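(* Let $n\ge1$ be an integer and let $U,W:\mathbb R^n\to[0,\infty]$ be Lebesgue measurable. Define $u$ and $w$ on $(0,\infty)$ by $u=U^*$ and $1/w=(1/W)^*$. Suppose $1<p<\infty$ and $0<q<p$, and suppose that there is a finite constant $C_1$ such that $$\bigg(\int_0^\infty\bigg(\int_0^{1/t} f\bigg)^q u(t)\,dt\bigg)^{1/q}\le C_1\bigg(\int_0^\infty f^p w\bigg)^{1/p}$$ for all non-negative measurable $f$ on $(0,\infty)$. If any one of the following conditions holds: (a) $q\ge2$; (b) $q>1$ and $p\le2$; (c) there exists a finite constant $\beta$ such that for all $y>0$, $$y^{q/2}\int_y^\infty u(x)\,\frac{dx}{x^{q/2}}\le\beta\bigg(\int_0^y u(x)\,dx+y^{\max(1,q)}\int_y^\infty u(x)\,\frac{dx}{x^{\max(1,q)}}\bigg);$$ (d) $u\in B_{q/2}$; (e) $q>1$ and $t^{2-q}u(t)$ is a decreasing function of $t$; (f) $q>1$ and there exists a finite constant $\beta$ such that for all $y>0$, $$y^{p'/2}\int_y^\infty w(x)^{1-p'}\,\frac{dx}{x^{p'/2}}\le\beta\bigg(\int_0^y w(x)^{1-p'}\,dx+y^{p'}\int_y^\infty w(x)^{1-p'}\,\frac{dx}{x^{p'}}\bigg);$$ (g) $q>1$ and $w^{1-p'}\in B_{p'/2}$; (h) $q>1$ and $t^{2-p'}w(t)^{1-p'}$ is a decreasing function of $t$; then there exists a finite constant $C$ such that $$\bigg(\int_{\mathbb R^n}|\hat f(y)|^qU(y)\,dy\bigg)^{1/q}\le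 C\bigg(\int_{\mathbb R^n}|f(x)|^pW(x)\,dx\bigg)^{1/p}$$ for all $f\in L^1(\mathbb R^n)$.
   Context: The Fourier transform of $f\in L^1(\mathbb R^n)$ is $\hat f(x)=\int_{\mathbb R^n}e^{-2\pi i x\cdot y}f(y)\,dy$. For a $\mu$-measurable function $f$, the non-increasing rearrangement is $f^*(t)=\inf\{\alpha>0:\mu_f(\alpha)\le t\}$, $t>0$, where $\mu_f(\alpha)=\mu\{x:|f(x)|>\alpha\}$; here $\mu$ is Lebesgue measure on $\mathbb R^n$. The functions $u$ and $w$ take values in $[0,\infty]$, $u$ is non-increasing and $w$ is non-decreasing. Conjugate indices: $1/p+1/p'=1$. For $s>0$, a non-negative function $f$ on $(0,\infty)$ is in $B_s$ if there exists a constant $\beta<\infty$ such that $y^s\int_y^\infty f(x)\,\frac{dx}{x^s}\le\beta\int_0^y f(x)\,dx$ for all $y>0$. "Decreasing" means non-increasing. Usual conventions: $1/0=\infty$, $1/\infty=0$, $0\cdot\infty=0$, negative powers of $0$ are $\infty$, and negative powers of $\infty$ are $0$. *)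

theory Defs
  imports "HOL-Analysis.Analysis"
begin

text \<open>Real powers on $[0,\infty]$. The library's \<^const>\<open>powr\<close> is not available on
  \<^typ>\<open>ennreal\<close>, and on \<^typ>\<open>real\<close> it satisfies \<^term>\<open>0 powr a = (0::real)\<close> also for negative
  \<^term>\<open>a\<close>; here negative powers of \<open>0\<close> are \<open>\<infinity>\<close> and negative powers of \<open>\<infinity>\<close> are \<open>0\<close>.\<close>

definition enn_powr :: "ennreal \<Rightarrow> real \<Rightarrow> ennreal"  (infixr "epowr" 80) where
  "x epowr a =
    (if a = 0 then 1
     else if x = 0 then (if a < 0 then \<infinity> else 0)
     else if x = \<infinity> then (if a < 0 then 0 else \<infinity>)
     else ennreal (enn2real x powr a))"

definition fourier :: "(real ^ 'n \<Rightarrow> complex) \<Rightarrow> real ^ 'n \<Rightarrow> complex" where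
  "fourier f x =
    (LINT y|lebesgue. exp (- 2 * complex_of_real pi * \<i> * complex_of_real (x \<bullet> y)) * f y)"

definition distribution_fun :: "'a measure \<Rightarrow> ('a \<Rightarrow> ennreal) \<Rightarrow> real \<Rightarrow> ennreal" where
  "distribution_fun M f \<alpha> = emeasure M {x \<in> space M. f x > ennreal \<alpha>}"

text \<open>The non-increasing rearrangement $f^*$, for functions with values in $[0,\infty]$ (so that
  $|f| = f$). The infimum over real \<open>\<alpha> > 0\<close> is taken in \<^typ>\<open>ennreal\<close>, so it is \<open>\<infinity>\<close> over the
  empty set.\<close>

definition rearrangement :: "'a measure \<Rightarrow> ('a \<Rightarrow> ennreal) \<Rightarrow> real \<Rightarrow> ennreal" where
  "rearrangement M f t = Inf {ennreal \<alpha> |\<alpha>. \<alpha> > 0 \<and> distribution_fun M f \<alpha> \<le> ennreal t}"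

text \<open>The class $B_s$, for \<open>s > 0\<close>. Functions on $(0,\infty)$ are represented by functions on
  \<^typ>\<open>real\<close> whose values outside $(0,\infty)$ are ignored.\<close>

definition B_class :: "real \<Rightarrow> (real \<Rightarrow> ennreal) set" where
  "B_class s = {f. \<exists>\<beta><\<infinity>. \<forall>y>0.
     ennreal (y powr s) * (\<integral>\<^sup>+x\<in>{y<..}. f x / ennreal (x powr s) \<partial>lebesgue)
       \<le> \<beta> * (\<integral>\<^sup>+x\<in>{0<..<y}. f x \<partial>lebesgue)}"

end

theory Submission
  imports Defs "HOL-Probability.Characteristic_Functions"
begin

text \<open>Write \<open>f^\<close> for the Fourier transform of \<open>f\<close>, \<open>\<rho> = f\<^sup>*\<close> and \<open>A\<rho>(t) = \<integral>\<^sub>0\<^sup>1\<^sup>/\<^sup>t \<rho>\<close>. Splitting \<open>f\<close> at the height \<open>\<rho>(1/z)\<close> and using the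
  $L^1$-$L^\infty$ and $L^2$ bounds of the Fourier transform gives
  \<open>\<integral>\<^sub>E |f^|\<^sup>2 \<le> 6 \<integral>\<^sub>0\<^sup>z (A\<rho>)\<^sup>2\<close> whenever \<open>|E| \<le> z\<close>. For \<open>q \<ge> 2\<close> this yields
  \<open>\<integral> |f^|\<^sup>q U \<le> C \<integral> (A\<rho>)\<^sup>q u\<close> by integrating over level sets. For \<open>q < 2\<close> one only gets
  \<open>\<integral> |f^|\<^sup>q U \<le> C \<integral> \<psi>\<^bsup>q/2\<^esup> u\<close>, where \<open>\<psi>(z)\<close> is the mean of \<open>(A\<rho>)\<^sup>2\<close> over \<open>(0, z)\<close>; since \<open>A\<rho>\<close> is
  quasi-concave it is comparable to a sum of functions \<open>c min(1, y/t)\<close> which is geometric at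
  each point, and condition (c) is what is needed to remove the mean from these functions.
  Together with the weighted inequality for \<open>A\<close> and \<open>\<integral> \<rho>\<^sup>p w \<le> \<integral> |f|\<^sup>p W\<close> this proves (a) and (c), and
  (d), (e) are special cases of these. Both the inequality for \<open>A\<close> and the Fourier inequality dualize
  (\<open>A\<close> is formally self-adjoint and \<open>\<integral> f^ g = \<integral> f g^\<close>), with \<open>p', q', w\<^bsup>1-p'\<^esup>, u\<^bsup>1-q'\<^esup>\<close> in place of \<open>q, p, u, w\<close>;
  this turns (b), (f), (g), (h) into (a), (c), (d), (e).\<close>

section \<open>Powers on the extended half-line\<close>

text \<open>Why (c) has its form: the mean over (0, z) of min(1, y/t)^2 is of size min(1, y/z), so
  averaging the square loses one power of decay. After the power q/2 a kink at y contributes the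
  integral of min(1, y/z)^(q/2) u, whereas the weighted inequality controls that of min(1, y/z)^q u.
  Such an integral with exponent r is the integral of u over (0, y) plus y^r times that of u(x)/x^r
  over (y, \<infinity>), so (c) amounts to comparing r = q/2 with r = max(1, q) on single kinks. The
  obstacle in the duality arguments is that weights may be 0 or \<infinity> and integrals may
  diverge, so norms cannot simply be divided out. Test functions are therefore truncated in height,
  in weight and in space, and the truncation is removed by monotone convergence. Weights on the
  half-line are tied to U and W only by implications between level sets: u is at least U*, and w is
  at most the increasing rearrangement of W. These implications survive negative powers, so the dual
  Fourier inequality is an instance of the direct one and no rearrangement of a dual weight is
  computed.\<close>

lemma epowr_0 [simp]: "x epowr 0 = 1"
  by (simp add: enn_powr_def)

lemma zero_epowr: "a > 0 \<Longrightarrow> 0 epowr a = 0"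
  by (simp add: enn_powr_def)

lemma zero_epowr_neg: "a < 0 \<Longrightarrow> 0 epowr a = \<infinity>"
  by (simp add: enn_powr_def)

lemma top_epowr: "a > 0 \<Longrightarrow> \<infinity> epowr a = \<infinity>" "a > 0 \<Longrightarrow> top epowr a = top"
  by (simp_all add: enn_powr_def)

lemma top_epowr_neg: "a < 0 \<Longrightarrow> \<infinity> epowr a = 0" "a < 0 \<Longrightarrow> top epowr a = 0"
  by (simp_all add: enn_powr_def)

lemma epowr_ennreal: "r > 0 \<Longrightarrow> ennreal r epowr a = ennreal (r powr a)"
  by (simp add: enn_powr_def)

lemma epowr_ennreal': "r \<ge> 0 \<Longrightarrow> a > 0 \<Longrightarrow> ennreal r epowr a = ennreal (r powr a)"
  by (cases "r = 0") (simp_all add: epowr_ennreal zero_epowr)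

lemma one_epowr [simp]: "1 epowr a = 1"
  using epowr_ennreal[of 1 a] by simp

lemma ennreal_cases3:
  fixes x :: ennreal
  obtains "x = 0" | r where "r > 0" "x = ennreal r" | "x = top"
  by (cases x) (metis ennreal_0 less_eq_real_def)

lemma epowr_one [simp]: "x epowr 1 = x"
  by (cases x rule: ennreal_cases3) (simp_all add: zero_epowr top_epowr epowr_ennreal)

lemma epowr_strict_mono:
  assumes "a > 0" "x < y"
  shows "x epowr a < y epowr a"
  using assms
  by (cases x rule: ennreal_cases3; cases y rule: ennreal_cases3)
     (auto simp: zero_epowr top_epowr epowr_ennreal ennreal_less_iff intro!: powr_less_mono2)

lemma epowr_less_iff: "a > 0 \<Longrightarrow> x epowr a < y epowr a \<longleftrightarrow> x < y"
  by (metis epowr_strict_mono not_less_iff_gr_or_eq)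

lemma epowr_le_iff: "a > 0 \<Longrightarrow> x epowr a \<le> y epowr a \<longleftrightarrow> x \<le> y"
  by (metis epowr_less_iff not_less)

lemma epowr_mono: "a \<ge> 0 \<Longrightarrow> x \<le> y \<Longrightarrow> x epowr a \<le> y epowr a"
  by (cases "a = 0") (simp_all add: epowr_le_iff)

lemma epowr_antimono:
  assumes "a \<le> 0" "x \<le> y"
  shows "y epowr a \<le> x epowr a"
  using assms
  by (cases x rule: ennreal_cases3; cases y rule: ennreal_cases3; cases "a = 0")
     (auto simp: zero_epowr_neg top_epowr_neg epowr_ennreal ennreal_le_iff top_unique intro!: powr_mono2')

text \<open>The sign condition reflects 0 * \<infinity> = 0: for x = 0, y = \<infinity> and a < 0
  the left side is \<infinity> and the right side is \<infinity> * 0 = 0.\<close>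

lemma epowr_mult: "a \<ge> 0 \<Longrightarrow> (x * y) epowr a = x epowr a * y epowr a"
  by (cases x rule: ennreal_cases3; cases y rule: ennreal_cases3; cases "a = 0")
     (auto simp: zero_epowr top_epowr epowr_ennreal ennreal_mult[symmetric] powr_mult
        ennreal_mult_top ennreal_top_mult)

text \<open>There is no sign condition, because a negative power merely exchanges 0 and \<infinity>.
  This recovers a weight from its dual: \<open>w = (w epowr (1 - p')) epowr (1 - p)\<close>.\<close>

lemma epowr_epowr: "(x epowr a) epowr b = x epowr (a * b)"
  by (cases x rule: ennreal_cases3; cases a "0::real" rule: linorder_cases;
      cases b "0::real" rule: linorder_cases)
     (auto simp: zero_epowr top_epowr zero_epowr_neg top_epowr_neg epowr_ennreal powr_powr
        mult_neg_neg mult_neg_pos mult_pos_neg)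

lemma epowr_add: "a \<ge> 0 \<Longrightarrow> b \<ge> 0 \<Longrightarrow> x epowr (a + b) = x epowr a * x epowr b"
  by (cases x rule: ennreal_cases3; cases "a = 0"; cases "b = 0")
     (auto simp: zero_epowr top_epowr epowr_ennreal ennreal_mult[symmetric] powr_add)

lemma epowr_2: "x epowr 2 = x\<^sup>2"
  using epowr_add[of 1 1 x] by (simp add: power2_eq_square)

lemma epowr_eq_0_iff: "a > 0 \<Longrightarrow> x epowr a = 0 \<longleftrightarrow> x = 0"
  by (cases x rule: ennreal_cases3) (simp_all add: zero_epowr top_epowr epowr_ennreal)

lemma epowr_eq_top_iff: "a > 0 \<Longrightarrow> x epowr a = top \<longleftrightarrow> x = top"
  by (cases x rule: ennreal_cases3) (simp_all add: zero_epowr top_epowr epowr_ennreal)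

lemma epowr_less_top: "a \<ge> 0 \<Longrightarrow> x < top \<Longrightarrow> x epowr a < top"
  by (cases "a = 0") (simp_all add: epowr_eq_top_iff flip: less_top)

lemma epowr_less_top_iff: "a > 0 \<Longrightarrow> x epowr a < top \<longleftrightarrow> x < top"
  using epowr_eq_top_iff[of a x] by (simp add: less_top[symmetric])

lemma one_divide_ennreal: "1 / x = x epowr (- 1)"
  by (cases x rule: ennreal_cases3)
     (simp_all add: zero_epowr_neg top_epowr_neg epowr_ennreal divide_ennreal_def inverse_ennreal powr_minus)

lemma epowr_inverse: "a > 0 \<Longrightarrow> (x epowr a) epowr (1 / a) = x" "a > 0 \<Longrightarrow> (x epowr (1 / a)) epowr a = x"
  by (simp_all add: epowr_epowr)

lemma le_epowr_iff: "a > 0 \<Longrightarrow> x \<le> y epowr a \<longleftrightarrow> x epowr (1 / a) \<le> y"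
  by (metis epowr_inverse(2) epowr_le_iff)

lemma epowr_le_iff': "a > 0 \<Longrightarrow> x epowr a \<le> y \<longleftrightarrow> x \<le> y epowr (1 / a)"
  by (metis epowr_inverse(2) epowr_le_iff)

lemma less_epowr_iff: "a > 0 \<Longrightarrow> x < y epowr a \<longleftrightarrow> x epowr (1 / a) < y"
  by (metis epowr_le_iff' not_less)

lemma epowr_measurable [measurable (raw)]:
  assumes f: "f \<in> borel_measurable M"
  shows "(\<lambda>x. f x epowr a) \<in> borel_measurable M"
  unfolding enn_powr_def using f by measurable

abbreviation head_int :: "(real \<Rightarrow> ennreal) \<Rightarrow> real \<Rightarrow> ennreal" where
  "head_int v y \<equiv> \<integral>\<^sup>+x\<in>{0<..<y}. v x \<partial>lborel"

abbreviation tail_int :: "real \<Rightarrow> (real \<Rightarrow> ennreal) \<Rightarrow> real \<Rightarrow> ennreal" where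
  "tail_int s v y \<equiv> \<integral>\<^sup>+x\<in>{y<..}. v x / ennreal (x powr s) \<partial>lborel"

abbreviation half_int :: "real \<Rightarrow> (real \<Rightarrow> ennreal) \<Rightarrow> (real \<Rightarrow> ennreal) \<Rightarrow> ennreal" where
  "half_int p w f \<equiv> \<integral>\<^sup>+t\<in>{0<..}. f t epowr p * w t \<partial>lborel"

abbreviation power_int :: "real \<Rightarrow> (real ^ 'n \<Rightarrow> ennreal) \<Rightarrow> (real ^ 'n \<Rightarrow> complex) \<Rightarrow> ennreal" where
  "power_int p W f \<equiv> \<integral>\<^sup>+x. ennreal (cmod (f x)) epowr p * W x \<partial>lebesgue"

section \<open>Integration over superlevel sets, with values in [0, \<infinity>]\<close>

lemma Collect_less_ennreal:
  "{t::real. 0 < t \<and> ennreal t < z} = (if z = top then {0<..} else {0<..<enn2real z})"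
  by (cases z) (auto simp: ennreal_less_iff)

lemma emeasure_Collect_less_ennreal: "emeasure lborel {t::real. 0 < t \<and> ennreal t < z} = z"
proof (cases z)
  case top
  have "emeasure lborel {0::real<..} \<ge> of_nat n" for n
  proof -
    have "of_nat n = emeasure lborel {0<..<real n}"
      by simp (simp add: ennreal_of_nat_eq_real_of_nat)
    also have "\<dots> \<le> emeasure lborel {0::real<..}"
      by (intro emeasure_mono) auto
    finally show ?thesis .
  qed
  then have "(SUP n. of_nat n) \<le> emeasure lborel {0::real<..}"
    by (intro SUP_least)
  then have "emeasure lborel {0::real<..} = top"
    by (simp add: ennreal_SUP_of_nat_eq_top top_unique)
  then show ?thesis using top by (simp add: Collect_less_ennreal greaterThan_def)
qed (simp add: Collect_less_ennreal)

lemma Collect_less_ennreal_sets [measurable]: "{t::real. 0 < t \<and> ennreal t < z} \<in> sets borel"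
  by (simp add: Collect_less_ennreal)

lemma nn_integral_indicator_ennreal: "(\<integral>\<^sup>+\<alpha>. indicator {0<..} \<alpha> * indicator {\<alpha>. ennreal \<alpha> < z} \<alpha> \<partial>lborel) = z"
proof -
  have "(\<integral>\<^sup>+\<alpha>. indicator {0<..} \<alpha> * indicator {\<alpha>. ennreal \<alpha> < z} \<alpha> \<partial>lborel)
      = (\<integral>\<^sup>+\<alpha>. indicator {t::real. 0 < t \<and> ennreal t < z} \<alpha> \<partial>lborel)"
    by (intro nn_integral_cong) (auto split: split_indicator)
  then show ?thesis by (simp add: emeasure_Collect_less_ennreal)
qed

text \<open>\<open>f x\<close> is the length of the set of heights below it; then Tonelli. The
  factor \<open>h\<close> is carried along because the later estimates bound integrals of
  \<open>h\<close> over sets, and the superlevel sets of a weight \<open>f\<close> are such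
  sets.\<close>

lemma (in sigma_finite_measure) layer_cake:
  fixes f h :: "'a \<Rightarrow> ennreal"
  assumes [measurable]: "f \<in> borel_measurable M" "h \<in> borel_measurable M"
  shows "(\<integral>\<^sup>+x. h x * f x \<partial>M)
       = (\<integral>\<^sup>+\<alpha>\<in>{0<..}. (\<integral>\<^sup>+x\<in>{x\<in>space M. f x > ennreal \<alpha>}. h x \<partial>M) \<partial>lborel)"
proof -
  interpret P: pair_sigma_finite lborel M by standard
  have "(\<integral>\<^sup>+x. h x * f x \<partial>M)
     = (\<integral>\<^sup>+x. (\<integral>\<^sup>+\<alpha>. h x * (indicator {0<..} \<alpha> * indicator {\<alpha>. ennreal \<alpha> < f x} \<alpha>) \<partial>lborel) \<partial>M)"
    by (subst nn_integral_cmult) (simp_all add: nn_integral_indicator_ennreal)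
  also have "\<dots> = (\<integral>\<^sup>+\<alpha>. (\<integral>\<^sup>+x. h x * (indicator {0<..} \<alpha> * indicator {\<alpha>. ennreal \<alpha> < f x} \<alpha>) \<partial>M) \<partial>lborel)"
    by (subst P.Fubini'[of "\<lambda>\<alpha> x. h x * (indicator {0<..} \<alpha> * indicator {\<alpha>. ennreal \<alpha> < f x} \<alpha>)"]) simp_all
  also have "\<dots> = (\<integral>\<^sup>+\<alpha>\<in>{0<..}. (\<integral>\<^sup>+x\<in>{x\<in>space M. f x > ennreal \<alpha>}. h x \<partial>M) \<partial>lborel)"
  proof (intro nn_integral_cong)
    fix \<alpha> :: real
    show "(\<integral>\<^sup>+x. h x * (indicator {0<..} \<alpha> * indicator {\<alpha>. ennreal \<alpha> < f x} \<alpha>) \<partial>M)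
      = (\<integral>\<^sup>+x\<in>{x\<in>space M. f x > ennreal \<alpha>}. h x \<partial>M) * indicator {0<..} \<alpha>"
      by (cases "\<alpha> > 0") (auto intro!: nn_integral_cong split: split_indicator)
  qed
  finally show ?thesis .
qed

lemma (in sigma_finite_measure) layer_cake_1:
  fixes f :: "'a \<Rightarrow> ennreal"
  assumes [measurable]: "f \<in> borel_measurable M"
  shows "(\<integral>\<^sup>+x. f x \<partial>M) = (\<integral>\<^sup>+\<alpha>\<in>{0<..}. emeasure M {x\<in>space M. f x > ennreal \<alpha>} \<partial>lborel)"
  using layer_cake[of f "\<lambda>_. 1"] by simp

text \<open>The two functions may live on different spaces, which is how functions on R^n are
  compared with rearrangements on the half-line.\<close>

lemma nn_integral_le_of_distribution:
  fixes f :: "'a \<Rightarrow> ennreal" and g :: "'b \<Rightarrow> ennreal"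
  assumes "sigma_finite_measure M" "sigma_finite_measure N"
    and [measurable]: "f \<in> borel_measurable M" "g \<in> borel_measurable N"
    and le: "\<And>\<alpha>. \<alpha> > 0 \<Longrightarrow> emeasure M {x\<in>space M. f x > ennreal \<alpha>} \<le> emeasure N {x\<in>space N. g x > ennreal \<alpha>}"
  shows "(\<integral>\<^sup>+x. f x \<partial>M) \<le> (\<integral>\<^sup>+x. g x \<partial>N)"
proof -
  interpret M: sigma_finite_measure M by fact
  interpret N: sigma_finite_measure N by fact
  show ?thesis
    by (subst M.layer_cake_1, simp, subst N.layer_cake_1, simp)
       (auto intro!: nn_integral_mono le split: split_indicator)
qed

section \<open>Layer cakes and rearrangements\<close>

abbreviation initial :: "ennreal \<Rightarrow> real set" where
  "initial z \<equiv> {t. 0 < t \<and> ennreal t < z}"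

lemma sigma_finite_lebesgue: "sigma_finite_measure (lebesgue :: 'a::euclidean_space measure)"
proof
  from lborel.sigma_finite_countable obtain A :: "'a set set" where A:
    "countable A" "A \<subseteq> sets lborel" "\<Union>A = space lborel" "\<forall>a\<in>A. emeasure lborel a \<noteq> \<infinity>"
    by auto
  then show "\<exists>A::'a set set. countable A \<and> A \<subseteq> sets lebesgue \<and> \<Union>A = space lebesgue \<and>
      (\<forall>a\<in>A. emeasure lebesgue a \<noteq> \<infinity>)"
    by (intro exI[of _ A]) auto
qed

lemma emeasure_Collect_le_ennreal: "emeasure lborel {t::real. 0 < t \<and> ennreal t \<le> z} = z"
proof (cases z)
  case (real r)
  then have "{t::real. 0 < t \<and> ennreal t \<le> z} = {0<..r}" by auto
  with real show ?thesis by simp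
next
  case top
  have "{t::real. 0 < t \<and> ennreal t \<le> z} = {t::real. 0 < t \<and> ennreal t < z}"
    using top by auto
  then show ?thesis using emeasure_Collect_less_ennreal[of z] by simp
qed

section \<open>Level sets of monotone functions and of rearrangements\<close>

lemma borel_measurable_antimono:
  fixes f :: "real \<Rightarrow> 'b::{second_countable_topology, linorder_topology}"
  assumes "antimono f"
  shows "f \<in> borel_measurable borel"
proof (rule borel_measurableI_greater)
  fix y
  have "is_interval {x. y < f x}"
    unfolding is_interval_1 using antimonoD[OF assms] by (meson mem_Collect_eq order_less_le_trans)
  then show "{x\<in>space borel. y < f x} \<in> sets borel"
    using real_interval_borel_measurable by simp
qed

lemma distribution_fun_antimono:
  assumes [measurable]: "f \<in> borel_measurable M" and "\<alpha> \<le> \<beta>"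
  shows "distribution_fun M f \<beta> \<le> distribution_fun M f \<alpha>"
  unfolding distribution_fun_def
  using ennreal_leI[OF \<open>\<alpha> \<le> \<beta>\<close>] by (intro emeasure_mono) (auto intro: order_le_less_trans)

text \<open>The strict inequalities match because the distribution function is right-continuous: the
  superlevel set at \<open>\<alpha>\<close> is the increasing union of those at \<alpha> + 1/(n+1),
  so a strict bound at \<open>\<alpha>\<close> persists at a slightly larger height.\<close>

lemma less_rearrangement_iff:
  assumes [measurable]: "f \<in> borel_measurable M" and "t \<ge> 0" "\<alpha> \<ge> 0"
  shows "ennreal \<alpha> < rearrangement M f t \<longleftrightarrow> ennreal t < emeasure M {x\<in>space M. f x > ennreal \<alpha>}"
proof
  assume *: "ennreal \<alpha> < rearrangement M f t"
  show "ennreal t < emeasure M {x\<in>space M. f x > ennreal \<alpha>}"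
  proof (rule ccontr)
    assume "\<not> ?thesis"
    then have D: "distribution_fun M f \<alpha> \<le> ennreal t"
      by (simp add: distribution_fun_def)
    have "rearrangement M f t \<le> ennreal \<beta>" if "\<beta> > \<alpha>" for \<beta>
      unfolding rearrangement_def
      using that \<open>\<alpha> \<ge> 0\<close> D distribution_fun_antimono[of f M \<alpha> \<beta>]
      by (intro Inf_lower) (auto intro!: exI[of _ \<beta>])
    moreover obtain \<gamma> where "ennreal \<alpha> < \<gamma>" "\<gamma> < rearrangement M f t"
      using dense[OF *] by auto
    moreover from this have "\<gamma> = ennreal (enn2real \<gamma>)" "enn2real \<gamma> > \<alpha>"
      using \<open>\<alpha> \<ge> 0\<close> by (cases \<gamma>; auto simp: ennreal_less_iff)+
    ultimately show False
      by (metis not_less)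
  qed
next
  assume t: "ennreal t < emeasure M {x\<in>space M. f x > ennreal \<alpha>}"
  have "{x\<in>space M. f x > ennreal \<alpha>} = (\<Union>n. {x\<in>space M. f x > ennreal (\<alpha> + 1 / Suc n)})" (is "_ = (\<Union>n. ?A n)")
  proof (intro equalityI subsetI)
    fix x assume x: "x \<in> {x\<in>space M. f x > ennreal \<alpha>}"
    then obtain \<gamma> where "ennreal \<alpha> < \<gamma>" "\<gamma> < f x"
      using dense by blast
    then obtain r where r: "\<alpha> < r" "ennreal r < f x"
      using \<open>\<alpha> \<ge> 0\<close> by (cases \<gamma>) (auto simp: ennreal_less_iff)
    then obtain n where "1 / Suc n < r - \<alpha>"
      by (metis diff_gt_0_iff_gt inverse_eq_divide reals_Archimedean)
    then have "ennreal (\<alpha> + 1 / Suc n) \<le> ennreal r"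
      by (intro ennreal_leI) simp
    with r x show "x \<in> (\<Union>n. ?A n)"
      by (auto intro: order_le_less_trans)
  next
    fix x assume "x \<in> (\<Union>n. ?A n)"
    then obtain n where "x \<in> ?A n" by auto
    moreover have "ennreal \<alpha> \<le> ennreal (\<alpha> + 1 / Suc n)"
      by (intro ennreal_leI) simp
    ultimately show "x \<in> {x\<in>space M. f x > ennreal \<alpha>}"
      by (auto intro: order_le_less_trans)
  qed
  moreover have "incseq ?A"
  proof (rule incseq_SucI)
    fix n
    have "ennreal (\<alpha> + 1 / Suc (Suc n)) \<le> ennreal (\<alpha> + 1 / Suc n)"
      by (intro ennreal_leI) (simp add: frac_le)
    then show "?A n \<le> ?A (Suc n)" by (auto intro: order_le_less_trans)
  qed
  ultimately have "emeasure M {x\<in>space M. f x > ennreal \<alpha>} = (SUP n. emeasure M (?A n))"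
    by (subst SUP_emeasure_incseq) (auto simp: image_subset_iff)
  with t obtain n where n: "ennreal t < emeasure M (?A n)"
    by (auto simp: less_SUP_iff)
  have "ennreal (\<alpha> + 1 / Suc n) \<le> rearrangement M f t"
    unfolding rearrangement_def
  proof (rule Inf_greatest, safe)
    fix \<beta> :: real assume "\<beta> > 0" "distribution_fun M f \<beta> \<le> ennreal t"
    then have "\<not> \<beta> \<le> \<alpha> + 1 / Suc n"
      using distribution_fun_antimono[of f M \<beta> "\<alpha> + 1 / Suc n"] n
      by (auto simp: distribution_fun_def)
    then show "ennreal (\<alpha> + 1 / Suc n) \<le> ennreal \<beta>"
      by (intro ennreal_leI) simp
  qed
  moreover have "ennreal \<alpha> < ennreal (\<alpha> + 1 / Suc n)"
    using \<open>\<alpha> \<ge> 0\<close> by (intro ennreal_lessI add_nonneg_pos) auto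
  ultimately show "ennreal \<alpha> < rearrangement M f t" by simp
qed

lemma antimono_rearrangement: "antimono (rearrangement M f)"
proof (rule antimonoI)
  fix s t :: real assume "s \<le> t"
  then have "ennreal s \<le> ennreal t" by (rule ennreal_leI)
  then show "rearrangement M f t \<le> rearrangement M f s"
    unfolding rearrangement_def by (intro Inf_superset_mono) (auto intro: order_trans)
qed

lemma borel_measurable_rearrangement [measurable]: "rearrangement M f \<in> borel_measurable borel"
  by (intro borel_measurable_antimono antimono_rearrangement)

text \<open>Superlevel sets of a weight may have infinite measure, while the set estimates are
  proved for finite measure; exhaustion and monotone convergence bridge the gap.\<close>

lemma (in sigma_finite_measure) nn_integral_le_of_finite_sets:
  assumes [measurable]: "h \<in> borel_measurable M" "H \<in> borel_measurable borel"
    and le: "\<And>E. E \<in> sets M \<Longrightarrow> emeasure M E < \<infinity> \<Longrightarrow>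
      (\<integral>\<^sup>+x\<in>E. h x \<partial>M) \<le> K * (\<integral>\<^sup>+t\<in>initial (emeasure M E). H t \<partial>lborel)"
    and [measurable]: "E \<in> sets M"
  shows "(\<integral>\<^sup>+x\<in>E. h x \<partial>M) \<le> K * (\<integral>\<^sup>+t\<in>initial (emeasure M E). H t \<partial>lborel)"
proof -
  obtain A :: "nat \<Rightarrow> 'a set" where A: "range A \<subseteq> sets M" "(\<Union>i. A i) = space M"
    "\<And>i. emeasure M (A i) \<noteq> \<infinity>" "incseq A"
    using sigma_finite_incseq by blast
  then have [measurable]: "A i \<in> sets M" for i by auto
  have "(\<integral>\<^sup>+x\<in>E. h x \<partial>M) = (\<integral>\<^sup>+x. (SUP i. h x * indicator (E \<inter> A i) x) \<partial>M)"
  proof (intro nn_integral_cong)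
    fix x assume "x \<in> space M"
    then obtain j where j: "x \<in> A j" using A(2) by blast
    have "(SUP i. h x * indicator (E \<inter> A i) x) \<le> h x * indicator E x"
      by (intro SUP_least) (auto split: split_indicator)
    moreover have "h x * indicator E x \<le> (SUP i. h x * indicator (E \<inter> A i) x)"
      using j by (intro SUP_upper2[of j]) (auto split: split_indicator)
    ultimately show "h x * indicator E x = (SUP i. h x * indicator (E \<inter> A i) x)"
      by (rule antisym[rotated])
  qed
  also have "\<dots> = (SUP i. \<integral>\<^sup>+x\<in>E \<inter> A i. h x \<partial>M)"
    using \<open>incseq A\<close> unfolding incseq_def
    by (intro nn_integral_monotone_convergence_SUP)
       (auto simp: incseq_def le_fun_def split: split_indicator)
  also have "\<dots> \<le> K * (\<integral>\<^sup>+t\<in>initial (emeasure M E). H t \<partial>lborel)"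
  proof (rule SUP_least)
    fix i
    have "emeasure M (E \<inter> A i) \<le> emeasure M (A i)" by (intro emeasure_mono) auto
    then have fin: "emeasure M (E \<inter> A i) < \<infinity>" by (rule order_le_less_trans) (use A(3)[of i] in \<open>simp add: less_top\<close>)
    have E: "emeasure M (E \<inter> A i) \<le> emeasure M E" by (intro emeasure_mono) auto
    have "(\<integral>\<^sup>+x\<in>E \<inter> A i. h x \<partial>M) \<le> K * (\<integral>\<^sup>+t\<in>initial (emeasure M (E \<inter> A i)). H t \<partial>lborel)"
      by (rule le) (use fin in auto)
    also have "\<dots> \<le> K * (\<integral>\<^sup>+t\<in>initial (emeasure M E). H t \<partial>lborel)"
      using E by (intro mult_left_mono nn_integral_mono) (auto split: split_indicator)
    finally show "(\<integral>\<^sup>+x\<in>E \<inter> A i. h x \<partial>M) \<le> K * (\<integral>\<^sup>+t\<in>initial (emeasure M E). H t \<partial>lborel)" .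
  qed
  finally show ?thesis .
qed

text \<open>The layer cake of \<open>U\<close> reduces the left side to the set estimate on
  superlevel sets of \<open>U\<close>. After exchanging the integrals, a point t is counted for the
  heights \<open>\<alpha>\<close> with t < |{U > \<alpha>}|, and these lie below \<open>u t\<close>.
  The hypothesis on \<open>u\<close> says that \<open>u\<close> is at least the rearrangement of
  \<open>U\<close>.\<close>

lemma (in sigma_finite_measure) nn_integral_mult_le_rearranged:
  assumes [measurable]: "h \<in> borel_measurable M" "U \<in> borel_measurable M"
      "H \<in> borel_measurable borel" "u \<in> borel_measurable borel"
    and u: "\<And>t \<alpha>. 0 < t \<Longrightarrow> 0 < \<alpha> \<Longrightarrow> ennreal t < emeasure M {x\<in>space M. U x > ennreal \<alpha>} \<Longrightarrow> ennreal \<alpha> \<le> u t"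
    and le: "\<And>E. E \<in> sets M \<Longrightarrow> emeasure M E < \<infinity> \<Longrightarrow>
      (\<integral>\<^sup>+x\<in>E. h x \<partial>M) \<le> K * (\<integral>\<^sup>+t\<in>initial (emeasure M E). H t \<partial>lborel)"
  shows "(\<integral>\<^sup>+x. h x * U x \<partial>M) \<le> K * (\<integral>\<^sup>+t\<in>{0<..}. H t * u t \<partial>lborel)"
proof -
  define D where "D \<alpha> = emeasure M {x\<in>space M. U x > ennreal \<alpha>}" for \<alpha>
  have "antimono D"
    unfolding D_def using distribution_fun_antimono[of U M]
    by (auto simp: antimono_def distribution_fun_def)
  then have [measurable]: "D \<in> borel_measurable borel" by (rule borel_measurable_antimono)
  have "(\<integral>\<^sup>+x. h x * U x \<partial>M) = (\<integral>\<^sup>+\<alpha>\<in>{0<..}. (\<integral>\<^sup>+x\<in>{x\<in>space M. U x > ennreal \<alpha>}. h x \<partial>M) \<partial>lborel)"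
    by (rule layer_cake) simp_all
  also have "\<dots> \<le> (\<integral>\<^sup>+\<alpha>\<in>{0<..}. (K * (\<integral>\<^sup>+t\<in>initial (D \<alpha>). H t \<partial>lborel)) \<partial>lborel)"
    unfolding D_def
    by (intro nn_integral_mono mult_right_mono nn_integral_le_of_finite_sets[OF assms(1) assms(3) le]) auto
  also have "\<dots> = (\<integral>\<^sup>+\<alpha>. K * ((\<integral>\<^sup>+t\<in>initial (D \<alpha>). H t \<partial>lborel) * indicator {0<..} \<alpha>) \<partial>lborel)"
    by (simp only: mult.assoc)
  also have "\<dots> = K * (\<integral>\<^sup>+\<alpha>\<in>{0<..}. (\<integral>\<^sup>+t\<in>initial (D \<alpha>). H t \<partial>lborel) \<partial>lborel)"
    by (rule nn_integral_cmult) measurable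
  also have "\<dots> = K * (\<integral>\<^sup>+\<alpha>. (\<integral>\<^sup>+t. H t * indicator (initial (D \<alpha>)) t * indicator {0<..} \<alpha> \<partial>lborel) \<partial>lborel)"
    by (subst nn_integral_multc) simp_all
  also have "\<dots> = K * (\<integral>\<^sup>+t. (\<integral>\<^sup>+\<alpha>. H t * indicator (initial (D \<alpha>)) t * indicator {0<..} \<alpha> \<partial>lborel) \<partial>lborel)"
    by (subst lborel_pair.Fubini') simp_all
  also have "\<dots> \<le> K * (\<integral>\<^sup>+t. H t * u t * indicator {0<..} t \<partial>lborel)"
  proof (intro mult_left_mono nn_integral_mono)
    fix t :: real
    have "(\<integral>\<^sup>+\<alpha>. H t * indicator (initial (D \<alpha>)) t * indicator {0<..} \<alpha> \<partial>lborel)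
      \<le> (\<integral>\<^sup>+\<alpha>. H t * indicator {0<..} t * indicator {\<alpha>. 0 < \<alpha> \<and> ennreal \<alpha> \<le> u t} \<alpha> \<partial>lborel)"
      using u by (intro nn_integral_mono) (auto simp: D_def split: split_indicator)
    also have "\<dots> = H t * u t * indicator {0<..} t"
      by (subst nn_integral_cmult) (simp_all add: emeasure_Collect_le_ennreal mult_ac)
    finally show "(\<integral>\<^sup>+\<alpha>. H t * indicator (initial (D \<alpha>)) t * indicator {0<..} \<alpha> \<partial>lborel)
      \<le> H t * u t * indicator {0<..} t" .
  qed auto
  finally show ?thesis .
qed

text \<open>Here \<open>w\<close> is at most the increasing rearrangement of \<open>W\<close>, so
  its integral over an initial interval collects the smallest values. On (0, |E|) the set where w >
  \<alpha> misses an initial interval of length |{x in E. W x <= \<alpha>}|; finiteness of |E|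
  allows the subtraction of measures.\<close>

lemma (in sigma_finite_measure) nn_integral_initial_le:
  assumes [measurable]: "W \<in> borel_measurable M" "w \<in> borel_measurable borel"
    and w: "\<And>t \<alpha>. 0 < t \<Longrightarrow> 0 < \<alpha> \<Longrightarrow> ennreal t < emeasure M {x\<in>space M. W x \<le> ennreal \<alpha>} \<Longrightarrow> w t \<le> ennreal \<alpha>"
    and [measurable]: "E \<in> sets M" and fin: "emeasure M E < \<infinity>"
  shows "(\<integral>\<^sup>+t\<in>initial (emeasure M E). w t \<partial>lborel) \<le> (\<integral>\<^sup>+x\<in>E. W x \<partial>M)"
proof (rule nn_integral_le_of_distribution)
  fix \<alpha> :: real assume "\<alpha> > 0"
  let ?c = "emeasure M {x\<in>E. W x \<le> ennreal \<alpha>}"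
  have sets[measurable]: "{x\<in>E. W x \<le> ennreal \<alpha>} \<in> sets M"
    using sets.sets_into_space[OF \<open>E \<in> sets M\<close>] by (auto simp: Int_def[symmetric] intro!: sets.sets_Collect)
  have c: "?c \<le> emeasure M {x\<in>space M. W x \<le> ennreal \<alpha>}" "?c \<le> emeasure M E"
    using sets.sets_into_space[OF \<open>E \<in> sets M\<close>] by (auto intro!: emeasure_mono)
  have "{t\<in>space lborel. w t * indicator (initial (emeasure M E)) t > ennreal \<alpha>}
      \<subseteq> initial (emeasure M E) - initial ?c"
    using w[OF _ \<open>\<alpha> > 0\<close>] c by (fastforce split: split_indicator_asm)
  then have "emeasure lborel {t\<in>space lborel. w t * indicator (initial (emeasure M E)) t > ennreal \<alpha>}
    \<le> emeasure lborel (initial (emeasure M E) - initial ?c)"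
    by (intro emeasure_mono) simp_all
  also have "\<dots> = emeasure M E - ?c"
    using fin c by (subst emeasure_Diff) (auto simp: emeasure_Collect_less_ennreal top_unique)
  also have "\<dots> = emeasure M (E - {x\<in>E. W x \<le> ennreal \<alpha>})"
    using fin c by (subst emeasure_Diff) (auto simp: top_unique)
  also have "E - {x\<in>E. W x \<le> ennreal \<alpha>} = {x\<in>space M. W x * indicator E x > ennreal \<alpha>}"
    using sets.sets_into_space[OF \<open>E \<in> sets M\<close>] by (auto split: split_indicator_asm)
  finally show "emeasure lborel {t\<in>space lborel. w t * indicator (initial (emeasure M E)) t > ennreal \<alpha>}
    \<le> emeasure M {x\<in>space M. W x * indicator E x > ennreal \<alpha>}" .
qed (simp_all add: lborel.sigma_finite_measure_axioms sigma_finite_measure_axioms)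

text \<open>Counterpart for the right-hand weight: superlevel sets of \<open>\<rho>\<close> lie in
  initial intervals of length |{k > \<alpha>}|, on which the previous lemma compares
  \<open>w\<close> with \<open>W\<close>.\<close>

lemma (in sigma_finite_measure) nn_integral_rearranged_mult_le:
  assumes [measurable]: "k \<in> borel_measurable M" "W \<in> borel_measurable M"
      "\<rho> \<in> borel_measurable borel" "w \<in> borel_measurable borel"
    and w: "\<And>t \<alpha>. 0 < t \<Longrightarrow> 0 < \<alpha> \<Longrightarrow> ennreal t < emeasure M {x\<in>space M. W x \<le> ennreal \<alpha>} \<Longrightarrow> w t \<le> ennreal \<alpha>"
    and \<rho>: "\<And>t \<alpha>. 0 < t \<Longrightarrow> 0 < \<alpha> \<Longrightarrow> ennreal \<alpha> < \<rho> t \<Longrightarrow> ennreal t < emeasure M {x\<in>space M. k x > ennreal \<alpha>}"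
    and fin: "\<And>\<alpha>. 0 < \<alpha> \<Longrightarrow> emeasure M {x\<in>space M. k x > ennreal \<alpha>} < \<infinity>"
  shows "(\<integral>\<^sup>+t\<in>{0<..}. \<rho> t * w t \<partial>lborel) \<le> (\<integral>\<^sup>+x. k x * W x \<partial>M)"
proof -
  have "(\<integral>\<^sup>+t\<in>{0<..}. \<rho> t * w t \<partial>lborel) = (\<integral>\<^sup>+t. (w t * indicator {0<..} t) * \<rho> t \<partial>lborel)"
    by (simp add: mult_ac)
  also have "\<dots> = (\<integral>\<^sup>+\<alpha>\<in>{0<..}. (\<integral>\<^sup>+t\<in>{t\<in>space lborel. \<rho> t > ennreal \<alpha>}. (w t * indicator {0<..} t) \<partial>lborel) \<partial>lborel)"
    by (rule lborel.layer_cake) simp_all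
  also have "\<dots> \<le> (\<integral>\<^sup>+\<alpha>\<in>{0<..}. (\<integral>\<^sup>+x\<in>{x\<in>space M. k x > ennreal \<alpha>}. W x \<partial>M) \<partial>lborel)"
  proof (intro nn_integral_mono)
    fix \<alpha> :: real
    have "(\<integral>\<^sup>+t\<in>{t\<in>space lborel. \<rho> t > ennreal \<alpha>}. (w t * indicator {0<..} t) \<partial>lborel)
      \<le> (\<integral>\<^sup>+x\<in>{x\<in>space M. k x > ennreal \<alpha>}. W x \<partial>M)" if "\<alpha> > 0"
    proof -
      have "(\<integral>\<^sup>+t\<in>{t\<in>space lborel. \<rho> t > ennreal \<alpha>}. (w t * indicator {0<..} t) \<partial>lborel)
         \<le> (\<integral>\<^sup>+t\<in>initial (emeasure M {x\<in>space M. k x > ennreal \<alpha>}). w t \<partial>lborel)"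
        using \<rho>[OF _ that] by (intro nn_integral_mono) (auto split: split_indicator)
      also have "\<dots> \<le> (\<integral>\<^sup>+x\<in>{x\<in>space M. k x > ennreal \<alpha>}. W x \<partial>M)"
        using fin[OF that] by (intro nn_integral_initial_le w) auto
      finally show ?thesis .
    qed
    then show "(\<integral>\<^sup>+t\<in>{t\<in>space lborel. \<rho> t > ennreal \<alpha>}. (w t * indicator {0<..} t) \<partial>lborel) * indicator {0<..} \<alpha>
      \<le> (\<integral>\<^sup>+x\<in>{x\<in>space M. k x > ennreal \<alpha>}. W x \<partial>M) * indicator {0<..} \<alpha>"
      by (auto split: split_indicator)
  qed
  also have "\<dots> = (\<integral>\<^sup>+x. W x * k x \<partial>M)"
    by (rule layer_cake[symmetric]) simp_all
  finally show ?thesis by (simp add: mult.commute)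
qed

section \<open>The $L^2$ bound for the Fourier transform\<close>

text \<open>Fubini is used on the product of two completed measures, since \<open>f\<close> is only
  Lebesgue measurable; kernels and translates are Borel on the product space and enter through this
  lemma.\<close>

lemma borel_measurable_lebesgue_pair:
  fixes g :: "'a::euclidean_space \<times> 'b::euclidean_space \<Rightarrow> 'c::topological_space"
  assumes "g \<in> borel_measurable borel"
  shows "g \<in> borel_measurable (lebesgue \<Otimes>\<^sub>M lebesgue)"
proof -
  have "(\<lambda>p. (fst p, snd p)) \<in> (lebesgue \<Otimes>\<^sub>M lebesgue) \<rightarrow>\<^sub>M (borel \<Otimes>\<^sub>M borel :: ('a \<times> 'b) measure)"
    by (intro measurable_Pair measurable_compose[OF measurable_fst] measurable_compose[OF measurable_snd])
       (simp_all add: measurable_completion)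
  from measurable_compose[OF this, of g borel] assms show ?thesis
    by (simp add: borel_prod)
qed

section \<open>The Fourier kernel and the multiplication formula\<close>

definition fkernel :: "real ^ 'n \<Rightarrow> real ^ 'n \<Rightarrow> complex" where
  "fkernel x y = exp (- 2 * complex_of_real pi * \<i> * complex_of_real (x \<bullet> y))"

lemma fourier_fkernel: "fourier f x = (LINT y|lebesgue. fkernel x y * f y)"
  by (simp add: fourier_def fkernel_def)

lemma fkernel_commute: "fkernel x y = fkernel y x"
  by (simp add: fkernel_def inner_commute)

lemma norm_fkernel [simp]: "cmod (fkernel x y) = 1"
  by (simp add: fkernel_def norm_exp_eq_Re)

lemma fkernel_add: "fkernel x (y + z) = fkernel x y * fkernel x z"
  by (simp add: fkernel_def inner_add_right exp_add[symmetric] algebra_simps)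

lemma cnj_fkernel: "cnj (fkernel x y) = fkernel x (- y)"
  by (simp add: fkernel_def exp_cnj)

lemma continuous_fkernel: "continuous_on UNIV (\<lambda>p. fkernel (fst p) (snd p))"
  unfolding fkernel_def by (intro continuous_intros)

lemma fkernel_measurable_pair [measurable]:
  "(\<lambda>p. fkernel (fst p) (snd p)) \<in> borel_measurable (lebesgue \<Otimes>\<^sub>M lebesgue)"
  by (intro borel_measurable_lebesgue_pair borel_measurable_continuous_onI continuous_fkernel)

lemma fkernel_measurable [measurable]: "fkernel x \<in> borel_measurable borel"
  unfolding fkernel_def by (intro borel_measurable_continuous_onI continuous_intros)

lemma fkernel_measurable_lebesgue [measurable]: "fkernel x \<in> borel_measurable lebesgue"
  by (simp add: measurable_completion)

lemma integrable_fkernel_mult: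
  "integrable lebesgue f \<Longrightarrow> integrable lebesgue (\<lambda>y. fkernel x y * f y)"
  by (rule Bochner_Integration.integrable_bound[of _ f]) (auto simp: norm_mult)

lemma norm_fourier_le:
  assumes "integrable lebesgue f"
  shows "ennreal (cmod (fourier f x)) \<le> (\<integral>\<^sup>+y. ennreal (cmod (f y)) \<partial>lebesgue)"
  unfolding fourier_fkernel
  using integral_norm_bound_ennreal[OF integrable_fkernel_mult[OF assms], of x]
  by (simp add: norm_mult)

lemma fourier_add:
  assumes "integrable lebesgue f" "integrable lebesgue g"
  shows "fourier (\<lambda>y. f y + g y) x = fourier f x + fourier g x"
  unfolding fourier_fkernel
  using assms by (simp add: distrib_left integrable_fkernel_mult)

lemma fourier_measurable [measurable]:
  fixes f :: "real ^ 'n \<Rightarrow> complex"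
  assumes [measurable]: "f \<in> borel_measurable lebesgue"
  shows "fourier f \<in> borel_measurable lebesgue"
proof -
  interpret sigma_finite_measure "lebesgue :: (real ^ 'n) measure" by (rule sigma_finite_lebesgue)
  have "(\<lambda>x. LINT y|lebesgue. fkernel x y * f y) \<in> borel_measurable lebesgue"
    by (rule borel_measurable_lebesgue_integral) (simp add: split_beta)
  then show ?thesis by (simp add: fourier_fkernel[abs_def])
qed

text \<open>Fubini and the symmetry of the kernel, whose modulus 1 makes the double integral
  absolutely convergent.\<close>

lemma fourier_mult_formula:
  fixes f g :: "real ^ 'n \<Rightarrow> complex"
  assumes f: "integrable lebesgue f" and g: "integrable lebesgue g"
  shows "(LINT x|lebesgue. fourier f x * g x) = (LINT y|lebesgue. f y * fourier g y)"
proof -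
  interpret L: sigma_finite_measure "lebesgue :: (real ^ 'n) measure" by (rule sigma_finite_lebesgue)
  interpret P: pair_sigma_finite "lebesgue :: (real ^ 'n) measure" "lebesgue :: (real ^ 'n) measure"
    by standard
  have [measurable]: "f \<in> borel_measurable lebesgue" "g \<in> borel_measurable lebesgue"
    using f g by auto
  have int: "integrable (lebesgue \<Otimes>\<^sub>M lebesgue) (\<lambda>(x, y). fkernel x y * f y * g x)"
  proof (rule P.Fubini_integrable)
    show "integrable lebesgue (\<lambda>x. LINT y|lebesgue. norm (case (x, y) of (x, y) \<Rightarrow> fkernel x y * f y * g x))"
      using f g by (simp add: norm_mult)
    show "AE x in lebesgue. integrable lebesgue (\<lambda>y. case (x, y) of (x, y) \<Rightarrow> fkernel x y * f y * g x)"
      using integrable_fkernel_mult[OF f] by simp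
  qed (simp add: split_beta)
  have "(LINT x|lebesgue. fourier f x * g x) = (LINT x|lebesgue. LINT y|lebesgue. fkernel x y * f y * g x)"
    unfolding fourier_fkernel by simp
  also have "\<dots> = (LINT y|lebesgue. LINT x|lebesgue. fkernel x y * f y * g x)"
    by (rule P.Fubini_integral[OF int, symmetric])
  also have "\<dots> = (LINT y|lebesgue. LINT x|lebesgue. f y * (fkernel y x * g x))"
    by (simp add: fkernel_commute mult_ac)
  also have "\<dots> = (LINT y|lebesgue. f y * fourier g y)"
    unfolding fourier_fkernel by simp
  finally show ?thesis .
qed

text \<open>This is the characteristic function of the standard normal law at -2 \<pi> y / e after
  the substitution x -> e x; the outcome is the normal density of standard deviation e / (2
  \<pi>).\<close>

lemma fourier_gaussian_1:
  fixes e y :: real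
  assumes "e > 0"
  shows "integrable lborel (\<lambda>x. iexp (y * x) * complex_of_real (exp (- (e * x)\<^sup>2 / 2)))"
    and "(LINT x|lborel. iexp (- 2 * pi * y * x) * complex_of_real (exp (- (e * x)\<^sup>2 / 2)))
       = complex_of_real (normal_density 0 (e / (2 * pi)) y)"
proof -
  have int: "integrable lborel (\<lambda>x. iexp (y * x) * complex_of_real (exp (- (e * x)\<^sup>2 / 2)))" for y
  proof (rule Bochner_Integration.integrable_bound)
    show "integrable lborel (\<lambda>x. sqrt (2 * pi * (1 / e)\<^sup>2) * normal_density 0 (1 / e) x)"
      using assms by (intro integrable_mult_right integrable_normal_density) auto
    show "AE x in lborel. norm (iexp (y * x) * complex_of_real (exp (- (e * x)\<^sup>2 / 2)))
       \<le> norm (sqrt (2 * pi * (1 / e)\<^sup>2) * normal_density 0 (1 / e) x)"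
      using assms by (simp add: normal_density_def norm_mult power_mult_distrib power_divide mult.commute)
  qed simp
  then show "integrable lborel (\<lambda>x. iexp (y * x) * complex_of_real (exp (- (e * x)\<^sup>2 / 2)))" .
  have "complex_of_real (exp (- (2 * pi * y / e)\<^sup>2 / 2)) = char std_normal_distribution (- 2 * pi * y / e)"
    by (subst char_std_normal_distribution) (simp add: exp_of_real)
  also have "\<dots> = (LINT x|lborel. std_normal_density x *\<^sub>R iexp (- 2 * pi * y / e * x))"
    unfolding char_def by (subst integral_density) auto
  also have "\<dots> = \<bar>e\<bar> *\<^sub>R (LINT x|lborel. std_normal_density (0 + e * x) *\<^sub>R iexp (- 2 * pi * y / e * (0 + e * x)))"
    using assms by (subst lborel_integral_real_affine[where c=e and t=0]) simp_all
  also have "(\<lambda>x. std_normal_density (0 + e * x) *\<^sub>R iexp (- 2 * pi * y / e * (0 + e * x)))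
    = (\<lambda>x. complex_of_real (1 / sqrt (2 * pi)) * (iexp (- 2 * pi * y * x) * complex_of_real (exp (- (e * x)\<^sup>2 / 2))))"
    using assms by (auto simp: std_normal_density_def scaleR_conv_of_real mult_ac)
  also have "\<bar>e\<bar> *\<^sub>R (LINT x|lborel. complex_of_real (1 / sqrt (2 * pi)) * (iexp (- 2 * pi * y * x) * complex_of_real (exp (- (e * x)\<^sup>2 / 2))))
    = complex_of_real (e / sqrt (2 * pi)) * (LINT x|lborel. iexp (- 2 * pi * y * x) * complex_of_real (exp (- (e * x)\<^sup>2 / 2)))"
    using assms by (simp add: scaleR_conv_of_real)
  finally have eq: "complex_of_real (exp (- (2 * pi * y / e)\<^sup>2 / 2)) =
    complex_of_real (e / sqrt (2 * pi)) * (LINT x|lborel. iexp (- 2 * pi * y * x) * complex_of_real (exp (- (e * x)\<^sup>2 / 2)))" .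
  have "complex_of_real (sqrt (2 * pi) / e) * complex_of_real (e / sqrt (2 * pi)) = 1"
    using assms by (simp flip: of_real_mult)
  then have "(LINT x|lborel. iexp (- 2 * pi * y * x) * complex_of_real (exp (- (e * x)\<^sup>2 / 2)))
    = complex_of_real (sqrt (2 * pi) / e) * complex_of_real (exp (- (2 * pi * y / e)\<^sup>2 / 2))"
    unfolding eq mult.assoc[symmetric] by simp
  also have "\<dots> = complex_of_real (sqrt (2 * pi) / e * exp (- (2 * pi * y / e)\<^sup>2 / 2))"
    by simp
  also have "sqrt (2 * pi) / e * exp (- (2 * pi * y / e)\<^sup>2 / 2) = normal_density 0 (e / (2 * pi)) y"
  proof -
    have "2 * pi * (e / (2 * pi))\<^sup>2 = e\<^sup>2 / (2 * pi)"
      by (simp add: power2_eq_square)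
    moreover have "- (2 * pi * y / e)\<^sup>2 / 2 = - y\<^sup>2 / (2 * (e / (2 * pi))\<^sup>2)"
      using assms by (simp add: field_simps power2_eq_square)
    ultimately show ?thesis
      using assms by (simp add: normal_density_def real_sqrt_divide)
  qed
  finally show "(LINT x|lborel. iexp (- 2 * pi * y * x) * complex_of_real (exp (- (e * x)\<^sup>2 / 2)))
       = complex_of_real (normal_density 0 (e / (2 * pi)) y)" .
qed

section \<open>Gaussians in several variables, as products over the coordinates\<close>

lemma
  fixes f :: "'a::euclidean_space \<Rightarrow> real \<Rightarrow> complex"
  assumes int: "\<And>b. b \<in> Basis \<Longrightarrow> integrable lborel (f b)"
  shows integral_lborel_prod: "(LINT x|lborel. (\<Prod>b\<in>Basis. f b (x \<bullet> b))) = (\<Prod>b\<in>Basis. LINT x|lborel. f b x)"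
    and integrable_lborel_prod: "integrable lborel (\<lambda>x. \<Prod>b\<in>Basis. f b (x \<bullet> b))"
proof -
  interpret product_sigma_finite "\<lambda>_::'a. interval_measure (\<lambda>x. x)"
    by (metis lborel_eq_real product_sigma_finite.intro lborel.sigma_finite_measure_axioms)
  have [measurable]: "f b \<in> borel_measurable borel" if "b \<in> Basis" for b
    using int[OF that] by auto
  show "(LINT x|lborel. (\<Prod>b\<in>Basis. f b (x \<bullet> b))) = (\<Prod>b\<in>Basis. LINT x|lborel. f b x)"
    using int by (subst lborel_def) (simp add: integral_distr product_integral_prod lborel_eq_real)
  show "integrable lborel (\<lambda>x. \<Prod>b\<in>Basis. f b (x \<bullet> b))"
    using int by (subst lborel_def) (simp add: integrable_distr_eq product_integrable_prod lborel_eq_real)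
qed

text \<open>A convergence factor: it tends to 1 as \<open>e\<close> tends to 0, and its transform is
  a probability density for every \<open>e > 0\<close>.\<close>

definition gaussian :: "real \<Rightarrow> real ^ 'n \<Rightarrow> real" where
  "gaussian e x = exp (- (e * norm x)\<^sup>2 / 2)"

lemma gaussian_prod: "gaussian e x = (\<Prod>b\<in>Basis. exp (- (e * (x \<bullet> b))\<^sup>2 / 2))"
proof -
  have "(e * norm x)\<^sup>2 = (\<Sum>b\<in>Basis. (e * (x \<bullet> b))\<^sup>2)"
    unfolding power_mult_distrib power2_norm_eq_inner
    by (simp add: euclidean_inner[of x x] power2_eq_square sum_distrib_left)
  then show ?thesis
    by (simp add: gaussian_def exp_sum[symmetric] sum_negf sum_divide_distrib)
qed

lemma gaussian_measurable [measurable]: "gaussian e \<in> borel_measurable borel"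
  unfolding gaussian_def by measurable

lemma fkernel_prod: "fkernel x y = (\<Prod>b\<in>Basis. iexp (- 2 * pi * (x \<bullet> b) * (y \<bullet> b)))"
  by (simp add: fkernel_def euclidean_inner[of x y] exp_sum[symmetric] sum_distrib_left mult_ac sum_negf)

lemma fourier_gaussian:
  fixes y :: "real ^ 'n"
  assumes "e > 0"
  shows "fourier (\<lambda>x. complex_of_real (gaussian e x)) y
       = complex_of_real (\<Prod>b\<in>Basis. normal_density 0 (e / (2 * pi)) (y \<bullet> b))"
proof -
  have "fourier (\<lambda>x. complex_of_real (gaussian e x)) y
      = (LINT x|lborel. fkernel y x * complex_of_real (gaussian e x))"
    unfolding fourier_fkernel by (rule integral_completion) measurable
  also have "\<dots> = (LINT x|lborel. (\<Prod>b\<in>Basis. iexp (- 2 * pi * (y \<bullet> b) * (x \<bullet> b)) * complex_of_real (exp (- (e * (x \<bullet> b))\<^sup>2 / 2))))"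
    by (simp only: fkernel_prod gaussian_prod of_real_prod prod.distrib)
  also have "\<dots> = (\<Prod>b\<in>Basis. LINT x|lborel. iexp (- 2 * pi * (y \<bullet> b) * x) * complex_of_real (exp (- (e * x)\<^sup>2 / 2)))"
    by (rule integral_lborel_prod) (rule fourier_gaussian_1(1)[OF assms])
  also have "\<dots> = complex_of_real (\<Prod>b\<in>Basis. normal_density 0 (e / (2 * pi)) (y \<bullet> b))"
    by (simp only: fourier_gaussian_1(2)[OF assms] of_real_prod)
  finally show ?thesis .
qed

lemma integrable_gaussian:
  assumes "e > 0"
  shows "integrable lebesgue (\<lambda>x :: real ^ 'n. complex_of_real (gaussian e x))"
proof -
  have "integrable lborel (\<lambda>x :: real ^ 'n. \<Prod>b\<in>Basis. (\<lambda>x. iexp (0 * x) * complex_of_real (exp (- (e * x)\<^sup>2 / 2))) (x \<bullet> b))"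
    by (rule integrable_lborel_prod) (rule fourier_gaussian_1(1)[OF assms])
  then have "integrable lborel (\<lambda>x :: real ^ 'n. complex_of_real (gaussian e x))"
    by (simp add: gaussian_prod)
  then show ?thesis
    by (subst integrable_completion) auto
qed

lemma nn_integral_fourier_gaussian:
  assumes "e > 0"
  shows "(\<integral>\<^sup>+y. ennreal (cmod (fourier (\<lambda>x. complex_of_real (gaussian e x)) y)) \<partial>(lborel :: (real ^ 'n) measure)) = 1"
proof -
  interpret prob_space "density lborel (normal_density 0 (e / (2 * pi)))"
    using assms by (intro prob_space_normal_density) simp
  have 1: "(\<integral>\<^sup>+x. ennreal (normal_density 0 (e / (2 * pi)) x) \<partial>lborel) = 1"
    using emeasure_space_1 by (simp add: emeasure_density)
  have "(\<integral>\<^sup>+y. ennreal (cmod (fourier (\<lambda>x. complex_of_real (gaussian e x)) y)) \<partial>(lborel :: (real ^ 'n) measure))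
    = (\<integral>\<^sup>+y. (\<Prod>b\<in>Basis. ennreal (normal_density 0 (e / (2 * pi)) (y \<bullet> b))) \<partial>(lborel :: (real ^ 'n) measure))"
    unfolding fourier_gaussian[OF assms]
    by (intro nn_integral_cong) (simp add: prod_ennreal abs_of_nonneg prod_nonneg del: of_real_prod)
  also have "\<dots> = (\<Prod>b\<in>(Basis :: (real ^ 'n) set). (\<integral>\<^sup>+x. ennreal (normal_density 0 (e / (2 * pi)) x) \<partial>lborel))"
    by (rule nn_integral_lborel_prod) auto
  finally show ?thesis by (simp add: 1)
qed

section \<open>Translations, reflections and the smoothed Plancherel inequality\<close>

lemma nn_integral_lebesgue_translation:
  fixes f :: "'a::euclidean_space \<Rightarrow> ennreal"
  assumes [measurable]: "f \<in> borel_measurable borel"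
  shows "(\<integral>\<^sup>+x. f (a + x) \<partial>lebesgue) = (\<integral>\<^sup>+x. f x \<partial>lebesgue)"
  unfolding nn_integral_completion
  by (subst lborel_distr_plus[of a, symmetric]) (simp add: nn_integral_distr)

lemma lebesgue_distr_uminus:
  "distr lebesgue lebesgue uminus = (lebesgue :: (real ^ 'n) measure)"
  and lebesgue_measurable_uminus: "uminus \<in> lebesgue \<rightarrow>\<^sub>M (lebesgue :: (real ^ 'n) measure)"
  using lebesgue_affine_euclidean[of "\<lambda>_. - 1" "0 :: real ^ 'n"]
    lebesgue_affine_measurable[of "\<lambda>_. - 1" "0 :: real ^ 'n"]
  by (simp_all add: euclidean_representation sum_negf density_1)

lemma integrable_lebesgue_uminus:
  fixes f :: "real ^ 'n \<Rightarrow> complex"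
  assumes "integrable lebesgue f"
  shows "integrable lebesgue (\<lambda>x. f (- x))"
  using assms by (subst (asm) lebesgue_distr_uminus[symmetric])
    (rule integrable_distr[OF lebesgue_measurable_uminus])

lemma integral_lebesgue_uminus:
  fixes f :: "real ^ 'n \<Rightarrow> complex"
  assumes "f \<in> borel_measurable lebesgue"
  shows "(LINT x|lebesgue. f (- x)) = (LINT x|lebesgue. f x)"
  by (subst (2) lebesgue_distr_uminus[symmetric])
     (rule integral_distr[OF lebesgue_measurable_uminus assms, symmetric])

lemma nn_integral_lebesgue_uminus:
  fixes f :: "real ^ 'n \<Rightarrow> ennreal"
  assumes "f \<in> borel_measurable lebesgue"
  shows "(\<integral>\<^sup>+x. f (- x) \<partial>lebesgue) = (\<integral>\<^sup>+x. f x \<partial>lebesgue)"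
  by (subst (2) lebesgue_distr_uminus[symmetric])
     (rule nn_integral_distr[OF lebesgue_measurable_uminus, symmetric], use assms in simp)

lemma cnj_measurable [measurable]: "cnj \<in> borel_measurable borel"
  by (intro borel_measurable_continuous_onI continuous_intros)

lemma fourier_cnj_uminus:
  assumes f: "integrable lebesgue f"
  shows "fourier (\<lambda>y. cnj (f (- y))) x = cnj (fourier f x)"
proof -
  have [measurable]: "f \<in> borel_measurable lebesgue" using f by auto
  have "fourier (\<lambda>y. cnj (f (- y))) x = (LINT y|lebesgue. cnj (fkernel x (- y) * f (- y)))"
    by (simp add: fourier_fkernel cnj_fkernel)
  also have "\<dots> = (LINT y|lebesgue. cnj (fkernel x y * f y))"
    by (rule integral_lebesgue_uminus[of "\<lambda>y. cnj (fkernel x y * f y)"]) measurable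
  also have "\<dots> = cnj (fourier f x)"
    unfolding fourier_fkernel by (rule Bochner_Integration.integral_cnj)
  finally show ?thesis .
qed

text \<open>Schur's test: \<open>k (y + z)\<close> has integral 1 in each variable separately. The
  sum y + z, rather than a difference, arises because the multiplication formula involves no
  conjugate.\<close>

lemma schur_bound:
  fixes f g k :: "real ^ 'n \<Rightarrow> ennreal"
  assumes [measurable]: "f \<in> borel_measurable lebesgue" "g \<in> borel_measurable lebesgue"
      "k \<in> borel_measurable borel"
    and k: "(\<integral>\<^sup>+x. k x \<partial>lborel) = 1"
    and le: "\<And>y z. h y z \<le> (f y + g z) * k (y + z)"
  shows "(\<integral>\<^sup>+y. (\<integral>\<^sup>+z. h y z \<partial>lebesgue) \<partial>lebesgue) \<le> (\<integral>\<^sup>+y. f y \<partial>lebesgue) + (\<integral>\<^sup>+y. g y \<partial>lebesgue)"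
proof -
  interpret L: sigma_finite_measure "lebesgue :: (real ^ 'n) measure" by (rule sigma_finite_lebesgue)
  interpret P: pair_sigma_finite "lebesgue :: (real ^ 'n) measure" "lebesgue :: (real ^ 'n) measure"
    by standard
  have [measurable]: "(\<lambda>p. k (fst p + snd p)) \<in> borel_measurable (lebesgue \<Otimes>\<^sub>M lebesgue)"
    by (rule borel_measurable_lebesgue_pair) (simp flip: borel_prod)
  have [measurable]: "(\<lambda>z. k (y + z)) \<in> borel_measurable lebesgue" for y
    by (intro measurable_completion) simp
  have k': "(\<integral>\<^sup>+z. k (y + z) \<partial>lebesgue) = 1" for y
    using k by (subst nn_integral_lebesgue_translation) (simp_all add: nn_integral_completion)
  have "(\<integral>\<^sup>+y. (\<integral>\<^sup>+z. h y z \<partial>lebesgue) \<partial>lebesgue)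
    \<le> (\<integral>\<^sup>+y. (\<integral>\<^sup>+z. f y * k (y + z) + g z * k (y + z) \<partial>lebesgue) \<partial>lebesgue)"
    using le by (intro nn_integral_mono) (simp add: distrib_right)
  also have "\<dots> = (\<integral>\<^sup>+y. (\<integral>\<^sup>+z. f y * k (y + z) \<partial>lebesgue) \<partial>lebesgue)
      + (\<integral>\<^sup>+y. (\<integral>\<^sup>+z. g z * k (y + z) \<partial>lebesgue) \<partial>lebesgue)"
    by (simp add: nn_integral_add split_beta)
  also have "(\<integral>\<^sup>+y. (\<integral>\<^sup>+z. f y * k (y + z) \<partial>lebesgue) \<partial>lebesgue) = (\<integral>\<^sup>+y. f y \<partial>lebesgue)"
    by (simp add: nn_integral_cmult k')
  also have "(\<integral>\<^sup>+y. (\<integral>\<^sup>+z. g z * k (y + z) \<partial>lebesgue) \<partial>lebesgue)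
    = (\<integral>\<^sup>+z. (\<integral>\<^sup>+y. g z * k (y + z) \<partial>lebesgue) \<partial>lebesgue)"
    by (rule P.Fubini'[symmetric]) (simp add: split_beta)
  also have "\<dots> = (\<integral>\<^sup>+z. (\<integral>\<^sup>+y. g z * k (z + y) \<partial>lebesgue) \<partial>lebesgue)"
    by (simp add: add.commute)
  also have "\<dots> = (\<integral>\<^sup>+z. g z \<partial>lebesgue)"
    by (simp add: nn_integral_cmult k')
  finally show ?thesis .
qed

text \<open>With f'(y) = cnj (f (- y)), whose transform is the conjugate of that of
  \<open>f\<close>, the left side is the integral of \<open>fourier f x * g x\<close>. The
  multiplication formula moves the transform to \<open>g\<close>, where it becomes a
  convolution-type integral of f' against a kernel of mass 1. The Gaussian factor makes
  \<open>g\<close> integrable, as \<open>fourier f\<close> is merely known to be bounded.\<close>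

lemma fourier_gaussian_L2:
  fixes f :: "real ^ 'n \<Rightarrow> complex"
  assumes f: "integrable lebesgue f" and e: "e > 0"
  shows "(\<integral>\<^sup>+x. ennreal ((cmod (fourier f x))\<^sup>2 * gaussian e x) \<partial>lebesgue) \<le> (\<integral>\<^sup>+x. ennreal ((cmod (f x))\<^sup>2) \<partial>lebesgue)"
proof -
  define f' where "f' y = cnj (f (- y))" for y
  define g where "g x = fourier f' x * complex_of_real (gaussian e x)" for x
  define K where "K = fourier (\<lambda>x :: real ^ 'n. complex_of_real (gaussian e x))"
  have [measurable]: "f \<in> borel_measurable lebesgue" using f by auto
  have f': "integrable lebesgue f'"
    unfolding f'_def using integrable_lebesgue_uminus[OF f] by simp
  then have [measurable]: "f' \<in> borel_measurable lebesgue" by auto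
  have G: "integrable lebesgue (\<lambda>x :: real ^ 'n. complex_of_real (gaussian e x))"
    by (rule integrable_gaussian[OF e])
  have ff': "fourier f' x = cnj (fourier f x)" for x
    unfolding f'_def[abs_def] by (rule fourier_cnj_uminus[OF f])
  have [measurable]: "gaussian e \<in> borel_measurable (lebesgue :: (real ^ 'n) measure)"
    by (intro measurable_completion) simp
  define B where "B = (LINT y|lebesgue. cmod (f' y))"
  have B: "cmod (fourier f' x) \<le> B" for x
    unfolding fourier_fkernel B_def
    using integral_norm_bound[of lebesgue "\<lambda>y. fkernel x y * f' y"] by (simp add: norm_mult)
  have g: "integrable lebesgue g"
  proof (rule Bochner_Integration.integrable_bound)
    show "integrable lebesgue (\<lambda>x :: real ^ 'n. B * complex_of_real (gaussian e x))"
      using G by simp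
    show "AE x in lebesgue. norm (g x) \<le> norm (B * complex_of_real (gaussian e x))"
      unfolding g_def using B order_trans[OF norm_ge_zero B]
      by (auto simp: norm_mult intro!: mult_right_mono)
  qed (unfold g_def, measurable)
  have K_prod: "K y = complex_of_real (\<Prod>b\<in>Basis. normal_density 0 (e / (2 * pi)) (y \<bullet> b))" for y
    unfolding K_def by (rule fourier_gaussian[OF e])
  have [measurable]: "K \<in> borel_measurable borel"
    unfolding K_prod[abs_def] by measurable
  have K1: "(\<integral>\<^sup>+y. ennreal (cmod (K y)) \<partial>lborel) = 1"
    unfolding K_def by (rule nn_integral_fourier_gaussian[OF e])
  \<comment> \<open>Multiplying the Gaussian by \<open>fkernel y\<close> translates its transform by
    y.\<close>
  have fg: "fourier g y = (LINT z|lebesgue. f' z * K (y + z))" for y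
  proof -
    have "fourier g y = (LINT x|lebesgue. fourier f' x * (fkernel y x * complex_of_real (gaussian e x)))"
      unfolding fourier_fkernel[of g] g_def by (simp add: mult_ac)
    also have "\<dots> = (LINT z|lebesgue. f' z * fourier (\<lambda>x. fkernel y x * complex_of_real (gaussian e x)) z)"
      by (rule fourier_mult_formula[OF f' integrable_fkernel_mult[OF G]])
    also have "fourier (\<lambda>x. fkernel y x * complex_of_real (gaussian e x)) = (\<lambda>z. K (y + z))"
      unfolding fourier_fkernel[abs_def] K_def
      by (intro ext Bochner_Integration.integral_cong) (simp_all add: fkernel_commute[of "_ + _"] fkernel_add fkernel_commute mult_ac)
    finally show ?thesis .
  qed
  have int: "integrable lebesgue (\<lambda>x. (cmod (fourier f x))\<^sup>2 * gaussian e x)"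
  proof -
    have "integrable lebesgue (\<lambda>x. cmod (fourier f x) * cmod (g x))"
    proof (rule Bochner_Integration.integrable_bound)
      show "integrable lebesgue (\<lambda>x. B * cmod (g x))" using g by simp
      show "AE x in lebesgue. norm (cmod (fourier f x) * cmod (g x)) \<le> norm (B * cmod (g x))"
        using B order_trans[OF norm_ge_zero B] unfolding ff'
        by (auto intro!: mult_right_mono)
    qed (use g in auto)
    also have "(\<lambda>x. cmod (fourier f x) * cmod (g x)) = (\<lambda>x. (cmod (fourier f x))\<^sup>2 * gaussian e x)"
      by (auto simp: g_def ff' norm_mult power2_eq_square gaussian_def)
    finally show ?thesis .
  qed
  have "(\<integral>\<^sup>+x. ennreal ((cmod (fourier f x))\<^sup>2 * gaussian e x) \<partial>lebesgue)
     = ennreal (LINT x|lebesgue. (cmod (fourier f x))\<^sup>2 * gaussian e x)"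
    using int by (intro nn_integral_eq_integral) (auto simp: gaussian_def)
  also have "(LINT x|lebesgue. (cmod (fourier f x))\<^sup>2 * gaussian e x)
     = cmod (complex_of_real (LINT x|lebesgue. (cmod (fourier f x))\<^sup>2 * gaussian e x))"
    by (simp add: gaussian_def)
  also have "complex_of_real (LINT x|lebesgue. (cmod (fourier f x))\<^sup>2 * gaussian e x)
    = (LINT x|lebesgue. complex_of_real ((cmod (fourier f x))\<^sup>2 * gaussian e x))"
    by (rule integral_complex_of_real[symmetric])
  also have "\<dots> = (LINT x|lebesgue. fourier f x * g x)"
    by (simp add: g_def ff' complex_norm_square mult_ac del: of_real_power integral_complex_of_real)
  also have "\<dots> = (LINT y|lebesgue. f y * fourier g y)"
    by (rule fourier_mult_formula[OF f g])
  also have "ennreal (cmod \<dots>) \<le> (\<integral>\<^sup>+y. ennreal (cmod (f y * fourier g y)) \<partial>lebesgue)"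
  \<comment> \<open>The Bochner integral of a non-integrable function is 0, so the bound is trivial
    in that case.\<close>
  proof (cases "integrable lebesgue (\<lambda>y. f y * fourier g y)")
    case True
    then show ?thesis by (rule integral_norm_bound_ennreal)
  qed (simp add: not_integrable_integral_eq)
  also have "\<dots> \<le> (\<integral>\<^sup>+y. (\<integral>\<^sup>+z. ennreal (cmod (f y) * cmod (f' z) * cmod (K (y + z))) \<partial>lebesgue) \<partial>lebesgue)"
  proof (rule nn_integral_mono)
    fix y
    have [measurable]: "(\<lambda>z. K (y + z)) \<in> borel_measurable lebesgue"
      by (intro measurable_completion) simp
    have "ennreal (cmod (fourier g y)) \<le> (\<integral>\<^sup>+z. ennreal (cmod (f' z * K (y + z))) \<partial>lebesgue)"
      unfolding fg
    proof (cases "integrable lebesgue (\<lambda>z. f' z * K (y + z))")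
      case True
      then show "ennreal (cmod (LINT z|lebesgue. f' z * K (y + z))) \<le> (\<integral>\<^sup>+z. ennreal (cmod (f' z * K (y + z))) \<partial>lebesgue)"
        by (rule integral_norm_bound_ennreal)
    qed (simp add: not_integrable_integral_eq)
    then have "ennreal (cmod (f y)) * ennreal (cmod (fourier g y)) \<le> ennreal (cmod (f y)) * (\<integral>\<^sup>+z. ennreal (cmod (f' z * K (y + z))) \<partial>lebesgue)"
      by (intro mult_left_mono) auto
    also have "\<dots> = (\<integral>\<^sup>+z. ennreal (cmod (f y) * cmod (f' z) * cmod (K (y + z))) \<partial>lebesgue)"
      by (subst nn_integral_cmult[symmetric]) (simp_all add: ennreal_mult norm_mult mult.assoc)
    finally show "ennreal (cmod (f y * fourier g y)) \<le> (\<integral>\<^sup>+z. ennreal (cmod (f y) * cmod (f' z) * cmod (K (y + z))) \<partial>lebesgue)"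
      by (simp add: norm_mult ennreal_mult)
  qed
  \<comment> \<open>From ab <= a^2/2 + b^2/2; the two halves add up to the full integral because
    reflection and conjugation preserve it.\<close>
  also have "\<dots> \<le> (\<integral>\<^sup>+y. ennreal ((cmod (f y))\<^sup>2 / 2) \<partial>lebesgue) + (\<integral>\<^sup>+y. ennreal ((cmod (f' y))\<^sup>2 / 2) \<partial>lebesgue)"
  proof (rule schur_bound[OF _ _ _ K1])
    fix y z
    have "cmod (f y) * cmod (f' z) \<le> (cmod (f y))\<^sup>2 / 2 + (cmod (f' z))\<^sup>2 / 2"
      using sum_squares_bound[of "cmod (f y)" "cmod (f' z)"] by simp
    then have "cmod (f y) * cmod (f' z) * cmod (K (y + z)) \<le> ((cmod (f y))\<^sup>2 / 2 + (cmod (f' z))\<^sup>2 / 2) * cmod (K (y + z))"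
      by (intro mult_right_mono) auto
    then show "ennreal (cmod (f y) * cmod (f' z) * cmod (K (y + z)))
      \<le> (ennreal ((cmod (f y))\<^sup>2 / 2) + ennreal ((cmod (f' z))\<^sup>2 / 2)) * ennreal (cmod (K (y + z)))"
      by (simp flip: ennreal_mult ennreal_plus)
  qed simp_all
  also have "(\<integral>\<^sup>+y. ennreal ((cmod (f' y))\<^sup>2 / 2) \<partial>lebesgue) = (\<integral>\<^sup>+y. ennreal ((cmod (f y))\<^sup>2 / 2) \<partial>lebesgue)"
    unfolding f'_def complex_mod_cnj
    by (rule nn_integral_lebesgue_uminus[of "\<lambda>y. ennreal ((cmod (f y))\<^sup>2 / 2)"]) measurable
  also have "(\<integral>\<^sup>+y. ennreal ((cmod (f y))\<^sup>2 / 2) \<partial>lebesgue) + (\<integral>\<^sup>+y. ennreal ((cmod (f y))\<^sup>2 / 2) \<partial>lebesgue)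
    = (\<integral>\<^sup>+x. ennreal ((cmod (f x))\<^sup>2) \<partial>lebesgue)"
    by (subst nn_integral_add[symmetric]) (simp_all flip: ennreal_plus)
  finally show ?thesis .
qed

lemma gaussian_tendsto_1: "(\<lambda>n. gaussian (1 / Suc n) x) \<longlonglongrightarrow> 1"
proof -
  have "(\<lambda>n. exp (- (1 / real (Suc n) * norm x)\<^sup>2 / 2)) \<longlonglongrightarrow> exp (- (0 * norm x)\<^sup>2 / 2)"
    by (intro tendsto_intros LIMSEQ_Suc[OF lim_1_over_n]) simp
  then show ?thesis by (simp add: gaussian_def)
qed

text \<open>Fatou's lemma removes the Gaussian factor. The right side may be infinite.\<close>

lemma fourier_L2_le:
  fixes f :: "real ^ 'n \<Rightarrow> complex"
  assumes f: "integrable lebesgue f"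
  shows "(\<integral>\<^sup>+x. ennreal ((cmod (fourier f x))\<^sup>2) \<partial>lebesgue) \<le> (\<integral>\<^sup>+x. ennreal ((cmod (f x))\<^sup>2) \<partial>lebesgue)"
proof -
  have [measurable]: "f \<in> borel_measurable lebesgue" using f by auto
  have [measurable]: "gaussian e \<in> borel_measurable (lebesgue :: (real ^ 'n) measure)" for e
    by (intro measurable_completion) simp
  have "(\<integral>\<^sup>+x. ennreal ((cmod (fourier f x))\<^sup>2) \<partial>lebesgue)
    = (\<integral>\<^sup>+x. liminf (\<lambda>n. ennreal ((cmod (fourier f x))\<^sup>2 * gaussian (1 / Suc n) x)) \<partial>lebesgue)"
  proof (rule nn_integral_cong)
    fix x :: "real ^ 'n"
    have "(\<lambda>n. ennreal ((cmod (fourier f x))\<^sup>2 * gaussian (1 / Suc n) x)) \<longlonglongrightarrow> ennreal ((cmod (fourier f x))\<^sup>2 * 1)"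
      by (intro tendsto_ennrealI tendsto_intros gaussian_tendsto_1)
    from lim_imp_Liminf[OF _ this] show "ennreal ((cmod (fourier f x))\<^sup>2)
      = liminf (\<lambda>n. ennreal ((cmod (fourier f x))\<^sup>2 * gaussian (1 / Suc n) x))" by simp
  qed
  also have "\<dots> \<le> liminf (\<lambda>n. \<integral>\<^sup>+x. ennreal ((cmod (fourier f x))\<^sup>2 * gaussian (1 / Suc n) x) \<partial>lebesgue)"
    by (rule nn_integral_liminf) measurable
  also have "\<dots> \<le> (\<integral>\<^sup>+x. ennreal ((cmod (f x))\<^sup>2) \<partial>lebesgue)"
    by (rule Liminf_le) (simp_all add: fourier_gaussian_L2[OF f])
  finally show ?thesis .
qed

section \<open>The averaging operator\<close>

text \<open>Hardy's operator composed with the inversion t -> 1/t. For t <= 0 the interval is empty,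
  as 1 / 0 = 0 on the reals, so the value is 0.\<close>

definition hardy :: "(real \<Rightarrow> ennreal) \<Rightarrow> real \<Rightarrow> ennreal" where
  "hardy g t = (\<integral>\<^sup>+x\<in>{0<..<1 / t}. g x \<partial>lborel)"

lemma hardy_measurable [measurable]:
  assumes [measurable]: "g \<in> borel_measurable borel"
  shows "hardy g \<in> borel_measurable borel"
proof -
  have "(\<lambda>t. \<integral>\<^sup>+x. g x * indicator {x. 0 < x \<and> x < 1 / t} x \<partial>lborel) \<in> borel_measurable borel"
    by measurable
  then show ?thesis
    by (simp add: hardy_def[abs_def] greaterThanLessThan_def greaterThan_def lessThan_def Int_def)
qed

lemma hardy_antimono:
  assumes "0 < s" "s \<le> t"
  shows "hardy g t \<le> hardy g s"
  unfolding hardy_def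
proof (intro nn_integral_mono mult_left_mono)
  fix x :: real
  have "1 / t \<le> 1 / s" using assms by (simp add: frac_le)
  then show "indicator {0<..<1 / t} x \<le> (indicator {0<..<1 / s} x :: ennreal)"
    by (auto split: split_indicator)
qed auto

lemma le_hardy:
  assumes "antimono \<rho>" "0 < t" "0 < x" "x \<le> 1 / t"
  shows "ennreal x * \<rho> x \<le> hardy \<rho> t"
proof -
  have "ennreal x * \<rho> x = (\<integral>\<^sup>+y. \<rho> x * indicator {0<..<x} y \<partial>lborel)"
    using assms by (subst nn_integral_cmult) (simp_all add: mult.commute)
  also have "\<dots> \<le> hardy \<rho> t"
    unfolding hardy_def using assms(4) antimonoD[OF assms(1)]
    by (intro nn_integral_mono) (auto split: split_indicator)
  finally show ?thesis .
qed

lemma hardy_square_le: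
  assumes "z > 0"
  shows "ennreal z * (hardy \<rho> z)\<^sup>2 \<le> (\<integral>\<^sup>+t\<in>{0<..<z}. (hardy \<rho> t)\<^sup>2 \<partial>lborel)"
proof -
  have "ennreal z * (hardy \<rho> z)\<^sup>2 = (\<integral>\<^sup>+t. (hardy \<rho> z)\<^sup>2 * indicator {0<..<z} t \<partial>lborel)"
    using assms by (subst nn_integral_cmult) (simp_all add: mult.commute)
  also have "\<dots> \<le> (\<integral>\<^sup>+t\<in>{0<..<z}. (hardy \<rho> t)\<^sup>2 \<partial>lborel)"
    by (intro nn_integral_mono) (auto intro!: power_mono hardy_antimono split: split_indicator)
  finally show ?thesis .
qed

text \<open>Insert 1 = x times the length of (0, 1/x) and exchange the integrals. For t < 1/x
  monotonicity gives x \<rho>(x) <= \<open>hardy \<rho> t\<close>, and the remaining factor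
  \<rho>(x) integrates over x < 1/t to at most \<open>hardy \<rho> t\<close> again.\<close>

lemma tail_square_le_hardy:
  assumes "antimono \<rho>" "z > 0"
  shows "(\<integral>\<^sup>+x\<in>{1 / z<..}. (\<rho> x)\<^sup>2 \<partial>lborel) \<le> (\<integral>\<^sup>+t\<in>{0<..<z}. (hardy \<rho> t)\<^sup>2 \<partial>lborel)"
proof -
  have [measurable]: "\<rho> \<in> borel_measurable borel"
    by (rule borel_measurable_antimono) fact
  have "(\<integral>\<^sup>+x\<in>{1 / z<..}. (\<rho> x)\<^sup>2 \<partial>lborel)
     = (\<integral>\<^sup>+x. (\<integral>\<^sup>+t. \<rho> x * (ennreal x * \<rho> x) * indicator {1 / z<..} x * indicator {t. 0 < t \<and> t < 1 / x} t \<partial>lborel) \<partial>lborel)"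
  proof (intro nn_integral_cong)
    fix x :: real
    show "(\<rho> x)\<^sup>2 * indicator {1 / z<..} x
       = (\<integral>\<^sup>+t. \<rho> x * (ennreal x * \<rho> x) * indicator {1 / z<..} x * indicator {t. 0 < t \<and> t < 1 / x} t \<partial>lborel)"
    proof (cases "x > 1 / z")
      case True
      then have x: "x > 0" using \<open>z > 0\<close> by (meson divide_pos_pos less_trans zero_less_one)
      have "{t. 0 < t \<and> t < 1 / x} = {0<..<1 / x}" by auto
      moreover have "ennreal x * ennreal (1 / x) = 1"
        using x by (simp flip: ennreal_mult)
      then have "(\<rho> x)\<^sup>2 = \<rho> x * (ennreal x * \<rho> x) * ennreal (1 / x)"
        by (metis mult.assoc mult.commute mult.right_neutral power2_eq_square)
      ultimately show ?thesis
        using True x by (subst nn_integral_cmult) simp_all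
    qed simp
  qed
  also have "\<dots> = (\<integral>\<^sup>+t. (\<integral>\<^sup>+x. \<rho> x * (ennreal x * \<rho> x) * indicator {1 / z<..} x * indicator {t. 0 < t \<and> t < 1 / x} t \<partial>lborel) \<partial>lborel)"
    by (rule lborel_pair.Fubini') measurable
  also have "\<dots> \<le> (\<integral>\<^sup>+t\<in>{0<..<z}. (hardy \<rho> t)\<^sup>2 \<partial>lborel)"
  proof (rule nn_integral_mono)
    fix t :: real
    have "(\<integral>\<^sup>+x. \<rho> x * (ennreal x * \<rho> x) * indicator {1 / z<..} x * indicator {t. 0 < t \<and> t < 1 / x} t \<partial>lborel)
       \<le> (\<integral>\<^sup>+x. (\<rho> x * indicator {0<..<1 / t} x) * (hardy \<rho> t * indicator {0<..<z} t) \<partial>lborel)"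
    proof (rule nn_integral_mono)
      fix x :: real
      show "\<rho> x * (ennreal x * \<rho> x) * indicator {1 / z<..} x * indicator {t. 0 < t \<and> t < 1 / x} t
        \<le> (\<rho> x * indicator {0<..<1 / t} x) * (hardy \<rho> t * indicator {0<..<z} t)"
      proof (cases "1 / z < x \<and> 0 < t \<and> t < 1 / x")
        case True
        then have x: "x > 0" using \<open>z > 0\<close> by (meson divide_pos_pos less_trans zero_less_one)
        with True \<open>z > 0\<close> have "x < 1 / t" "t < z"
          by (simp_all add: field_simps) (smt (verit, best) mult_less_cancel_left_pos mult.commute)
        then show ?thesis
          using True x le_hardy[OF assms(1), of t x] by (auto intro!: mult_left_mono)
      qed (auto split: split_indicator)
    qed
    also have "\<dots> = hardy \<rho> t * (hardy \<rho> t * indicator {0<..<z} t)"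
      by (subst nn_integral_multc) (simp_all add: hardy_def)
    finally show "(\<integral>\<^sup>+x. \<rho> x * (ennreal x * \<rho> x) * indicator {1 / z<..} x * indicator {t. 0 < t \<and> t < 1 / x} t \<partial>lborel)
       \<le> (hardy \<rho> t)\<^sup>2 * indicator {0<..<z} t"
      by (simp add: power2_eq_square mult.assoc)
  qed
  finally show ?thesis .
qed

text \<open>This is to bound the L^2 norm of the part of \<open>f\<close> below the height
  \<rho>(1/z). On (0, 1/z] the minimum is the constant \<rho>(1/z), and \<rho>(1/z)^2 / z = z
  (\<rho>(1/z) / z)^2 is at most z (\<open>hardy \<rho> z\<close>)^2; beyond 1/z the tail estimate
  applies.\<close>

lemma min_square_le_hardy:
  assumes "antimono \<rho>" "z > 0"
  shows "(\<integral>\<^sup>+x\<in>{0<..}. (min (\<rho> x) (\<rho> (1 / z)))\<^sup>2 \<partial>lborel) \<le> 2 * (\<integral>\<^sup>+t\<in>{0<..<z}. (hardy \<rho> t)\<^sup>2 \<partial>lborel)"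
proof -
  have [measurable]: "\<rho> \<in> borel_measurable borel"
    by (rule borel_measurable_antimono) fact
  have "(\<integral>\<^sup>+x\<in>{0<..}. (min (\<rho> x) (\<rho> (1 / z)))\<^sup>2 \<partial>lborel)
     \<le> (\<integral>\<^sup>+x. (\<rho> (1 / z))\<^sup>2 * indicator {0<..1 / z} x + (\<rho> x)\<^sup>2 * indicator {1 / z<..} x \<partial>lborel)"
    by (intro nn_integral_mono) (auto split: split_indicator intro!: power_mono)
  also have "\<dots> = ennreal (1 / z) * (\<rho> (1 / z))\<^sup>2 + (\<integral>\<^sup>+x\<in>{1 / z<..}. (\<rho> x)\<^sup>2 \<partial>lborel)"
  proof (subst nn_integral_add)
    have "(\<integral>\<^sup>+x. (\<rho> (1 / z))\<^sup>2 * indicator {0<..1 / z} x \<partial>lborel) = ennreal (1 / z) * (\<rho> (1 / z))\<^sup>2"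
      using \<open>z > 0\<close> by (subst nn_integral_cmult) (simp_all add: mult.commute)
    then show "(\<integral>\<^sup>+x. (\<rho> (1 / z))\<^sup>2 * indicator {0<..1 / z} x \<partial>lborel) + (\<integral>\<^sup>+x\<in>{1 / z<..}. (\<rho> x)\<^sup>2 \<partial>lborel)
      = ennreal (1 / z) * (\<rho> (1 / z))\<^sup>2 + (\<integral>\<^sup>+x\<in>{1 / z<..}. (\<rho> x)\<^sup>2 \<partial>lborel)" by simp
  qed simp_all
  also have "ennreal (1 / z) * (\<rho> (1 / z))\<^sup>2 = ennreal z * (ennreal (1 / z) * \<rho> (1 / z))\<^sup>2"
  proof -
    have "ennreal z * (ennreal (1 / z))\<^sup>2 = ennreal (1 / z)"
      using \<open>z > 0\<close> by (simp add: power2_eq_square flip: ennreal_mult)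
    then show ?thesis by (simp add: power_mult_distrib flip: mult.assoc)
  qed
  also have "\<dots> \<le> ennreal z * (hardy \<rho> z)\<^sup>2"
    using assms by (intro mult_left_mono power_mono le_hardy) auto
  also have "\<dots> \<le> (\<integral>\<^sup>+t\<in>{0<..<z}. (hardy \<rho> t)\<^sup>2 \<partial>lborel)"
    by (rule hardy_square_le) fact
  also have "(\<integral>\<^sup>+x\<in>{1 / z<..}. (\<rho> x)\<^sup>2 \<partial>lborel) \<le> (\<integral>\<^sup>+t\<in>{0<..<z}. (hardy \<rho> t)\<^sup>2 \<partial>lborel)"
    by (rule tail_square_le_hardy) fact+
  finally show ?thesis by (simp add: mult_2)
qed

section \<open>Finiteness of level sets and the splitting estimate\<close>

lemma markov_distribution:
  assumes [measurable]: "k \<in> borel_measurable M"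
  shows "ennreal \<alpha> * emeasure M {x\<in>space M. k x > ennreal \<alpha>} \<le> (\<integral>\<^sup>+x. k x \<partial>M)"
proof -
  have "ennreal \<alpha> * emeasure M {x\<in>space M. k x > ennreal \<alpha>}
     = (\<integral>\<^sup>+x. ennreal \<alpha> * indicator {x\<in>space M. k x > ennreal \<alpha>} x \<partial>M)"
    by (subst nn_integral_cmult) simp_all
  also have "\<dots> \<le> (\<integral>\<^sup>+x. k x \<partial>M)"
    by (intro nn_integral_mono) (auto split: split_indicator)
  finally show ?thesis .
qed

lemma distribution_finite:
  assumes "k \<in> borel_measurable M" "(\<integral>\<^sup>+x. k x \<partial>M) < \<infinity>" "\<alpha> > 0"
  shows "emeasure M {x\<in>space M. k x > ennreal \<alpha>} < \<infinity>"
proof (rule ccontr)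
  assume "\<not> ?thesis"
  then have "emeasure M {x\<in>space M. k x > ennreal \<alpha>} = \<infinity>" by (simp flip: less_top)
  then show False
    using markov_distribution[OF assms(1), of \<alpha>] assms(2,3) by (simp add: ennreal_mult_top top_unique)
qed

lemma rearrangement_finite:
  assumes [measurable]: "k \<in> borel_measurable M" and "(\<integral>\<^sup>+x. k x \<partial>M) < \<infinity>" "t > 0"
  shows "rearrangement M k t < \<infinity>"
proof (rule ccontr)
  assume "\<not> ?thesis"
  then have top: "rearrangement M k t = \<infinity>" by (simp flip: less_top)
  define S where "S = enn2real (\<integral>\<^sup>+x. k x \<partial>M)"
  have S: "(\<integral>\<^sup>+x. k x \<partial>M) = ennreal S" "S \<ge> 0"
    using assms(2) by (simp_all add: S_def)
  \<comment> \<open>An infinite value at t would give a superlevel set of measure above t at this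
    height, hence S + 1 <= S by Markov's inequality.\<close>
  define \<alpha> where "\<alpha> = (S + 1) / t"
  have \<alpha>: "\<alpha> > 0" using S \<open>t > 0\<close> by (simp add: \<alpha>_def add_nonneg_pos)
  have "ennreal t < emeasure M {x\<in>space M. k x > ennreal \<alpha>}"
    using less_rearrangement_iff[of k M t \<alpha>] top \<alpha> \<open>t > 0\<close> by simp
  then have "ennreal \<alpha> * ennreal t \<le> ennreal S"
    using markov_distribution[of k M \<alpha>] S by (metis assms(1) less_imp_le mult_left_mono order_trans zero_le)
  then show False
    using \<alpha> S \<open>t > 0\<close> by (simp add: \<alpha>_def ennreal_mult[symmetric])
qed

text \<open>Splitting \<open>f\<close> at the height \<open>\<rho> (1 / z)\<close> and using the bounds of the Fourier transform on
  $L^1$ for the high part and on $L^2$ for the low part.\<close>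

lemma fourier_square_le:
  fixes f :: "real ^ 'n \<Rightarrow> complex"
  assumes f: "integrable lebesgue f" and z: "z > 0"
    and E[measurable]: "E \<in> sets lebesgue" and le: "emeasure lebesgue E \<le> ennreal z"
  defines "\<rho> \<equiv> rearrangement lebesgue (\<lambda>x. ennreal (cmod (f x)))"
  shows "(\<integral>\<^sup>+x\<in>E. (ennreal (cmod (fourier f x)))\<^sup>2 \<partial>lebesgue)
       \<le> 6 * (\<integral>\<^sup>+t\<in>{0<..<z}. (hardy \<rho> t)\<^sup>2 \<partial>lborel)"
proof -
  let ?M = "lebesgue :: (real ^ 'n) measure"
  let ?k = "\<lambda>x. ennreal (cmod (f x))"
  let ?P = "\<integral>\<^sup>+t\<in>{0<..<z}. (hardy \<rho> t)\<^sup>2 \<partial>lborel"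
  have [measurable]: "f \<in> borel_measurable lebesgue" using f by auto
  have k: "?k \<in> borel_measurable ?M" by simp
  have fin: "(\<integral>\<^sup>+x. ?k x \<partial>?M) < \<infinity>" using f by (simp add: integrable_iff_bounded)
  have \<rho>: "antimono \<rho>" unfolding \<rho>_def by (rule antimono_rearrangement)
  then have [measurable]: "\<rho> \<in> borel_measurable borel" by (rule borel_measurable_antimono)
  have ks: "{x. ?k x > ennreal \<alpha>} \<in> sets ?M" for \<alpha>
  proof -
    have "{x\<in>space ?M. ?k x > ennreal \<alpha>} \<in> sets ?M" by measurable
    then show ?thesis by simp
  qed
  have less_\<rho>: "ennreal \<alpha> < \<rho> t \<longleftrightarrow> ennreal t < emeasure ?M {x. ?k x > ennreal \<alpha>}"
    if "t \<ge> 0" "\<alpha> \<ge> 0" for t \<alpha>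
    using less_rearrangement_iff[OF k that] by (simp add: \<rho>_def)
  have emeasure_k: "emeasure ?M {x. ?k x > ennreal \<alpha>} = emeasure lborel (initial (emeasure ?M {x. ?k x > ennreal \<alpha>}))" for \<alpha>
    by (simp add: emeasure_Collect_less_ennreal)
  define l where "l = enn2real (\<rho> (1 / z))"
  have "\<rho> (1 / z) < \<infinity>"
    unfolding \<rho>_def using fin z by (intro rearrangement_finite) auto
  then have l: "\<rho> (1 / z) = ennreal l" "l \<ge> 0" by (simp_all add: l_def)
  define f1 where "f1 x = (if cmod (f x) > l then f x else 0)" for x
  define f2 where "f2 x = (if cmod (f x) > l then 0 else f x)" for x
  have [measurable]: "f1 \<in> borel_measurable lebesgue" "f2 \<in> borel_measurable lebesgue"
    unfolding f1_def f2_def by measurable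
  have f1: "integrable lebesgue f1" and f2: "integrable lebesgue f2"
    by (rule Bochner_Integration.integrable_bound[OF f]; simp add: f1_def f2_def)+
  have f12: "fourier f x = fourier f1 x + fourier f2 x" for x
  proof -
    have "f = (\<lambda>y. f1 y + f2 y)" by (auto simp: f1_def f2_def)
    then show ?thesis using fourier_add[OF f1 f2] by simp
  qed
  have L1: "(\<integral>\<^sup>+x. ennreal (cmod (f1 x)) \<partial>lebesgue) \<le> hardy \<rho> z"
    unfolding hardy_def
  proof (rule nn_integral_le_of_distribution)
    fix \<alpha> :: real assume "\<alpha> > 0"
    have "emeasure ?M {x. ?k x > ennreal l} \<le> ennreal (1 / z)"
      using less_\<rho>[of "1 / z" l] l z by simp
    \<comment> \<open>Since \<open>f1\<close> vanishes unless |f| > l, its level sets are those of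
      |f| from height \<open>l\<close> on; by monotonicity the points t where \<rho>(t) > l satisfy
      t < 1/z.\<close>
    have eq: "{x\<in>space ?M. ennreal (cmod (f1 x)) > ennreal \<alpha>} = {x. ?k x > ennreal (max \<alpha> l)}"
      using l \<open>\<alpha> > 0\<close> by (auto simp: f1_def ennreal_less_iff)
    have "emeasure ?M {x. ?k x > ennreal (max \<alpha> l)} = emeasure lborel (initial (emeasure ?M {x. ?k x > ennreal (max \<alpha> l)}))"
      by (rule emeasure_k)
    also have "\<dots> \<le> emeasure lborel {t\<in>space lborel. \<rho> t * indicator {0<..<1 / z} t > ennreal \<alpha>}"
    proof (intro emeasure_mono subsetI)
      fix t assume "t \<in> initial (emeasure ?M {x. ?k x > ennreal (max \<alpha> l)})"
      then have t: "t > 0" "ennreal t < emeasure ?M {x. ?k x > ennreal (max \<alpha> l)}" by auto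
      then have "ennreal (max \<alpha> l) < \<rho> t"
        using less_\<rho>[of t "max \<alpha> l"] l by simp
      moreover from this have "t < 1 / z"
        using antimonoD[OF \<rho>, of "1 / z" t] l
        by (metis ennreal_leI leD leI max.cobounded2 order_less_le_trans)
      moreover have "ennreal \<alpha> \<le> ennreal (max \<alpha> l)" by (intro ennreal_leI) simp
      ultimately show "t \<in> {t\<in>space lborel. \<rho> t * indicator {0<..<1 / z} t > ennreal \<alpha>}"
        using t by (auto intro: order_le_less_trans)
    qed simp
    finally show "emeasure ?M {x\<in>space ?M. ennreal (cmod (f1 x)) > ennreal \<alpha>}
      \<le> emeasure lborel {t\<in>space lborel. \<rho> t * indicator {0<..<1 / z} t > ennreal \<alpha>}"
      unfolding eq .
  qed (simp_all add: sigma_finite_lebesgue lborel.sigma_finite_measure_axioms)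
  have "(\<integral>\<^sup>+x. ennreal ((cmod (f2 x))\<^sup>2) \<partial>lebesgue) \<le> (\<integral>\<^sup>+x\<in>{0<..}. (min (\<rho> x) (\<rho> (1 / z)))\<^sup>2 \<partial>lborel)"
  proof (rule nn_integral_le_of_distribution)
    fix \<alpha> :: real assume "\<alpha> > 0"
    show "emeasure ?M {x\<in>space ?M. ennreal ((cmod (f2 x))\<^sup>2) > ennreal \<alpha>}
      \<le> emeasure lborel {t\<in>space lborel. (min (\<rho> t) (\<rho> (1 / z)))\<^sup>2 * indicator {0<..} t > ennreal \<alpha>}"
    proof (cases "sqrt \<alpha> < l")
      case True
      have "emeasure ?M {x\<in>space ?M. ennreal ((cmod (f2 x))\<^sup>2) > ennreal \<alpha>} \<le> emeasure ?M {x. ?k x > ennreal (sqrt \<alpha>)}"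
        using \<open>\<alpha> > 0\<close> by (intro emeasure_mono[OF _ ks])
          (auto simp: f2_def ennreal_less_iff intro!: real_less_lsqrt split: if_splits)
      also have "\<dots> = emeasure lborel (initial (emeasure ?M {x. ?k x > ennreal (sqrt \<alpha>)}))"
        by (rule emeasure_k)
      also have "\<dots> \<le> emeasure lborel {t\<in>space lborel. (min (\<rho> t) (\<rho> (1 / z)))\<^sup>2 * indicator {0<..} t > ennreal \<alpha>}"
      proof (intro emeasure_mono subsetI)
        fix t assume "t \<in> initial (emeasure ?M {x. ?k x > ennreal (sqrt \<alpha>)})"
        then have t: "t > 0" "ennreal t < emeasure ?M {x. ?k x > ennreal (sqrt \<alpha>)}" by auto
        then have "ennreal (sqrt \<alpha>) < \<rho> t"
          using less_\<rho>[of t "sqrt \<alpha>"] \<open>\<alpha> > 0\<close> by simp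
        moreover have "ennreal (sqrt \<alpha>) < \<rho> (1 / z)"
          using True \<open>\<alpha> > 0\<close> by (simp add: l ennreal_less_iff)
        ultimately have "ennreal (sqrt \<alpha>) < min (\<rho> t) (\<rho> (1 / z))" by simp
        then have "ennreal (sqrt \<alpha>) epowr 2 < min (\<rho> t) (\<rho> (1 / z)) epowr 2"
          by (intro epowr_strict_mono) auto
        then show "t \<in> {t\<in>space lborel. (min (\<rho> t) (\<rho> (1 / z)))\<^sup>2 * indicator {0<..} t > ennreal \<alpha>}"
          using t \<open>\<alpha> > 0\<close> by (simp add: epowr_2 ennreal_power)
      qed simp
      finally show ?thesis .
    next
      case False
      then have "l\<^sup>2 \<le> \<alpha>"
        using l \<open>\<alpha> > 0\<close> by (metis not_less real_le_rsqrt real_sqrt_le_iff real_sqrt_unique sqrt_le_D)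
      moreover have "(cmod (f2 x))\<^sup>2 \<le> l\<^sup>2" for x
        using l by (auto simp: f2_def intro!: power_mono)
      ultimately have "{x\<in>space ?M. ennreal ((cmod (f2 x))\<^sup>2) > ennreal \<alpha>} = {}"
        using \<open>\<alpha> > 0\<close> by (auto simp: ennreal_less_iff not_less intro: order_trans)
      then show ?thesis by simp
    qed
  qed (simp_all add: sigma_finite_lebesgue lborel.sigma_finite_measure_axioms)
  also have "\<dots> \<le> 2 * ?P"
    by (rule min_square_le_hardy[OF \<rho> z])
  finally have L2: "(\<integral>\<^sup>+x. ennreal ((cmod (f2 x))\<^sup>2) \<partial>lebesgue) \<le> 2 * ?P" .
  have "(\<integral>\<^sup>+x\<in>E. (ennreal (cmod (fourier f x)))\<^sup>2 \<partial>lebesgue)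
     \<le> (\<integral>\<^sup>+x. 2 * (hardy \<rho> z)\<^sup>2 * indicator E x + 2 * ennreal ((cmod (fourier f2 x))\<^sup>2) \<partial>lebesgue)"
  proof (rule nn_integral_mono)
    fix x
    have "(cmod (fourier f x))\<^sup>2 \<le> (cmod (fourier f1 x) + cmod (fourier f2 x))\<^sup>2"
      unfolding f12 by (intro power_mono norm_triangle_ineq) auto
    also have "\<dots> \<le> 2 * (cmod (fourier f1 x))\<^sup>2 + 2 * (cmod (fourier f2 x))\<^sup>2"
      using sum_squares_bound[of "cmod (fourier f1 x)" "cmod (fourier f2 x)"] by (simp add: power2_sum)
    finally have "ennreal ((cmod (fourier f x))\<^sup>2) \<le> ennreal (2 * (cmod (fourier f1 x))\<^sup>2 + 2 * (cmod (fourier f2 x))\<^sup>2)"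
      by (rule ennreal_leI)
    also have "\<dots> = 2 * (ennreal (cmod (fourier f1 x)))\<^sup>2 + 2 * ennreal ((cmod (fourier f2 x))\<^sup>2)"
      by (simp add: ennreal_plus ennreal_mult ennreal_power)
    also have "\<dots> \<le> 2 * (hardy \<rho> z)\<^sup>2 + 2 * ennreal ((cmod (fourier f2 x))\<^sup>2)"
      using order_trans[OF norm_fourier_le[OF f1] L1] by (intro add_mono mult_left_mono power_mono) auto
    finally show "(ennreal (cmod (fourier f x)))\<^sup>2 * indicator E x
      \<le> 2 * (hardy \<rho> z)\<^sup>2 * indicator E x + 2 * ennreal ((cmod (fourier f2 x))\<^sup>2)"
      by (auto simp: ennreal_power split: split_indicator)
  qed
  also have "\<dots> = 2 * ((hardy \<rho> z)\<^sup>2 * emeasure lebesgue E) + 2 * (\<integral>\<^sup>+x. ennreal ((cmod (fourier f2 x))\<^sup>2) \<partial>lebesgue)"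
    by (subst nn_integral_add) (simp_all add: nn_integral_cmult mult.assoc)
  \<comment> \<open>The outer factors 2 come from (a + b)^2 <= 2 a^2 + 2 b^2. The high part is
    bounded pointwise by \<open>hardy \<rho> z\<close> on a set of measure at most z, the low part
    by the L^2 inequality.\<close>
  also have "\<dots> \<le> 2 * ?P + 2 * (2 * ?P)"
  proof (intro add_mono mult_left_mono)
    have "(hardy \<rho> z)\<^sup>2 * emeasure lebesgue E \<le> (hardy \<rho> z)\<^sup>2 * ennreal z"
      by (intro mult_left_mono le) simp
    also have "\<dots> \<le> ?P" using hardy_square_le[OF z, of \<rho>] by (simp add: mult.commute)
    finally show "(hardy \<rho> z)\<^sup>2 * emeasure lebesgue E \<le> ?P" .
    show "(\<integral>\<^sup>+x. ennreal ((cmod (fourier f2 x))\<^sup>2) \<partial>lebesgue) \<le> 2 * ?P"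
      using fourier_L2_le[OF f2] L2 by (rule order_trans)
  qed auto
  also have "\<dots> = 6 * ?P"
  proof -
    have "2 * ?P + 2 * (2 * ?P) = (2 + 2 * 2) * ?P"
      by (simp only: distrib_right mult.assoc)
    then show ?thesis by simp
  qed
  finally show ?thesis .
qed

section \<open>Level sets\<close>

definition avg :: "(real \<Rightarrow> ennreal) \<Rightarrow> real \<Rightarrow> ennreal" where
  "avg g z = ennreal (1 / z) * (head_int g z)"

lemma avg_measurable [measurable]:
  assumes [measurable]: "g \<in> borel_measurable borel"
  shows "avg g \<in> borel_measurable borel"
proof -
  have "(\<lambda>z. ennreal (1 / z) * \<integral>\<^sup>+t. g t * indicator {t. 0 < t \<and> t < z} t \<partial>lborel) \<in> borel_measurable borel"
    by measurable
  then show ?thesis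
    by (simp add: avg_def[abs_def] greaterThanLessThan_def greaterThan_def lessThan_def Int_def)
qed

text \<open>Rescaling to a fixed interval makes the dependence on z pointwise, so that averaging
  visibly preserves monotonicity.\<close>

lemma avg_eq:
  assumes [measurable]: "g \<in> borel_measurable borel" and "z > 0"
  shows "avg g z = (\<integral>\<^sup>+s\<in>{0<..<1}. g (z * s) \<partial>lborel)"
proof -
  have "(head_int g z)
     = ennreal \<bar>z\<bar> * (\<integral>\<^sup>+s. g (0 + z * s) * indicator {0<..<z} (0 + z * s) \<partial>lborel)"
    using \<open>z > 0\<close> by (intro nn_integral_real_affine) auto
  also have "(\<lambda>s. g (0 + z * s) * indicator {0<..<z} (0 + z * s)) = (\<lambda>s. g (z * s) * indicator {0<..<1} s)"
    using \<open>z > 0\<close> by (auto split: split_indicator simp: zero_less_mult_iff)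
  moreover have "ennreal (1 / z) * ennreal z = 1"
    using \<open>z > 0\<close> by (simp flip: ennreal_mult)
  ultimately show ?thesis
    using \<open>z > 0\<close> by (simp add: avg_def flip: mult.assoc)
qed

lemma avg_antimono:
  assumes [measurable]: "g \<in> borel_measurable borel"
    and "\<And>s t. 0 < s \<Longrightarrow> s \<le> t \<Longrightarrow> g t \<le> g s" "0 < s" "s \<le> t"
  shows "avg g t \<le> avg g s"
proof -
  have "g (t * x) * indicator {0<..<1} x \<le> g (s * x) * indicator {0<..<1} x" for x
    using assms(3,4) assms(2)[of "s * x" "t * x"] by (auto split: split_indicator)
  then show ?thesis using assms(3,4) by (simp add: avg_eq nn_integral_mono)
qed

lemma nn_integral_initial_ge:
  assumes "\<And>t. 0 < t \<Longrightarrow> t < z \<Longrightarrow> a \<le> g t" "z > 0"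
  shows "ennreal z * a \<le> (\<integral>\<^sup>+t\<in>initial (ennreal z). g t \<partial>lborel)"
proof -
  have "ennreal z * a = (\<integral>\<^sup>+t. a * indicator (initial (ennreal z)) t \<partial>lborel)"
    by (subst nn_integral_cmult) (simp_all add: emeasure_Collect_less_ennreal mult.commute)
  also have "\<dots> \<le> (\<integral>\<^sup>+t\<in>initial (ennreal z). g t \<partial>lborel)"
    using assms by (intro nn_integral_mono) (auto split: split_indicator simp: ennreal_less_iff)
  finally show ?thesis .
qed

text \<open>For \<open>q < 2\<close> the pointwise bound \<open>h\<^sup>q \<le> a\<^bsup>q/2\<^esup> + a\<^bsup>q/2-1\<^esup> h\<^sup>2\<close> replaces Hoelder's inequality.\<close>

lemma nn_integral_epowr_small_le:
  assumes [measurable]: "h \<in> borel_measurable M" "\<phi> \<in> borel_measurable borel"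
    and \<phi>: "\<And>s t. 0 < s \<Longrightarrow> s \<le> t \<Longrightarrow> \<phi> t \<le> \<phi> s"
    and q: "0 < q" "q < 2"
    and key: "\<And>E z. E \<in> sets M \<Longrightarrow> z > 0 \<Longrightarrow> emeasure M E \<le> ennreal z \<Longrightarrow>
      (\<integral>\<^sup>+x\<in>E. (h x)\<^sup>2 \<partial>M) \<le> 6 * (\<integral>\<^sup>+t\<in>{0<..<z}. (\<phi> t)\<^sup>2 \<partial>lborel)"
    and [measurable]: "E \<in> sets M" and fin: "emeasure M E < \<infinity>"
  shows "(\<integral>\<^sup>+x\<in>E. h x epowr q \<partial>M)
       \<le> 7 * (\<integral>\<^sup>+t\<in>initial (emeasure M E). avg (\<lambda>t. (\<phi> t)\<^sup>2) t epowr (q / 2) \<partial>lborel)"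
proof -
  obtain z where z: "emeasure M E = ennreal z" "z \<ge> 0"
    using fin by (cases "emeasure M E") auto
  let ?\<psi> = "avg (\<lambda>t. (\<phi> t)\<^sup>2)"
  have anti: "?\<psi> t \<le> ?\<psi> s" if "0 < s" "s \<le> t" for s t
    using that by (intro avg_antimono) (auto intro!: power_mono \<phi>)
  show ?thesis
  proof (cases "z = 0")
    case True
    then have "E \<in> null_sets M" using z by auto
    then have "(\<integral>\<^sup>+x\<in>E. h x epowr q \<partial>M) = 0"
      by (rule nn_integral_null_set)
    then show ?thesis by simp
  next
    case False
    with z have "z > 0" by simp
    have zz: "ennreal z * ennreal (1 / z) = 1" using \<open>z > 0\<close> by (simp flip: ennreal_mult)
    define a where "a = ?\<psi> z"
    have za: "(\<integral>\<^sup>+t\<in>{0<..<z}. (\<phi> t)\<^sup>2 \<partial>lborel) = ennreal z * a"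
      by (simp add: a_def avg_def zz flip: mult.assoc)
    have h2: "(\<integral>\<^sup>+x\<in>E. (h x)\<^sup>2 \<partial>M) \<le> 6 * (ennreal z * a)"
      using key[of E z] z \<open>z > 0\<close> by (simp add: za)
    have R: "ennreal z * a epowr (q / 2) \<le> (\<integral>\<^sup>+t\<in>initial (ennreal z). ?\<psi> t epowr (q / 2) \<partial>lborel)"
      using q anti unfolding a_def by (intro nn_integral_initial_ge epowr_mono) (auto simp: \<open>z > 0\<close>)
    consider "a = 0" | "a = top" | "a \<noteq> 0" "a \<noteq> top" by blast
    then show ?thesis
    proof cases
      case 1
      then have "(\<integral>\<^sup>+x\<in>E. (h x)\<^sup>2 \<partial>M) = 0" using h2 by simp
      then have "AE x in M. (h x)\<^sup>2 * indicator E x = 0"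
        by (subst (asm) nn_integral_0_iff_AE) auto
      then have "AE x in M. h x epowr q * indicator E x = 0"
        by eventually_elim (use q in \<open>auto simp: zero_epowr split: split_indicator\<close>)
      then have "(\<integral>\<^sup>+x\<in>E. h x epowr q \<partial>M) = 0"
        by (subst nn_integral_0_iff_AE) auto
      then show ?thesis by simp
    next
      case 2
      then have "ennreal z * a epowr (q / 2) = top"
        using q \<open>z > 0\<close> by (simp add: top_epowr ennreal_mult_top)
      then show ?thesis using R z by (simp add: top_unique ennreal_mult_top)
    next
      case 3
      have split: "a = a epowr (q / 2) * a epowr (1 - q / 2)"
        using q by (subst epowr_add[symmetric]) auto
      \<comment> \<open>The pointwise bound is multiplied by a^(1 - q/2) so that only non-negative
        powers occur. If h^2 <= a the term a dominates, otherwise h^2 does.\<close>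
      have pw: "h x epowr q * a epowr (1 - q / 2) \<le> a + (h x)\<^sup>2" for x
      proof -
        have hq: "h x epowr q = ((h x)\<^sup>2) epowr (q / 2)"
          by (simp add: epowr_epowr flip: epowr_2)
        show ?thesis
        proof (cases "(h x)\<^sup>2 \<le> a")
          case True
          then have "h x epowr q * a epowr (1 - q / 2) \<le> a epowr (q / 2) * a epowr (1 - q / 2)"
            unfolding hq using q by (intro mult_right_mono epowr_mono) auto
          then show ?thesis using split by (simp add: add_increasing2)
        next
          case False
          then have "h x epowr q * a epowr (1 - q / 2) \<le> ((h x)\<^sup>2) epowr (q / 2) * ((h x)\<^sup>2) epowr (1 - q / 2)"
            unfolding hq using q by (intro mult_left_mono epowr_mono) auto
          also have "\<dots> = (h x)\<^sup>2"
            using q by (subst epowr_add[symmetric]) auto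
          finally show ?thesis by (simp add: add_increasing)
        qed
      qed
      have "a epowr (1 - q / 2) * (\<integral>\<^sup>+x\<in>E. h x epowr q \<partial>M) = (\<integral>\<^sup>+x\<in>E. h x epowr q * a epowr (1 - q / 2) \<partial>M)"
        by (subst nn_integral_cmult[symmetric]) (simp_all add: mult_ac)
      also have "\<dots> \<le> (\<integral>\<^sup>+x. a * indicator E x + (h x)\<^sup>2 * indicator E x \<partial>M)"
        using pw by (intro nn_integral_mono) (auto split: split_indicator)
      also have "\<dots> = ennreal z * a + (\<integral>\<^sup>+x\<in>E. (h x)\<^sup>2 \<partial>M)"
        using z by (subst nn_integral_add) (simp_all add: nn_integral_cmult mult.commute)
      also have "\<dots> \<le> ennreal z * a + 6 * (ennreal z * a)"
        using h2 by (intro add_left_mono)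
      also have "\<dots> = (1 + 6) * (ennreal z * a)"
        by (simp only: distrib_right mult_1)
      also have "\<dots> = a epowr (1 - q / 2) * (7 * (ennreal z * a epowr (q / 2)))"
        by (subst split) (simp add: mult_ac)
      finally have "a epowr (1 - q / 2) * (\<integral>\<^sup>+x\<in>E. h x epowr q \<partial>M) \<le> a epowr (1 - q / 2) * (7 * (ennreal z * a epowr (q / 2)))" .
      moreover have "a epowr (1 - q / 2) \<noteq> 0" "a epowr (1 - q / 2) \<noteq> top"
        using 3 q by (auto simp: epowr_eq_0_iff epowr_eq_top_iff)
      ultimately have "(\<integral>\<^sup>+x\<in>E. h x epowr q \<partial>M) \<le> 7 * (ennreal z * a epowr (q / 2))"
        by (subst (asm) ennreal_mult_le_mult_iff) auto
      also have "\<dots> \<le> 7 * (\<integral>\<^sup>+t\<in>initial (ennreal z). ?\<psi> t epowr (q / 2) \<partial>lborel)"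
        by (intro mult_left_mono R) auto
      finally show ?thesis using z by simp
    qed
  qed
qed

text \<open>For \<open>q > 2\<close> the estimate on the level sets of \<open>h\<close> is integrated against \<open>\<lambda>\<^bsup>q-3\<^esup> d\<lambda>\<close>; the
  part of the right-hand side where \<open>\<phi> \<le> \<lambda> / 4\<close> is absorbed into the left-hand side.\<close>

lemma level_set_le:
  assumes [measurable]: "h \<in> borel_measurable M" "\<phi> \<in> borel_measurable borel"
    and bdd: "\<And>x. h x \<le> ennreal B"
    and key: "\<And>E z. E \<in> sets M \<Longrightarrow> z > 0 \<Longrightarrow> emeasure M E \<le> ennreal z \<Longrightarrow>
      (\<integral>\<^sup>+x\<in>E. (h x)\<^sup>2 \<partial>M) \<le> 6 * (\<integral>\<^sup>+t\<in>{0<..<z}. (\<phi> t)\<^sup>2 \<partial>lborel)"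
    and E[measurable]: "E \<in> sets M" and fin: "emeasure M E < \<infinity>"
  shows "(\<integral>\<^sup>+x. (h x)\<^sup>2 * indicator E x * indicator {x\<in>space M. h x > l} x \<partial>M)
       \<le> 12 * (\<integral>\<^sup>+t. (\<phi> t)\<^sup>2 * indicator (initial (emeasure M E)) t * indicator {t. 4 * \<phi> t > l} t \<partial>lborel)"
proof -
  let ?E = "{x\<in>space M. x \<in> E \<and> h x > l}"
  have le: "emeasure M ?E \<le> emeasure M E" by (intro emeasure_mono) auto
  then obtain z where z: "emeasure M ?E = ennreal z" "z \<ge> 0"
    using fin by (cases "emeasure M ?E") auto
  define I where "I = (\<integral>\<^sup>+x\<in>?E. (h x)\<^sup>2 \<partial>M)"
  define X where "X = (\<integral>\<^sup>+t. (\<phi> t)\<^sup>2 * indicator (initial (emeasure M E)) t * indicator {t. 4 * \<phi> t > l} t \<partial>lborel)"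
  have eq: "(\<integral>\<^sup>+x. (h x)\<^sup>2 * indicator E x * indicator {x\<in>space M. h x > l} x \<partial>M) = I"
    unfolding I_def by (intro nn_integral_cong) (auto split: split_indicator)
  have "I \<le> 12 * X"
  proof (cases "z = 0")
    case True
    then have "?E \<in> null_sets M" using z by auto
    then have "I = 0" unfolding I_def by (rule nn_integral_null_set)
    then show ?thesis by simp
  next
    case False
    with z have "z > 0" by simp
    \<comment> \<open>Finiteness of I, from the boundedness of \<open>h\<close>, is what permits
      absorbing I into the left side.\<close>
    have "I \<le> (\<integral>\<^sup>+x. (ennreal B)\<^sup>2 * indicator ?E x \<partial>M)"
      unfolding I_def using bdd by (intro nn_integral_mono mult_right_mono power_mono) auto
    also have "\<dots> = (ennreal B)\<^sup>2 * ennreal z"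
      using z by (subst nn_integral_cmult) simp_all
    also have "\<dots> < \<infinity>" by (simp add: ennreal_mult_less_top power_less_top_ennreal)
    finally have I: "I < \<infinity>" .
    have "l\<^sup>2 * ennreal z = (\<integral>\<^sup>+x. l\<^sup>2 * indicator ?E x \<partial>M)"
      using z by (subst nn_integral_cmult) simp_all
    also have "\<dots> \<le> I"
      unfolding I_def by (intro nn_integral_mono) (auto split: split_indicator intro!: power_mono)
    finally have lI: "l\<^sup>2 * ennreal z \<le> I" .
    \<comment> \<open>The factor 16 = 4^2 matches the threshold: where 4 \<phi> <= l one has 16
      \<phi>^2 <= l^2, and l^2 z <= I.\<close>
    have "16 * I \<le> 16 * (6 * (\<integral>\<^sup>+t\<in>{0<..<z}. (\<phi> t)\<^sup>2 \<partial>lborel))"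
      unfolding I_def using z \<open>z > 0\<close> by (intro mult_left_mono key) auto
    also have "\<dots> = 6 * (\<integral>\<^sup>+t. 16 * ((\<phi> t)\<^sup>2 * indicator {0<..<z} t) \<partial>lborel)"
      by (subst nn_integral_cmult) (simp_all add: mult_ac)
    also have "\<dots> \<le> 6 * (\<integral>\<^sup>+t. 16 * ((\<phi> t)\<^sup>2 * indicator (initial (emeasure M E)) t * indicator {t. 4 * \<phi> t > l} t)
        + l\<^sup>2 * indicator {0<..<z} t \<partial>lborel)"
    proof (intro mult_left_mono nn_integral_mono)
      fix t
      have "16 * (\<phi> t)\<^sup>2 \<le> l\<^sup>2" if "\<not> 4 * \<phi> t > l"
        using power_mono[of "4 * \<phi> t" l 2] that by (simp add: power_mult_distrib)
      moreover have "ennreal t < emeasure M E" if "0 < t" "t < z"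
        by (rule order_less_le_trans[of _ "ennreal z"]) (use that le z in \<open>auto simp: ennreal_less_iff\<close>)
      ultimately show "16 * ((\<phi> t)\<^sup>2 * indicator {0<..<z} t)
        \<le> 16 * ((\<phi> t)\<^sup>2 * indicator (initial (emeasure M E)) t * indicator {t. 4 * \<phi> t > l} t) + l\<^sup>2 * indicator {0<..<z} t"
        by (auto split: split_indicator simp: add_increasing2)
    qed auto
    also have "\<dots> = 6 * (16 * X + l\<^sup>2 * ennreal z)"
      using z by (subst nn_integral_add) (simp_all add: nn_integral_cmult X_def)
    also have "\<dots> \<le> 6 * (16 * X + I)"
      using lI by (intro mult_left_mono add_left_mono) auto
    finally have *: "16 * I \<le> 6 * (16 * X + I)" .
    show ?thesis
    proof (cases "X = top")
      case False
      then obtain i x where ix: "I = ennreal i" "i \<ge> 0" "X = ennreal x" "x \<ge> 0"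
        using I by (cases I; cases X) auto
      with * have "ennreal (16 * i) \<le> ennreal (6 * (16 * x + i))"
        by (simp add: ennreal_mult ennreal_plus)
      \<comment> \<open>Absorption leaves 10 i <= 96 x; 12 is a rounded constant.\<close>
      then have "i \<le> 12 * x"
        using \<open>i \<ge> 0\<close> \<open>x \<ge> 0\<close> by (subst (asm) ennreal_le_iff) auto
      then have "ennreal i \<le> ennreal (12 * x)" by (rule ennreal_leI)
      then show ?thesis using ix by (simp add: ennreal_mult)
    qed (simp add: ennreal_mult_top)
  qed
  then show ?thesis unfolding eq X_def .
qed

text \<open>Write h^q = h^2 h^(q-2) and take the layer cake of h^(q-2), whose superlevel sets are
  superlevel sets of \<open>h\<close>. The factor 4^(q-2) comes from the enlarged set {4 \<phi> > l}
  on the right.\<close>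

lemma nn_integral_epowr_large_le:
  assumes M: "sigma_finite_measure M"
    and [measurable]: "h \<in> borel_measurable M" "\<phi> \<in> borel_measurable borel"
    and bdd: "\<And>x. h x \<le> ennreal B"
    and q: "q > 2"
    and key: "\<And>E z. E \<in> sets M \<Longrightarrow> z > 0 \<Longrightarrow> emeasure M E \<le> ennreal z \<Longrightarrow>
      (\<integral>\<^sup>+x\<in>E. (h x)\<^sup>2 \<partial>M) \<le> 6 * (\<integral>\<^sup>+t\<in>{0<..<z}. (\<phi> t)\<^sup>2 \<partial>lborel)"
    and [measurable]: "E \<in> sets M" and fin: "emeasure M E < \<infinity>"
  shows "(\<integral>\<^sup>+x\<in>E. h x epowr q \<partial>M)
       \<le> (12 * 4 epowr (q - 2)) * (\<integral>\<^sup>+t\<in>initial (emeasure M E). \<phi> t epowr q \<partial>lborel)"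
proof -
  interpret sigma_finite_measure M by fact
  have split: "x epowr q = x\<^sup>2 * x epowr (q - 2)" for x :: ennreal
    using q epowr_add[of 2 "q - 2" x] by (simp add: epowr_2)
  have "(\<integral>\<^sup>+x\<in>E. h x epowr q \<partial>M) = (\<integral>\<^sup>+x. ((h x)\<^sup>2 * indicator E x) * h x epowr (q - 2) \<partial>M)"
    by (simp add: split mult_ac)
  also have "\<dots> = (\<integral>\<^sup>+\<alpha>\<in>{0<..}. (\<integral>\<^sup>+x\<in>{x\<in>space M. h x epowr (q - 2) > ennreal \<alpha>}. ((h x)\<^sup>2 * indicator E x) \<partial>M) \<partial>lborel)"
    by (rule layer_cake) simp_all
  also have "\<dots> \<le> (\<integral>\<^sup>+\<alpha>\<in>{0<..}. (12 * (\<integral>\<^sup>+t\<in>{t\<in>space lborel. (4 * \<phi> t) epowr (q - 2) > ennreal \<alpha>}.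
      ((\<phi> t)\<^sup>2 * indicator (initial (emeasure M E)) t) \<partial>lborel)) \<partial>lborel)"
  proof (intro nn_integral_mono mult_right_mono)
    fix \<alpha> :: real
    show "(\<integral>\<^sup>+x\<in>{x\<in>space M. h x epowr (q - 2) > ennreal \<alpha>}. ((h x)\<^sup>2 * indicator E x) \<partial>M)
      \<le> 12 * (\<integral>\<^sup>+t\<in>{t\<in>space lborel. (4 * \<phi> t) epowr (q - 2) > ennreal \<alpha>}.
        ((\<phi> t)\<^sup>2 * indicator (initial (emeasure M E)) t) \<partial>lborel)"
      using level_set_le[OF assms(2,3) bdd key \<open>E \<in> sets M\<close> fin, of "ennreal \<alpha> epowr (1 / (q - 2))"] q
      by (simp add: less_epowr_iff)
  qed simp
  also have "\<dots> = 12 * (\<integral>\<^sup>+\<alpha>\<in>{0<..}. (\<integral>\<^sup>+t\<in>{t\<in>space lborel. (4 * \<phi> t) epowr (q - 2) > ennreal \<alpha>}.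
      ((\<phi> t)\<^sup>2 * indicator (initial (emeasure M E)) t) \<partial>lborel) \<partial>lborel)"
    unfolding mult.assoc by (rule nn_integral_cmult) simp
  also have "\<dots> = 12 * (\<integral>\<^sup>+t. ((\<phi> t)\<^sup>2 * indicator (initial (emeasure M E)) t) * (4 * \<phi> t) epowr (q - 2) \<partial>lborel)"
    by (subst lborel.layer_cake) simp_all
  also have "\<dots> = 12 * (\<integral>\<^sup>+t. 4 epowr (q - 2) * (\<phi> t epowr q * indicator (initial (emeasure M E)) t) \<partial>lborel)"
    using q by (simp add: split epowr_mult mult_ac)
  also have "\<dots> = (12 * 4 epowr (q - 2)) * (\<integral>\<^sup>+t\<in>initial (emeasure M E). \<phi> t epowr q \<partial>lborel)"
    by (subst nn_integral_cmult) (simp_all add: mult.assoc)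
  finally show ?thesis .
qed

section \<open>Quasi-concave functions\<close>

text \<open>Distinct integer exponents bounded by N select part of a geometric series whose largest
  possible term is R^N.\<close>

lemma sum_powr_inj_le:
  fixes e :: "int \<Rightarrow> int" and R :: real
  assumes "R > 1" "finite A" "inj_on e A" "\<And>k. k \<in> A \<Longrightarrow> e k \<le> N"
  shows "(\<Sum>k\<in>A. R powr e k) \<le> R powr N / (1 - 1 / R)"
proof -
  have R: "norm (1 / R) < 1" using \<open>R > 1\<close> by simp
  have "(\<Sum>k\<in>A. R powr e k) = (\<Sum>m\<in>e ` A. R powr m)"
    by (simp add: sum.reindex[OF assms(3)])
  also have "\<dots> = (\<Sum>j\<in>(\<lambda>m. nat (N - m)) ` e ` A. R powr N * (1 / R) ^ j)"
  proof (subst sum.reindex[of "\<lambda>m. nat (N - m)"])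
    show "inj_on (\<lambda>m. nat (N - m)) (e ` A)"
    proof (rule inj_onI)
      fix m m' assume "m \<in> e ` A" "m' \<in> e ` A" "nat (N - m) = nat (N - m')"
      moreover from this have "m \<le> N" "m' \<le> N" using assms(4) by auto
      ultimately show "m = m'" by simp
    qed
    have "R powr m = R powr N * (1 / R) ^ nat (N - m)" if "m \<in> e ` A" for m
    proof -
      have "m \<le> N" using that assms(4) by auto
      have "(1 / R) ^ nat (N - m) = R powr (- real (nat (N - m)))"
        using \<open>R > 1\<close> by (simp add: powr_minus powr_realpow power_one_over inverse_eq_divide)
      also have "- real (nat (N - m)) = m - N"
        using \<open>m \<le> N\<close> by simp
      finally have "(1 / R) ^ nat (N - m) = R powr (m - N)" .
      then show ?thesis using \<open>R > 1\<close> by (simp flip: powr_add)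
    qed
    then show "(\<Sum>m\<in>e ` A. R powr m) = sum ((\<lambda>j. R powr N * (1 / R) ^ j) \<circ> (\<lambda>m. nat (N - m))) (e ` A)"
      by (intro sum.cong) auto
  qed
  also have "\<dots> = R powr N * (\<Sum>j\<in>(\<lambda>m. nat (N - m)) ` e ` A. (1 / R) ^ j)"
    by (simp add: sum_distrib_left)
  also have "\<dots> \<le> R powr N * (\<Sum>j. (1 / R) ^ j)"
    using R \<open>R > 1\<close> \<open>finite A\<close> by (intro mult_left_mono sum_le_suminf summable_geometric) auto
  also have "\<dots> = R powr N / (1 - 1 / R)"
    using R by (simp add: suminf_geometric)
  finally show ?thesis .
qed

text \<open>Two geometric series, one on each side of t, contribute 1 / (1 - 2^(-r)) each; the
  factor 2^r pays for replacing the dyadic value 2^(c i) by g(t), as 2^(c i) <= 2 g(t).\<close>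

definition kink_const :: "real \<Rightarrow> real" where
  "kink_const r = 2 / (1 - 1 / 2 powr r) * 2 powr r"

lemma kink_const_nonneg: "r > 0 \<Longrightarrow> kink_const r \<ge> 0"
proof -
  assume "r > 0"
  then have "1 < (2::real) powr r" using powr_less_mono[of 0 r 2] by simp
  then have "1 / (2::real) powr r \<le> 1" by simp
  then show ?thesis by (simp add: kink_const_def)
qed

text \<open>The representation of a quasi-concave function by its kinks. On the dyadic scale the
  integer sequence \<open>c\<close> descends by steps of \<open>0\<close> or \<open>-1\<close>, and \<open>K\<close> consists of the positions
  where a flat step is followed by a descending one. Consecutive kinks have different values
  of \<open>c k\<close> and of \<open>c k + k\<close>, which makes the sums in the second claim geometric.\<close>

lemma quasiconcave_decomposition:
  fixes g :: "real \<Rightarrow> real"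
  assumes pos: "\<And>t. t > 0 \<Longrightarrow> g t > 0"
    and anti: "\<And>s t. 0 < s \<Longrightarrow> s \<le> t \<Longrightarrow> g t \<le> g s"
    and mono: "\<And>s t. 0 < s \<Longrightarrow> s \<le> t \<Longrightarrow> s * g s \<le> t * g t"
    and bdd: "\<And>t. t > 0 \<Longrightarrow> g t \<le> B"
    and lim: "(g \<longlongrightarrow> 0) at_top"
  shows "\<exists>(c :: int \<Rightarrow> int) (K :: int set).
    (\<forall>t>0. \<exists>k\<in>K. g t \<le> 4 * (2 powr c k * min 1 (2 powr k / t))) \<and>
    (\<forall>t>0. \<forall>r>0. \<forall>A. finite A \<longrightarrow> A \<subseteq> K \<longrightarrow>
      (\<Sum>k\<in>A. (2 powr c k * min 1 (2 powr k / t)) powr r) \<le> kink_const r * g t powr r)"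
proof -
  define c :: "int \<Rightarrow> int" where "c k = \<lfloor>log 2 (g (2 powr k))\<rfloor>" for k
  define K where "K = {k. c (k - 1) = c k \<and> c (k + 1) = c k - 1}"
  have c_le: "2 powr c k \<le> g (2 powr k)" for k
    using pos[of "2 powr k"] by (simp add: c_def powr_le_iff)
  have c_gt: "g (2 powr k) < 2 powr (c k + 1)" for k
    using pos[of "2 powr k"] log_less_iff[of 2 "g (2 powr k)" "c k + 1"] by (simp add: c_def)
  \<comment> \<open>Doubling t cannot increase g, and cannot more than halve it because t g(t) is
    non-decreasing.\<close>
  have step: "c (k + 1) = c k \<or> c (k + 1) = c k - 1" for k
  proof -
    have le: "(2::real) powr k \<le> 2 powr (k + 1)" by simp
    have "g (2 powr (k + 1)) \<le> g (2 powr k)"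
      using anti[OF _ le] by simp
    then have "log 2 (g (2 powr (k + 1))) \<le> log 2 (g (2 powr k))"
      using pos by simp
    then have 1: "c (k + 1) \<le> c k"
      unfolding c_def by (simp add: floor_mono)
    have "2 powr k * g (2 powr k) \<le> 2 powr (k + 1) * g (2 powr (k + 1))"
      using mono[OF _ le] by simp
    then have "g (2 powr k) \<le> 2 * g (2 powr (k + 1))"
      by (simp add: powr_add)
    then have "log 2 (g (2 powr k)) \<le> log 2 (2 * g (2 powr (k + 1)))"
      using pos by (subst log_le_cancel_iff) auto
    also have "\<dots> = 1 + log 2 (g (2 powr (k + 1)))"
      using pos[of "2 powr (k + 1)"] by (subst log_mult) auto
    finally have "log 2 (g (2 powr k)) - 1 \<le> log 2 (g (2 powr (k + 1)))" by simp
    from floor_mono[OF this] have 2: "c k - 1 \<le> c (k + 1)"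
      by (simp add: c_def)
    from 1 2 show ?thesis by linarith
  qed
  have c_add: "c (k + int n) \<le> c k \<and> c k - int n \<le> c (k + int n)" for k n
  proof (induction n)
    case (Suc n)
    then show ?case using step[of "k + int n"] by (auto simp: algebra_simps)
  qed simp
  have c_anti: "c k' \<le> c k" if "k \<le> k'" for k k'
    using c_add[of k "nat (k' - k)"] that by simp
  have d_mono: "c k + k \<le> c k' + k'" if "k \<le> k'" for k k'
    using c_add[of k "nat (k' - k)"] that by simp
  \<comment> \<open>A kink is followed by a descent, so \<open>c\<close> is strictly smaller at
    every later kink; in \<open>inj_d\<close>, a kink is preceded by a flat step, across which c k +
    k increases.\<close>
  have inj_c: "inj_on c K"
  proof (rule linorder_inj_onI)
    fix k k' assume "k < k'" "k \<in> K" "k' \<in> K"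
    then have "c k' \<le> c (k + 1)" "c (k + 1) = c k - 1"
      using c_anti[of "k + 1" k'] by (simp_all add: K_def)
    then show "c k \<noteq> c k'" by linarith
  qed auto
  have inj_d: "inj_on (\<lambda>k. c k + k) K"
  proof (rule linorder_inj_onI)
    fix k k' assume "k < k'" "k \<in> K" "k' \<in> K"
    then have "c k + k \<le> c (k' - 1) + (k' - 1)" "c (k' - 1) = c k'"
      using d_mono[of k "k' - 1"] by (simp_all add: K_def)
    then show "c k + k \<noteq> c k' + k'" by linarith
  qed auto
  have dyadic: "\<exists>i::int. 2 powr i \<le> t \<and> t < 2 powr (real_of_int i + 1)" if "t > 0" for t :: real
  proof (intro exI conjI)
    show "2 powr \<lfloor>log 2 t\<rfloor> \<le> t"
      using that by (simp add: powr_le_iff)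
    show "t < 2 powr (real_of_int \<lfloor>log 2 t\<rfloor> + 1)"
      using that by (intro iffD1[OF log_less_iff]) simp_all
  qed
  show ?thesis
  proof (intro exI[of _ c] exI[of _ K] conjI allI impI)
    fix t :: real assume "t > 0"
    then obtain i :: int where i: "2 powr i \<le> t" "t < 2 powr (real_of_int i + 1)"
      using dyadic[OF \<open>t > 0\<close>] by blast
    have "g t \<le> g (2 powr i)" using anti[OF _ i(1)] by simp
    also have "\<dots> < 2 * 2 powr c i" using c_gt[of i] by (simp add: powr_add)
    finally have gt: "g t < 2 * 2 powr c i" .
    moreover have "0 < (2::real) powr c i" by simp
    ultimately have gt4: "g t \<le> 4 * 2 powr c i" by linarith
    from step[of i] show "\<exists>k\<in>K. g t \<le> 4 * (2 powr c k * min 1 (2 powr k / t))"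
    proof
      assume flat: "c (i + 1) = c i"
      \<comment> \<open>A flat stretch to the right must end because g tends to 0. Its last point is
        a kink with the same value of \<open>c\<close>, beyond t.\<close>
      have ex: "\<exists>n. c (i + 1 + int n + 1) \<noteq> c (i + 1 + int n)"
      proof (rule ccontr)
        assume "\<not> ?thesis"
        then have "c (i + 1 + int n) = c (i + 1)" for n
          by (induction n) (auto simp: algebra_simps)
        then have ci: "2 powr c i \<le> g (2 powr (i + 1 + int n))" for n
          using c_le[of "i + 1 + int n"] flat by simp
        have "eventually (\<lambda>t. g t < 2 powr c i) at_top"
          using lim by (rule order_tendstoD) simp
        then obtain T where T: "\<And>t. t \<ge> T \<Longrightarrow> g t < 2 powr c i"
          by (auto simp: eventually_at_top_linorder)
        obtain n where "T / 2 powr (i + 1) < 2 ^ n"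
          using real_arch_pow[of 2 "T / 2 powr (i + 1)"] by auto
        then have "T < 2 powr (i + 1 + int n)"
          by (simp add: powr_add powr_realpow field_simps)
        then show False using ci[of n] T[of "2 powr (i + 1 + int n)"] by simp
      qed
      define n where "n = (LEAST n. c (i + 1 + int n + 1) \<noteq> c (i + 1 + int n))"
      have n: "c (i + 1 + int n + 1) \<noteq> c (i + 1 + int n)"
        unfolding n_def using ex by (rule LeastI_ex)
      have before: "c (i + 1 + int m + 1) = c (i + 1 + int m)" if "m < n" for m
        using not_less_Least[of m "\<lambda>n. c (i + 1 + int n + 1) \<noteq> c (i + 1 + int n)"] that
        by (auto simp: n_def)
      have const: "c (i + 1 + int m) = c i" if "m \<le> n" for m
        using that
      proof (induction m)
        case (Suc m)
        then show ?case using before[of m] by (simp add: algebra_simps)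
      qed (simp add: flat)
      define k where "k = i + 1 + int n"
      have "c (k - 1) = c k"
      proof (cases n)
        case 0
        then show ?thesis using flat by (simp add: k_def)
      next
        case (Suc m)
        then show ?thesis using const[of m] const[of n] by (simp add: k_def algebra_simps)
      qed
      moreover have "c (k + 1) = c k - 1"
        using n step[of k] by (auto simp: k_def)
      ultimately have "k \<in> K" by (simp add: K_def)
      moreover have "t < 2 powr k"
      proof -
        note i(2)
        also have "(2::real) powr (real_of_int i + 1) \<le> 2 powr k" by (simp add: k_def)
        finally show ?thesis .
      qed
      then have "min 1 (2 powr k / t) = 1" using \<open>t > 0\<close> by (simp add: field_simps)
      moreover have "c k = c i" using const[of n] by (simp add: k_def)
      ultimately show ?thesis using gt4 by (intro bexI[of _ k]) simp_all
    next
      assume drop: "c (i + 1) = c i - 1"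
      \<comment> \<open>A descent continued forever to the left would make g unbounded, so a flat
        step is met; the kink after it lies at or before i.\<close>
      have ex: "\<exists>n. c (i - int n - 1) = c (i - int n)"
      proof (rule ccontr)
        assume *: "\<not> ?thesis"
        have ci: "c (i - int n) = c i + int n" for n
        proof (induction n)
          case (Suc n)
          have "c (i - int n - 1) \<noteq> c (i - int n)" using * by blast
          then show ?case using Suc step[of "i - int n - 1"] by (auto simp: algebra_simps)
        qed simp
        obtain n where n: "B / 2 powr c i < 2 ^ n"
          using real_arch_pow[of 2 "B / 2 powr c i"] by auto
        have "2 powr (c i + int n) \<le> B"
          using c_le[of "i - int n"] bdd[of "2 powr (i - int n)"] by (simp add: ci)
        with n show False
          by (simp add: powr_add powr_realpow field_simps)
      qed
      define n where "n = (LEAST n. c (i - int n - 1) = c (i - int n))"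
      have n: "c (i - int n - 1) = c (i - int n)"
        unfolding n_def using ex by (rule LeastI_ex)
      have before: "c (i - int m - 1) \<noteq> c (i - int m)" if "m < n" for m
        using not_less_Least[of m "\<lambda>n. c (i - int n - 1) = c (i - int n)"] that
        by (auto simp: n_def)
      have ci: "c (i - int m) = c i + int m" if "m \<le> n" for m
        using that
      proof (induction m)
        case (Suc m)
        then show ?case using before[of m] step[of "i - int m - 1"] by (auto simp: algebra_simps)
      qed simp
      define k where "k = i - int n"
      have ck: "c k = c i + int n" using ci[of n] by (simp add: k_def)
      have "c (k + 1) = c k - 1"
      proof (cases n)
        case 0
        then show ?thesis using drop by (simp add: k_def)
      next
        case (Suc m)
        then have "k + 1 = i - int m" by (simp add: k_def)
        then show ?thesis using ci[of m] ck Suc by simp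
      qed
      then have "k \<in> K" using n by (simp add: K_def k_def)
      moreover have "g t \<le> 4 * (2 powr c k * min 1 (2 powr k / t))"
      proof -
        have "(2::real) powr c i \<le> 2 powr c k" by (simp add: ck)
        then have 1: "g t \<le> 4 * (2 powr c k)" using gt4 by linarith
        \<comment> \<open>Each descending step from k to i lowers \<open>c\<close> by one while the
          index grows by one.\<close>
        have e: "2 powr c k * 2 powr k = 2 powr c i * (2::real) powr i"
        proof -
          have "real_of_int (c k) + real_of_int k = real_of_int (c i) + real_of_int i"
            using ck by (simp add: k_def)
          then show ?thesis by (simp flip: powr_add)
        qed
        have "g t * t \<le> 2 * 2 powr c i * t"
          using gt \<open>t > 0\<close> by (intro mult_right_mono) auto
        also have "\<dots> \<le> 2 * 2 powr c i * (2 * 2 powr i)"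
          using i by (intro mult_left_mono) (simp_all add: powr_add)
        also have "\<dots> = 4 * (2 powr c i * 2 powr i)" by simp
        finally have "g t * t \<le> 4 * (2 powr c k * 2 powr k)"
          unfolding e .
        then have 2: "g t \<le> 4 * (2 powr c k * (2 powr k / t))"
          using \<open>t > 0\<close> by (simp add: field_simps)
        from 1 2 show ?thesis by (auto simp: min_def)
      qed
      ultimately show ?thesis by blast
    qed
  next
    fix t r :: real and A assume t: "t > 0" and r: "r > 0" and A: "finite A" "A \<subseteq> K"
    obtain i :: int where i: "2 powr i \<le> t" "t < 2 powr (real_of_int i + 1)"
      using dyadic[OF t] by blast
    define R where "R = (2::real) powr r"
    have R: "R > 1" using r powr_less_mono[of 0 r 2] by (simp add: R_def)
    have Rp: "R powr x = (2 powr x) powr r" for x by (simp add: R_def powr_powr mult.commute)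
    \<comment> \<open>Kinks to the right of i are bounded by their height 2^(c k), the others by
      2^(c k + k) / t. By injectivity each family sums to a geometric series controlled by its value
      at i.\<close>
    have "(\<Sum>k\<in>A. (2 powr c k * min 1 (2 powr k / t)) powr r)
      \<le> (\<Sum>k\<in>A. (if k > i then R powr c k else R powr (c k + k) / t powr r))"
    proof (rule sum_mono)
      fix k assume "k \<in> A"
      have "(2 powr c k * min 1 (2 powr k / t)) powr r \<le> (2 powr c k * 1) powr r"
        using r t by (intro powr_mono2 mult_left_mono) auto
      moreover have "(2 powr c k * min 1 (2 powr k / t)) powr r \<le> (2 powr c k * (2 powr k / t)) powr r"
        using r t by (intro powr_mono2 mult_left_mono) auto
      moreover have "(2 powr c k * (2 powr k / t)) powr r = R powr (c k + k) / t powr r"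
        using t unfolding Rp by (simp add: powr_divide flip: powr_add)
      ultimately show "(2 powr c k * min 1 (2 powr k / t)) powr r
        \<le> (if k > i then R powr c k else R powr (c k + k) / t powr r)"
        by (simp add: Rp)
    qed
    also have "\<dots> = (\<Sum>k\<in>A \<inter> {k. k > i}. R powr c k) + (\<Sum>k\<in>A \<inter> - {k. k > i}. R powr (c k + k) / t powr r)"
      using A by (subst sum.If_cases) auto
    also have "\<dots> \<le> R powr c i / (1 - 1 / R) + R powr c i / (1 - 1 / R)"
    proof (rule add_mono)
      show "(\<Sum>k\<in>A \<inter> {k. k > i}. R powr c k) \<le> R powr c i / (1 - 1 / R)"
        using A R c_anti by (intro sum_powr_inj_le inj_on_subset[OF inj_c]) auto
      have "(\<Sum>k\<in>A \<inter> - {k. k > i}. R powr (c k + k) / t powr r)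
         = (\<Sum>k\<in>A \<inter> - {k. k > i}. R powr (real_of_int (c k + k))) / t powr r"
        by (simp add: sum_divide_distrib)
      also have "\<dots> \<le> (R powr (real_of_int (c i + i)) / (1 - 1 / R)) / t powr r"
        using A R d_mono by (intro divide_right_mono sum_powr_inj_le inj_on_subset[OF inj_d]) auto
      also have "\<dots> = R powr c i * (2 powr i / t) powr r / (1 - 1 / R)"
        using t by (simp add: powr_add Rp powr_divide)
      also have "\<dots> \<le> R powr c i * 1 / (1 - 1 / R)"
        using R t i r by (intro divide_right_mono mult_left_mono powr_le1) auto
      finally show "(\<Sum>k\<in>A \<inter> - {k. k > i}. R powr (c k + k) / t powr r) \<le> R powr c i / (1 - 1 / R)"
        by simp
    qed
    also have "\<dots> = 2 / (1 - 1 / R) * R powr c i" by simp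
    also have "\<dots> \<le> 2 / (1 - 1 / R) * (R * g t powr r)"
    proof (rule mult_left_mono)
      have "2 powr c i \<le> 2 * 2 powr c (i + 1)"
        using step[of i] powr_add[of 2 "c i - 1" "1::real"] by auto
      also have "2 powr c (i + 1) \<le> g (2 powr (i + 1))"
        using c_le[of "i + 1"] by simp
      also have "\<dots> \<le> g t" using t i by (intro anti) auto
      finally have "2 powr c i \<le> 2 * g t" by simp
      then have "R powr c i \<le> (2 * g t) powr r"
        unfolding Rp using r by (intro powr_mono2) auto
      then show "R powr c i \<le> R * g t powr r"
        using pos[OF t] by (simp add: R_def powr_mult)
    qed (use R in simp)
    finally show "(\<Sum>k\<in>A. (2 powr c k * min 1 (2 powr k / t)) powr r)
        \<le> kink_const r * g t powr r"
      by (simp add: R_def kink_const_def mult.assoc)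
  qed
qed

text \<open>With S the sum, a = a^s a^(1-s) <= a^s S^(1-s) for each term; summing, S^(1-s) cancels
  because S is finite.\<close>

lemma suminf_epowr_le:
  fixes a :: "nat \<Rightarrow> ennreal"
  assumes s: "0 < s" "s \<le> 1" and fin: "(\<Sum>n. a n) < top"
  shows "(\<Sum>n. a n) epowr s \<le> (\<Sum>n. a n epowr s)"
proof (cases "(\<Sum>n. a n) = 0")
  case True
  then show ?thesis using s by (simp add: zero_epowr)
next
  case False
  define S where "S = (\<Sum>n. a n)"
  have le: "a n \<le> S" for n
    unfolding S_def using sum_le_suminf[of a "{n}"] by simp
  have split: "x = x epowr s * x epowr (1 - s)" for x :: ennreal
    using s epowr_add[of s "1 - s" x] by simp
  have "S = (\<Sum>n. a n epowr s * a n epowr (1 - s))"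
    using split unfolding S_def by simp
  also have "\<dots> \<le> (\<Sum>n. a n epowr s * S epowr (1 - s))"
    using s le by (intro suminf_le mult_left_mono epowr_mono) auto
  also have "\<dots> = (\<Sum>n. a n epowr s) * S epowr (1 - s)"
    by simp
  finally have "S epowr (1 - s) * S epowr s \<le> S epowr (1 - s) * (\<Sum>n. a n epowr s)"
    using split[of S] by (simp add: mult.commute)
  moreover have "S epowr (1 - s) \<noteq> 0" "S epowr (1 - s) \<noteq> top"
    using False fin s by (cases "s = 1"; simp add: S_def epowr_eq_0_iff epowr_eq_top_iff)+
  ultimately show ?thesis
    unfolding S_def by (subst (asm) ennreal_mult_le_mult_iff) auto
qed

text \<open>The integrand is at most 1, so the mean is at most 1; its integral over the whole
  half-line is y + y, so the mean is at most 2y/z.\<close>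

lemma avg_min_square_le:
  assumes "y > 0" "z > 0"
  shows "avg (\<lambda>t. (ennreal (min 1 (y / t)))\<^sup>2) z \<le> ennreal (2 * min 1 (y / z))"
proof -
  let ?I = "\<integral>\<^sup>+t\<in>{0<..<z}. (ennreal (min 1 (y / t)))\<^sup>2 \<partial>lborel"
  have 1: "ennreal (1 / z) * ?I \<le> 1"
  proof -
    have "?I \<le> (\<integral>\<^sup>+t. indicator {0<..<z} t \<partial>lborel)"
      using assms by (intro nn_integral_mono) (auto split: split_indicator simp: ennreal_power intro!: power_le_one)
    also have "\<dots> = ennreal z" using assms by simp
    finally have "ennreal (1 / z) * ?I \<le> ennreal (1 / z) * ennreal z"
      by (intro mult_left_mono) auto
    also have "\<dots> = 1" using assms by (simp flip: ennreal_mult)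
    finally show ?thesis .
  qed
  have "(\<integral>\<^sup>+t. ennreal (y\<^sup>2 / t\<^sup>2) * indicator {y..} t \<partial>lborel) = ennreal (0 - - y\<^sup>2 / y)"
  proof (rule nn_integral_FTC_atLeast[where F="\<lambda>t. - y\<^sup>2 / t" and T=0])
    show "DERIV (\<lambda>t. - y\<^sup>2 / t) x :> y\<^sup>2 / x\<^sup>2" if "y \<le> x" for x
      using that assms by (auto intro!: derivative_eq_intros simp: power2_eq_square)
    show "((\<lambda>t. - y\<^sup>2 / t) \<longlongrightarrow> 0) at_top"
      by (intro tendsto_divide_0[OF tendsto_const] filterlim_at_top_imp_at_infinity filterlim_ident)
  qed auto
  also have "0 - - y\<^sup>2 / y = y" using assms by (simp add: power2_eq_square)
  finally have FTC: "(\<integral>\<^sup>+t. ennreal (y\<^sup>2 / t\<^sup>2) * indicator {y..} t \<partial>lborel) = ennreal y" .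
  have "?I \<le> (\<integral>\<^sup>+t. indicator {0<..<y} t + ennreal (y\<^sup>2 / t\<^sup>2) * indicator {y..} t \<partial>lborel)"
  proof (rule nn_integral_mono)
    fix t
    have "(min 1 (y / t))\<^sup>2 \<le> y\<^sup>2 / t\<^sup>2" if "t > 0"
      using power_mono[of "min 1 (y / t)" "y / t" 2] assms that by (simp add: power_divide)
    moreover have "(min 1 (y / t))\<^sup>2 \<le> 1" if "t > 0"
      using assms that by (intro power_le_one) auto
    ultimately show "(ennreal (min 1 (y / t)))\<^sup>2 * indicator {0<..<z} t
      \<le> indicator {0<..<y} t + ennreal (y\<^sup>2 / t\<^sup>2) * indicator {y..} t"
      using assms by (auto split: split_indicator simp: ennreal_power)
  qed
  also have "\<dots> = ennreal y + ennreal y"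
    using assms by (subst nn_integral_add) (simp_all add: FTC)
  also have "\<dots> = ennreal (2 * y)" using assms by (simp flip: ennreal_plus)
  finally have "ennreal (1 / z) * ?I \<le> ennreal (1 / z) * ennreal (2 * y)"
    by (intro mult_left_mono) auto
  also have "\<dots> = ennreal (2 * (y / z))"
    using assms by (simp flip: ennreal_mult)
  finally have 2: "ennreal (1 / z) * ?I \<le> ennreal (2 * (y / z))" .
  show ?thesis
  proof (cases "1 \<le> y / z")
    case True
    then have "ennreal (2 * min 1 (y / z)) = 2" by simp
    then show ?thesis using 1 by (simp add: avg_def) (metis order_trans one_le_numeral)
  next
    case False
    then show ?thesis using 2 by (simp add: avg_def min_def)
  qed
qed

text \<open>Translates the weight conditions into integrals of powers of a single kink.\<close>

lemma nn_integral_min_powr: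
  assumes [measurable]: "u \<in> borel_measurable borel" and "y > 0" "r > 0"
  shows "(\<integral>\<^sup>+z\<in>{0<..}. ennreal (min 1 (y / z) powr r) * u z \<partial>lborel)
    = (head_int u y)
      + ennreal (y powr r) * (tail_int r u y)"
proof -
  have "(\<integral>\<^sup>+z\<in>{0<..}. ennreal (min 1 (y / z) powr r) * u z \<partial>lborel)
    = (\<integral>\<^sup>+z. u z * indicator {0<..<y} z + ennreal (y powr r) * (u z / ennreal (z powr r) * indicator {y<..} z) \<partial>lborel)"
  proof (rule nn_integral_cong_AE)
    have "AE z in lborel. z \<noteq> y" by (rule AE_lborel_singleton)
    then show "AE z in lborel. ennreal (min 1 (y / z) powr r) * u z * indicator {0<..} z
      = u z * indicator {0<..<y} z + ennreal (y powr r) * (u z / ennreal (z powr r) * indicator {y<..} z)"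
    proof eventually_elim
      case (elim z)
      have "ennreal (min 1 (y / z) powr r) = ennreal (y powr r) * inverse (ennreal (z powr r))" if "z > y"
      proof -
        have "min 1 (y / z) = y / z" using that assms by simp
        then have "min 1 (y / z) powr r = y powr r / z powr r"
          using that assms by (simp add: powr_divide)
        moreover have "z powr r > 0" using that assms by simp
        ultimately show ?thesis
          by (simp add: inverse_ennreal divide_inverse ennreal_mult)
      qed
      moreover have "min 1 (y / z) = 1" if "z < y" "z > 0"
        using that by (simp add: min_def)
      ultimately show ?case
        using elim assms by (auto split: split_indicator simp: divide_ennreal_def mult_ac)
    qed
  qed
  also have "\<dots> = (head_int u y)
      + ennreal (y powr r) * (tail_int r u y)"
    by (subst nn_integral_add) (simp_all add: nn_integral_cmult)
  finally show ?thesis .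
qed

text \<open>Used with s = q/2. At each point one kink dominates \<phi> up to a factor, so \<phi>^2
  is bounded by a sum of squared kinks; subadditivity of the power \<open>s\<close> moves it inside
  the sum of means. On each kink \<open>cond\<close> restores the exponent 2s, and the geometric
  upper bound reassembles \<phi>^(2s).\<close>

lemma avg_square_weight_le:
  assumes [measurable]: "u \<in> borel_measurable borel" "\<phi> \<in> borel_measurable borel"
    and s: "0 < s" "s < 1"
    and cond: "\<And>y. y > 0 \<Longrightarrow>
      ennreal (y powr s) * (tail_int s u y)
        \<le> \<beta> * ((head_int u y)
            + ennreal (y powr (2 * s)) * (tail_int (2 * s) u y))"
    and g: "\<And>t. t > 0 \<Longrightarrow> \<phi> t = ennreal (g t)"
    and pos: "\<And>t. t > 0 \<Longrightarrow> g t > 0"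
    and anti: "\<And>s t. 0 < s \<Longrightarrow> s \<le> t \<Longrightarrow> g t \<le> g s"
    and mono: "\<And>s t. 0 < s \<Longrightarrow> s \<le> t \<Longrightarrow> s * g s \<le> t * g t"
    and bdd: "\<And>t. t > 0 \<Longrightarrow> g t \<le> B"
    and lim: "(g \<longlongrightarrow> 0) at_top"
  shows "(\<integral>\<^sup>+t\<in>{0<..}. avg (\<lambda>t. (\<phi> t)\<^sup>2) t epowr s * u t \<partial>lborel)
    \<le> (ennreal (32 powr s * kink_const (2 * s)) * (1 + \<beta>)) * (\<integral>\<^sup>+t\<in>{0<..}. \<phi> t epowr (2 * s) * u t \<partial>lborel)"
proof -
  have "\<exists>(c :: int \<Rightarrow> int) (K :: int set).
    (\<forall>t>0. \<exists>k\<in>K. g t \<le> 4 * (2 powr c k * min 1 (2 powr k / t))) \<and>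
    (\<forall>t>0. \<forall>r>0. \<forall>A. finite A \<longrightarrow> A \<subseteq> K \<longrightarrow>
      (\<Sum>k\<in>A. (2 powr c k * min 1 (2 powr k / t)) powr r) \<le> kink_const r * g t powr r)"
    by (rule quasiconcave_decomposition[OF pos anti mono bdd lim])
  then obtain c :: "int \<Rightarrow> int" and K :: "int set" where
    low: "\<forall>t>0. \<exists>k\<in>K. g t \<le> 4 * (2 powr c k * min 1 (2 powr k / t))"
    and up: "\<forall>t>0. \<forall>r>0. \<forall>A. finite A \<longrightarrow> A \<subseteq> K \<longrightarrow>
      (\<Sum>k\<in>A. (2 powr c k * min 1 (2 powr k / t)) powr r) \<le> kink_const r * g t powr r"
    by (elim exE conjE)
  \<comment> \<open>Enumerating all integers and giving non-kinks the coefficient 0 turns sums over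
    \<open>K\<close> into series over the naturals.\<close>
  define b where "b n = (if int_decode n \<in> K then 2 powr c (int_decode n) else (0::real))" for n
  define y where "y n = (2::real) powr int_decode n" for n
  define m where "m n t = b n * min 1 (y n / t)" for n t
  have y: "y n > 0" for n by (simp add: y_def)
  have b: "b n \<ge> 0" for n by (simp add: b_def)
  have m: "m n t \<ge> 0" if "t > 0" for n t using that y[of n] b[of n] by (simp add: m_def)
  have [measurable]: "m n \<in> borel_measurable borel" for n unfolding m_def by measurable
  have low': "\<exists>n. g t \<le> 4 * m n t" if t: "t > 0" for t
  proof -
    obtain k where "k \<in> K" "g t \<le> 4 * (2 powr c k * min 1 (2 powr k / t))"
      using low[rule_format, OF t] by blast
    then show ?thesis by (intro exI[of _ "int_encode k"]) (simp add: m_def b_def y_def)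
  qed
  have up': "(\<Sum>n. ennreal (m n t powr r)) \<le> ennreal (kink_const r * g t powr r)" if t: "t > 0" and r: "r > 0" for t r
    unfolding suminf_eq_SUP
  proof (rule SUP_least)
    fix N
    let ?A = "{n. n < N \<and> int_decode n \<in> K}"
    have "(\<Sum>n<N. m n t powr r) = (\<Sum>n\<in>?A. (2 powr c (int_decode n) * min 1 (2 powr int_decode n / t)) powr r)"
      by (rule sum.mono_neutral_cong_right) (auto simp: m_def b_def y_def)
    also have "\<dots> = (\<Sum>k\<in>int_decode ` ?A. (2 powr c k * min 1 (2 powr k / t)) powr r)"
      by (subst sum.reindex) (auto intro: inj_on_subset[OF inj_int_decode])
    also have "\<dots> \<le> kink_const r * g t powr r"
      using t r by (intro up[rule_format]) auto
    finally show "(\<Sum>n<N. ennreal (m n t powr r)) \<le> ennreal (kink_const r * g t powr r)"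
      by (simp add: sum_ennreal ennreal_leI)
  qed
  have avg_m: "avg (\<lambda>t. (ennreal (m n t))\<^sup>2) z epowr s \<le> ennreal (2 powr s) * (ennreal (b n powr (2 * s)) * ennreal (min 1 (y n / z) powr s))"
    if z: "z > 0" for n z
  proof -
    have "avg (\<lambda>t. (ennreal (m n t))\<^sup>2) z = ennreal (1 / z) * (\<integral>\<^sup>+t. ennreal ((b n)\<^sup>2) * ((ennreal (min 1 (y n / t)))\<^sup>2 * indicator {0<..<z} t) \<partial>lborel)"
      unfolding avg_def m_def using b[of n] y[of n]
      by (intro arg_cong[where f="\<lambda>x. _ * x"] nn_integral_cong)
         (auto split: split_indicator simp: ennreal_power power_mult_distrib ennreal_mult)
    also have "\<dots> = ennreal ((b n)\<^sup>2) * avg (\<lambda>t. (ennreal (min 1 (y n / t)))\<^sup>2) z"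
      by (subst nn_integral_cmult) (simp_all add: avg_def mult_ac)
    also have "\<dots> \<le> ennreal ((b n)\<^sup>2) * ennreal (2 * min 1 (y n / z))"
      using y[of n] z by (intro mult_left_mono avg_min_square_le) auto
    also have "\<dots> = ennreal (2 * ((b n)\<^sup>2 * min 1 (y n / z)))"
      using y[of n] z by (simp add: mult_ac flip: ennreal_mult)
    finally have "avg (\<lambda>t. (ennreal (m n t))\<^sup>2) z epowr s \<le> ennreal (2 * ((b n)\<^sup>2 * min 1 (y n / z))) epowr s"
      using s by (intro epowr_mono) auto
    also have "\<dots> = ennreal ((2 * ((b n)\<^sup>2 * min 1 (y n / z))) powr s)"
      using s y[of n] z by (intro epowr_ennreal') auto
    also have "(2 * ((b n)\<^sup>2 * min 1 (y n / z))) powr s = 2 powr s * (b n powr (2 * s) * min 1 (y n / z) powr s)"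
    proof -
      have "((b n)\<^sup>2) powr s = b n powr (2 * s)"
        using b[of n] by (cases "b n = 0") (simp_all add: powr_powr flip: powr_numeral)
      then show ?thesis by (simp add: powr_mult)
    qed
    finally show ?thesis by (simp add: ennreal_mult)
  qed
  have pw: "avg (\<lambda>t. (\<phi> t)\<^sup>2) z epowr s
    \<le> ennreal (32 powr s) * (\<Sum>n. ennreal (b n powr (2 * s)) * ennreal (min 1 (y n / z) powr s))" if z: "z > 0" for z
  proof -
    let ?S = "\<Sum>n. avg (\<lambda>t. (ennreal (m n t))\<^sup>2) z"
    have S: "?S = ennreal (1 / z) * (\<integral>\<^sup>+t\<in>{0<..<z}. (\<Sum>n. (ennreal (m n t))\<^sup>2) \<partial>lborel)"
      unfolding avg_def by (simp add: nn_integral_suminf flip: ennreal_suminf_multc)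
    have "avg (\<lambda>t. (\<phi> t)\<^sup>2) z \<le> ennreal (1 / z) * (\<integral>\<^sup>+t. 16 * ((\<Sum>n. (ennreal (m n t))\<^sup>2) * indicator {0<..<z} t) \<partial>lborel)"
      unfolding avg_def
    proof (intro mult_left_mono nn_integral_mono)
      fix t
      have "(\<phi> t)\<^sup>2 \<le> 16 * (\<Sum>n. (ennreal (m n t))\<^sup>2)" if t: "t > 0"
      proof -
        obtain n where n: "g t \<le> 4 * m n t" using low'[OF t] by blast
        have "(\<phi> t)\<^sup>2 \<le> (4 * ennreal (m n t))\<^sup>2"
          using ennreal_leI[OF n] t m[OF t, of n] by (intro power_mono) (auto simp: g ennreal_mult)
        also have "\<dots> = 16 * (ennreal (m n t))\<^sup>2" by (simp add: power_mult_distrib)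
        also have "\<dots> \<le> 16 * (\<Sum>n. (ennreal (m n t))\<^sup>2)"
          using sum_le_suminf[of "\<lambda>n. (ennreal (m n t))\<^sup>2" "{n}"] by (intro mult_left_mono) auto
        finally show ?thesis .
      qed
      then show "(\<phi> t)\<^sup>2 * indicator {0<..<z} t \<le> 16 * ((\<Sum>n. (ennreal (m n t))\<^sup>2) * indicator {0<..<z} t)"
        by (auto split: split_indicator)
    qed auto
    also have "\<dots> = 16 * ?S"
      unfolding S by (subst nn_integral_cmult) (simp_all add: mult_ac)
    finally have le: "avg (\<lambda>t. (\<phi> t)\<^sup>2) z \<le> 16 * ?S" .
    \<comment> \<open>Finiteness for the subadditivity step, from the geometric bound with exponent
      2 and the boundedness of g.\<close>
    have "?S \<le> ennreal (1 / z) * (\<integral>\<^sup>+t. ennreal (kink_const 2 * B powr 2) * indicator {0<..<z} t \<partial>lborel)"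
      unfolding S
    proof (intro mult_left_mono nn_integral_mono)
      fix t
      have "(\<Sum>n. (ennreal (m n t))\<^sup>2) \<le> ennreal (kink_const 2 * B powr 2)" if t: "t > 0"
      proof -
        have "(\<Sum>n. (ennreal (m n t))\<^sup>2) = (\<Sum>n. ennreal (m n t powr 2))"
          using m[OF t] by (simp add: ennreal_power)
        also have "\<dots> \<le> ennreal (kink_const 2 * g t powr 2)"
          using t by (intro up') auto
        also have "\<dots> \<le> ennreal (kink_const 2 * B powr 2)"
          using pos[OF t] bdd[OF t] kink_const_nonneg[of 2]
          by (intro ennreal_leI mult_left_mono powr_mono2) auto
        finally show ?thesis .
      qed
      then show "(\<Sum>n. (ennreal (m n t))\<^sup>2) * indicator {0<..<z} t \<le> ennreal (kink_const 2 * B powr 2) * indicator {0<..<z} t"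
        by (auto split: split_indicator)
    qed auto
    also have "\<dots> < top"
      using z by (subst nn_integral_cmult) (simp_all add: ennreal_mult_less_top)
    finally have fin: "?S < top" .
    have "avg (\<lambda>t. (\<phi> t)\<^sup>2) z epowr s \<le> (16 * ?S) epowr s"
      using s le by (intro epowr_mono) auto
    also have "\<dots> = 16 epowr s * ?S epowr s"
      using s by (intro epowr_mult) auto
    also have "\<dots> \<le> 16 epowr s * (\<Sum>n. avg (\<lambda>t. (ennreal (m n t))\<^sup>2) z epowr s)"
      using s fin by (intro mult_left_mono suminf_epowr_le) auto
    also have "\<dots> \<le> 16 epowr s * (\<Sum>n. ennreal (2 powr s) * (ennreal (b n powr (2 * s)) * ennreal (min 1 (y n / z) powr s)))"
      using z by (intro mult_left_mono suminf_le avg_m) auto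
    also have "\<dots> = (16 epowr s * ennreal (2 powr s)) * (\<Sum>n. ennreal (b n powr (2 * s)) * ennreal (min 1 (y n / z) powr s))"
      by (simp only: ennreal_suminf_cmult mult.assoc)
    \<comment> \<open>16 is the square of the factor 4 in the kink decomposition, 2 the constant for
      the mean of one kink.\<close>
    also have "16 epowr s * ennreal (2 powr s) = ennreal (32 powr s)"
    proof -
      have "16 epowr s = ennreal (16 powr s)"
        using epowr_ennreal[of 16 s] by simp
      then show ?thesis by (simp flip: ennreal_mult powr_mult)
    qed
    finally show ?thesis .
  qed
  have weight: "(\<integral>\<^sup>+z\<in>{0<..}. ennreal (min 1 (y n / z) powr s) * u z \<partial>lborel)
      \<le> (1 + \<beta>) * (\<integral>\<^sup>+z\<in>{0<..}. ennreal (min 1 (y n / z) powr (2 * s)) * u z \<partial>lborel)" for n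
  proof -
    let ?a = "\<integral>\<^sup>+x\<in>{0<..<y n}. u x \<partial>lborel"
    let ?R = "?a + ennreal (y n powr (2 * s)) * (tail_int (2 * s) u (y n))"
    \<comment> \<open>The head is part of ?R, and \<open>cond\<close> bounds the tail term by
      \<beta> times ?R; hence the factor 1 + \<beta>.\<close>
    have "?a + ennreal (y n powr s) * (tail_int s u (y n)) \<le> ?R + \<beta> * ?R"
      using cond[OF y[of n]] by (intro add_mono) auto
    also have "\<dots> = (1 + \<beta>) * ?R" by (simp add: distrib_right)
    finally show ?thesis
      using y[of n] s by (simp only: nn_integral_min_powr[OF assms(1)] mult_pos_pos zero_less_numeral)
  qed
  have "(\<Sum>n. ennreal (b n powr (2 * s)) * (\<integral>\<^sup>+z\<in>{0<..}. ennreal (min 1 (y n / z) powr (2 * s)) * u z \<partial>lborel))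
    = (\<integral>\<^sup>+z. (\<Sum>n. ennreal (b n powr (2 * s)) * (ennreal (min 1 (y n / z) powr (2 * s)) * u z * indicator {0<..} z)) \<partial>lborel)"
    by (simp add: nn_integral_cmult nn_integral_suminf)
  also have "\<dots> \<le> (\<integral>\<^sup>+z. ennreal (kink_const (2 * s)) * (\<phi> z epowr (2 * s) * u z * indicator {0<..} z) \<partial>lborel)"
  proof (rule nn_integral_mono)
    fix z
    have "(\<Sum>n. ennreal (b n powr (2 * s)) * (ennreal (min 1 (y n / z) powr (2 * s)) * u z))
      \<le> ennreal (kink_const (2 * s)) * (\<phi> z epowr (2 * s) * u z)" if z: "z > 0"
    proof -
      have "(\<Sum>n. ennreal (b n powr (2 * s)) * (ennreal (min 1 (y n / z) powr (2 * s)) * u z))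
        = (\<Sum>n. ennreal (m n z powr (2 * s))) * u z"
        unfolding m_def by (simp add: powr_mult ennreal_mult flip: mult.assoc)
      also have "\<dots> \<le> ennreal (kink_const (2 * s) * g z powr (2 * s)) * u z"
        using z s by (intro mult_right_mono up') auto
      also have "\<dots> = ennreal (kink_const (2 * s)) * (\<phi> z epowr (2 * s) * u z)"
        using z s pos[OF z] kink_const_nonneg[of "2 * s"] by (simp add: g epowr_ennreal ennreal_mult mult_ac)
      finally show ?thesis .
    qed
    then show "(\<Sum>n. ennreal (b n powr (2 * s)) * (ennreal (min 1 (y n / z) powr (2 * s)) * u z * indicator {0<..} z))
      \<le> ennreal (kink_const (2 * s)) * (\<phi> z epowr (2 * s) * u z * indicator {0<..} z)"
      by (auto split: split_indicator)
  qed
  also have "\<dots> = ennreal (kink_const (2 * s)) * (\<integral>\<^sup>+t\<in>{0<..}. \<phi> t epowr (2 * s) * u t \<partial>lborel)"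
    by (rule nn_integral_cmult) measurable
  finally have kinks: "(\<Sum>n. ennreal (b n powr (2 * s)) * (\<integral>\<^sup>+z\<in>{0<..}. ennreal (min 1 (y n / z) powr (2 * s)) * u z \<partial>lborel))
    \<le> ennreal (kink_const (2 * s)) * (\<integral>\<^sup>+t\<in>{0<..}. \<phi> t epowr (2 * s) * u t \<partial>lborel)" .
  have "(\<integral>\<^sup>+t\<in>{0<..}. avg (\<lambda>t. (\<phi> t)\<^sup>2) t epowr s * u t \<partial>lborel)
    \<le> (\<integral>\<^sup>+z. ennreal (32 powr s) * (\<Sum>n. ennreal (b n powr (2 * s)) * (ennreal (min 1 (y n / z) powr s) * u z * indicator {0<..} z)) \<partial>lborel)"
  proof (rule nn_integral_mono)
    fix z
    have "avg (\<lambda>t. (\<phi> t)\<^sup>2) z epowr s * u z \<le> ennreal (32 powr s) * (\<Sum>n. ennreal (b n powr (2 * s)) * ennreal (min 1 (y n / z) powr s)) * u z" if "z > 0"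
      using pw[OF that] by (rule mult_right_mono) simp
    then show "avg (\<lambda>t. (\<phi> t)\<^sup>2) z epowr s * u z * indicator {0<..} z
      \<le> ennreal (32 powr s) * (\<Sum>n. ennreal (b n powr (2 * s)) * (ennreal (min 1 (y n / z) powr s) * u z * indicator {0<..} z))"
      by (auto split: split_indicator simp flip: mult.assoc)
  qed
  also have "\<dots> = ennreal (32 powr s) * (\<Sum>n. ennreal (b n powr (2 * s)) * (\<integral>\<^sup>+z\<in>{0<..}. ennreal (min 1 (y n / z) powr s) * u z \<partial>lborel))"
    by (simp add: nn_integral_cmult nn_integral_suminf)
  also have "\<dots> \<le> ennreal (32 powr s) * (\<Sum>n. ennreal (b n powr (2 * s)) * ((1 + \<beta>) * (\<integral>\<^sup>+z\<in>{0<..}. ennreal (min 1 (y n / z) powr (2 * s)) * u z \<partial>lborel)))"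
    by (intro mult_left_mono suminf_le weight) auto
  also have "\<dots> = ennreal (32 powr s) * (\<Sum>n. (1 + \<beta>) * (ennreal (b n powr (2 * s)) * (\<integral>\<^sup>+z\<in>{0<..}. ennreal (min 1 (y n / z) powr (2 * s)) * u z \<partial>lborel)))"
    by (simp only: mult.left_commute)
  also have "\<dots> = ennreal (32 powr s) * (1 + \<beta>) * (\<Sum>n. ennreal (b n powr (2 * s)) * (\<integral>\<^sup>+z\<in>{0<..}. ennreal (min 1 (y n / z) powr (2 * s)) * u z \<partial>lborel))"
    by (simp only: ennreal_suminf_cmult mult.assoc)
  also have "\<dots> \<le> ennreal (32 powr s) * (1 + \<beta>) * (ennreal (kink_const (2 * s)) * (\<integral>\<^sup>+t\<in>{0<..}. \<phi> t epowr (2 * s) * u t \<partial>lborel))"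
    by (intro mult_left_mono kinks) auto
  finally show ?thesis
    using kink_const_nonneg[of "2 * s"] s by (simp add: ennreal_mult mult_ac)
qed

section \<open>The Fourier inequality\<close>

text \<open>The case q = 2 is the splitting estimate itself, q > 2 uses absorption on level sets,
  and only q < 2 passes through the mean and the weight condition.\<close>

lemma fourier_epowr_le:
  fixes f :: "real ^ 'n \<Rightarrow> complex"
  assumes [measurable]: "U \<in> borel_measurable lebesgue" "u \<in> borel_measurable borel"
    and u: "\<And>t \<alpha>. 0 < t \<Longrightarrow> 0 < \<alpha> \<Longrightarrow> ennreal t < emeasure lebesgue {x. U x > ennreal \<alpha>} \<Longrightarrow> ennreal \<alpha> \<le> u t"
    and q: "q > 0"
    and cond: "q \<ge> 2 \<or> (\<forall>y>0. ennreal (y powr (q / 2)) * (tail_int (q / 2) u y)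
              \<le> \<beta> * ((head_int u y)
                  + ennreal (y powr q) * (tail_int q u y)))"
    and f: "integrable lebesgue f"
  defines "\<rho> \<equiv> rearrangement lebesgue (\<lambda>x. ennreal (cmod (f x)))"
  shows "(power_int q U (fourier f))
    \<le> (if q = 2 then 6 else if q > 2 then 12 * 4 epowr (q - 2)
        else 7 * (ennreal (32 powr (q / 2) * kink_const q) * (1 + \<beta>)))
      * (half_int q u (hardy \<rho>))"
proof -
  let ?M = "lebesgue :: (real ^ 'n) measure"
  let ?k = "\<lambda>x. ennreal (cmod (f x))"
  let ?h = "\<lambda>x. ennreal (cmod (fourier f x))"
  interpret M: sigma_finite_measure ?M by (rule sigma_finite_lebesgue)
  have [measurable]: "f \<in> borel_measurable ?M" using f by auto
  have \<rho>: "antimono \<rho>" unfolding \<rho>_def by (rule antimono_rearrangement)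
  then have [measurable]: "\<rho> \<in> borel_measurable borel" by (rule borel_measurable_antimono)
  have less_\<rho>: "ennreal \<alpha> < \<rho> t \<longleftrightarrow> ennreal t < emeasure ?M {x. ?k x > ennreal \<alpha>}"
    if "t \<ge> 0" "\<alpha> \<ge> 0" for t \<alpha>
  proof -
    have "?k \<in> borel_measurable ?M" by measurable
    from less_rearrangement_iff[OF this that] show ?thesis by (simp add: \<rho>_def)
  qed
  have key: "(\<integral>\<^sup>+x\<in>E. (?h x)\<^sup>2 \<partial>?M) \<le> 6 * (\<integral>\<^sup>+t\<in>{0<..<z}. (hardy \<rho> t)\<^sup>2 \<partial>lborel)"
    if "E \<in> sets ?M" "z > 0" "emeasure ?M E \<le> ennreal z" for E z
    unfolding \<rho>_def using fourier_square_le[OF f that(2,1,3)] .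
  obtain B where B: "B \<ge> 0" "(\<integral>\<^sup>+x. ?k x \<partial>?M) = ennreal B"
    using f by (cases "\<integral>\<^sup>+x. ?k x \<partial>?M") (auto simp: integrable_iff_bounded)
  have bdd: "?h x \<le> ennreal B" for x
    using norm_fourier_le[OF f] B by simp
  consider "q = 2" | "q > 2" | "q < 2" by linarith
  then show ?thesis
  proof cases
    case 1
    have "(\<integral>\<^sup>+x. ?h x epowr q * U x \<partial>?M) \<le> 6 * (half_int q u (hardy \<rho>))"
    proof (rule M.nn_integral_mult_le_rearranged)
      fix E assume E: "E \<in> sets ?M" "emeasure ?M E < \<infinity>"
      then obtain z where z: "emeasure ?M E = ennreal z" "z \<ge> 0"
        by (cases "emeasure ?M E") auto
      show "(\<integral>\<^sup>+x\<in>E. ?h x epowr q \<partial>?M) \<le> 6 * (\<integral>\<^sup>+t\<in>initial (emeasure ?M E). hardy \<rho> t epowr q \<partial>lborel)"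
      proof (cases "z = 0")
        case True
        then have "E \<in> null_sets ?M" using z E by auto
        then have "(\<integral>\<^sup>+x\<in>E. ?h x epowr q \<partial>?M) = 0" by (rule nn_integral_null_set)
        then show ?thesis by simp
      next
        case False
        then have "initial (emeasure ?M E) = {0<..<z}" using z by (auto simp: ennreal_less_iff)
        then show ?thesis using key[of E z] E z False by (simp add: 1 epowr_2)
      qed
    qed (use u in simp_all)
    then show ?thesis using 1 by simp
  next
    case 2
    have "(\<integral>\<^sup>+x. ?h x epowr q * U x \<partial>?M) \<le> (12 * 4 epowr (q - 2)) * (half_int q u (hardy \<rho>))"
    proof (rule M.nn_integral_mult_le_rearranged)
      fix E assume E: "E \<in> sets ?M" "emeasure ?M E < \<infinity>"
      show "(\<integral>\<^sup>+x\<in>E. ?h x epowr q \<partial>?M)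
          \<le> (12 * 4 epowr (q - 2)) * (\<integral>\<^sup>+t\<in>initial (emeasure ?M E). hardy \<rho> t epowr q \<partial>lborel)"
        by (rule nn_integral_epowr_large_le[OF sigma_finite_lebesgue _ _ bdd _ key]) (use 2 E in simp_all)
    qed (use u in simp_all)
    then show ?thesis using 2 by simp
  next
    case 3
    let ?\<psi> = "avg (\<lambda>t. (hardy \<rho> t)\<^sup>2)"
    have \<psi>: "?\<psi> \<in> borel_measurable borel" by (rule avg_measurable) measurable
    have weak: "(\<integral>\<^sup>+x. ?h x epowr q * U x \<partial>?M) \<le> 7 * (\<integral>\<^sup>+t\<in>{0<..}. ?\<psi> t epowr (q / 2) * u t \<partial>lborel)"
    proof (rule M.nn_integral_mult_le_rearranged)
      fix E assume E: "E \<in> sets ?M" "emeasure ?M E < \<infinity>"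
      show "(\<integral>\<^sup>+x\<in>E. ?h x epowr q \<partial>?M)
          \<le> 7 * (\<integral>\<^sup>+t\<in>initial (emeasure ?M E). ?\<psi> t epowr (q / 2) \<partial>lborel)"
      proof (rule nn_integral_epowr_small_le)
        show "hardy \<rho> t \<le> hardy \<rho> s" if "0 < s" "s \<le> t" for s t
          using that by (rule hardy_antimono)
        show "(\<integral>\<^sup>+x\<in>E. (?h x)\<^sup>2 \<partial>?M) \<le> 6 * (\<integral>\<^sup>+t\<in>{0<..<z}. (hardy \<rho> t)\<^sup>2 \<partial>lborel)"
          if "E \<in> sets ?M" "z > 0" "emeasure ?M E \<le> ennreal z" for E z
          using that by (rule key)
      qed (use 3 q E in simp_all)
    next
      show "(\<lambda>t. ?\<psi> t epowr (q / 2)) \<in> borel_measurable borel"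
        using \<psi> by (rule epowr_measurable)
    qed (use u in simp_all)
    \<comment> \<open>The L^1 norm bounds \<open>hardy \<rho>\<close> uniformly. This supplies real
      values, the boundedness asked for by the kink decomposition, and the dominating function for
      its limit at infinity.\<close>
    have hardy_le: "hardy \<rho> t \<le> ennreal B" for t
    proof -
      have "(\<integral>\<^sup>+x. \<rho> x * indicator {0<..<1 / t} x \<partial>lborel) \<le> (\<integral>\<^sup>+x. ?k x \<partial>?M)"
      proof (rule nn_integral_le_of_distribution)
        fix \<alpha> :: real assume "\<alpha> > 0"
        have "emeasure lborel {x\<in>space lborel. \<rho> x * indicator {0<..<1 / t} x > ennreal \<alpha>}
          \<le> emeasure lborel (initial (emeasure ?M {x. ?k x > ennreal \<alpha>}))"
        proof (intro emeasure_mono subsetI)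
          fix x assume "x \<in> {x\<in>space lborel. \<rho> x * indicator {0<..<1 / t} x > ennreal \<alpha>}"
          then have "0 < x" "ennreal \<alpha> < \<rho> x"
            by (auto split: split_indicator_asm)
          then show "x \<in> initial (emeasure ?M {x. ?k x > ennreal \<alpha>})"
            using \<open>\<alpha> > 0\<close> less_\<rho>[of x \<alpha>] by (metis (mono_tags, lifting) less_imp_le mem_Collect_eq)
        qed simp
        then show "emeasure lborel {x\<in>space lborel. \<rho> x * indicator {0<..<1 / t} x > ennreal \<alpha>}
          \<le> emeasure ?M {x\<in>space ?M. ?k x > ennreal \<alpha>}"
          by (simp add: emeasure_Collect_less_ennreal)
      qed (simp_all add: M.sigma_finite_measure_axioms lborel.sigma_finite_measure_axioms)
      then show ?thesis using B by (simp add: hardy_def)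
    qed
    show ?thesis
    \<comment> \<open>The kink decomposition needs a positive function. The excluded case is f = 0
      almost everywhere, where the transform vanishes identically.\<close>
    proof (cases "emeasure ?M {x. ?k x > 0} = 0")
      case True
      have "{x\<in>space ?M. ?k x > 0} \<in> sets ?M" by measurable
      then have "{x. ?k x > 0} \<in> sets ?M" by simp
      then have "AE x in ?M. ?k x = 0"
        by (intro AE_I[OF _ True]) auto
      then have "(\<integral>\<^sup>+x. ?k x \<partial>?M) = 0" by (subst nn_integral_0_iff_AE) auto
      then have "?h x = 0" for x using norm_fourier_le[OF f, of x] by simp
      then have "(\<integral>\<^sup>+x. ?h x epowr q * U x \<partial>?M) = (\<integral>\<^sup>+x. 0 \<partial>?M)"
        using q by (intro nn_integral_cong) (simp add: zero_epowr)
      then show ?thesis by simp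
    next
      case False
      define g where "g t = enn2real (hardy \<rho> t)" for t
      have g: "hardy \<rho> t = ennreal (g t)" for t
        using hardy_le[of t] by (simp add: g_def less_top order_le_less_trans)
      have g0: "g t \<ge> 0" for t by (simp add: g_def)
      have pos: "g t > 0" if t: "t > 0" for t
      proof (rule ccontr)
        \<comment> \<open>Then \<rho> vanishes on (0, 1/t], so the support of \<open>f\<close> has
          measure below every positive number.\<close>
        assume "\<not> g t > 0"
        then have 0: "hardy \<rho> t = 0" using g0[of t] g[of t] by simp
        have le: "emeasure ?M {x. ?k x > 0} \<le> ennreal x" if "0 < x" "x \<le> 1 / t" for x
        proof -
          have "ennreal x * \<rho> x = 0"
            using le_hardy[OF \<rho> t that] 0 by simp
          then have "\<rho> x = 0" using that by simp
          then show ?thesis using less_\<rho>[of x 0] that by simp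
        qed
        have "emeasure ?M {x. ?k x > 0} \<le> 0 + ennreal e" if "e > 0" for e
        proof -
          have "emeasure ?M {x. ?k x > 0} \<le> ennreal (min e (1 / t))"
            using that t by (intro le) auto
          also have "\<dots> \<le> ennreal e" by (intro ennreal_leI) auto
          finally show ?thesis by simp
        qed
        then have "emeasure ?M {x. ?k x > 0} \<le> 0"
          by (rule ennreal_le_epsilon)
        then show False using False by simp
      qed
      have anti: "g t \<le> g s" if "0 < s" "s \<le> t" for s t
        using hardy_antimono[OF that, of \<rho>] g0 by (simp add: g)
      \<comment> \<open>t times \<open>hardy \<rho> t\<close> is the mean of the non-increasing
        \<open>\<rho>\<close> over (0, 1/t), an interval that shrinks as t grows.\<close>
      have mono: "s * g s \<le> t * g t" if "0 < s" "s \<le> t" for s t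
      proof -
        have "avg \<rho> (1 / s) \<le> avg \<rho> (1 / t)"
          using that antimonoD[OF \<rho>] by (intro avg_antimono) (auto simp: frac_le)
        then have "ennreal s * hardy \<rho> s \<le> ennreal t * hardy \<rho> t"
          by (simp add: avg_def hardy_def)
        then show ?thesis using that g0 by (simp add: g flip: ennreal_mult)
      qed
      have bddg: "g t \<le> B" if "t > 0" for t
        using hardy_le[of t] g0 B by (simp add: g)
      have seq: "(\<lambda>n. hardy \<rho> (real (Suc n))) \<longlonglongrightarrow> 0"
      proof -
        have "(\<lambda>n. \<integral>\<^sup>+x. \<rho> x * indicator {0<..<1 / real (Suc n)} x \<partial>lborel) \<longlonglongrightarrow> (\<integral>\<^sup>+x. 0 \<partial>(lborel :: real measure))"
        proof (rule nn_integral_dominated_convergence[where w="\<lambda>x. \<rho> x * indicator {0<..<1 / 1} x"])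
          show "(\<integral>\<^sup>+x. \<rho> x * indicator {0<..<1 / 1} x \<partial>lborel) < \<infinity>"
            using hardy_le[of 1] by (auto simp: hardy_def less_top[symmetric] top_unique)
          show "AE x in lborel. (\<lambda>n. \<rho> x * indicator {0<..<1 / real (Suc n)} x) \<longlonglongrightarrow> 0"
          proof (intro AE_I2)
            fix x :: real
            show "(\<lambda>n. \<rho> x * indicator {0<..<1 / real (Suc n)} x) \<longlonglongrightarrow> 0"
            proof (cases "x > 0")
              case True
              have "eventually (\<lambda>n. 1 / real (Suc n) < x) sequentially"
                using order_tendstoD(2)[OF LIMSEQ_Suc[OF lim_1_over_n] True] .
              then have "eventually (\<lambda>n. \<rho> x * indicator {0<..<1 / real (Suc n)} x = 0) sequentially"
                by eventually_elim simp
              then show ?thesis by (rule tendsto_eventually)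
            qed simp
          qed
          show "AE x in lborel. \<rho> x * indicator {0<..<1 / real (Suc n)} x \<le> \<rho> x * indicator {0<..<1 / 1} x" for n
          proof (intro AE_I2 mult_left_mono)
            fix x :: real
            have "1 / real (Suc n) \<le> 1 / 1" by simp
            then show "indicator {0<..<1 / real (Suc n)} x \<le> (indicator {0<..<1 / 1} x :: ennreal)"
              by (auto split: split_indicator simp del: of_nat_Suc intro: order_less_le_trans)
          qed simp
        qed simp_all
        then show ?thesis by (simp add: hardy_def)
      qed
      have lim: "(g \<longlongrightarrow> 0) at_top"
      proof (rule order_tendstoI)
        fix a :: real assume "a < 0"
        then show "eventually (\<lambda>t. a < g t) at_top"
          using g0 by (intro always_eventually allI) (meson less_le_trans)
      next
        fix a :: real assume a: "0 < a"
        then have "0 < ennreal a" by simp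
        then have "eventually (\<lambda>n. hardy \<rho> (real (Suc n)) < ennreal a) sequentially"
          by (rule order_tendstoD(2)[OF seq])
        then obtain n where "hardy \<rho> (real (Suc n)) < ennreal a"
          by (auto simp: eventually_sequentially)
        then have n: "g (real (Suc n)) < a" using g0 by (simp add: g ennreal_less_iff)
        show "eventually (\<lambda>t. g t < a) at_top"
          using eventually_ge_at_top[of "real (Suc n)"]
        proof eventually_elim
          case (elim t)
          then have "g t \<le> g (real (Suc n))" by (intro anti) auto
          then show ?case using n by simp
        qed
      qed
      have "(\<integral>\<^sup>+t\<in>{0<..}. ?\<psi> t epowr (q / 2) * u t \<partial>lborel)
        \<le> (ennreal (32 powr (q / 2) * kink_const (2 * (q / 2))) * (1 + \<beta>)) * (\<integral>\<^sup>+t\<in>{0<..}. hardy \<rho> t epowr (2 * (q / 2)) * u t \<partial>lborel)"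
        by (rule avg_square_weight_le[OF _ _ _ _ _ g pos anti mono bddg lim]) (use cond 3 q in auto)
      then have "7 * (\<integral>\<^sup>+t\<in>{0<..}. ?\<psi> t epowr (q / 2) * u t \<partial>lborel)
        \<le> 7 * ((ennreal (32 powr (q / 2) * kink_const q) * (1 + \<beta>)) * (half_int q u (hardy \<rho>)))"
        by (intro mult_left_mono) auto
      with weak show ?thesis using 3 by (simp add: mult.assoc)
    qed
  qed
qed

lemma rearrangement_weight_le:
  fixes f :: "real ^ 'n \<Rightarrow> complex"
  assumes [measurable]: "W \<in> borel_measurable lebesgue" "w \<in> borel_measurable borel"
    and w: "\<And>t \<alpha>. 0 < t \<Longrightarrow> 0 < \<alpha> \<Longrightarrow> ennreal t < emeasure lebesgue {x. W x \<le> ennreal \<alpha>} \<Longrightarrow> w t \<le> ennreal \<alpha>"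
    and p: "p > 0" and f: "integrable lebesgue f"
  defines "\<rho> \<equiv> rearrangement lebesgue (\<lambda>x. ennreal (cmod (f x)))"
  shows "(half_int p w \<rho>) \<le> (power_int p W f)"
proof -
  let ?M = "lebesgue :: (real ^ 'n) measure"
  let ?k = "\<lambda>x. ennreal (cmod (f x))"
  interpret M: sigma_finite_measure ?M by (rule sigma_finite_lebesgue)
  have [measurable]: "f \<in> borel_measurable ?M" using f by auto
  have fin: "(\<integral>\<^sup>+x. ?k x \<partial>?M) < \<infinity>" using f by (simp add: integrable_iff_bounded)
  have [measurable]: "\<rho> \<in> borel_measurable borel" unfolding \<rho>_def by measurable
  have level: "ennreal \<alpha> < x epowr p \<longleftrightarrow> ennreal (\<alpha> powr (1 / p)) < x" if "\<alpha> > 0" for \<alpha> x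
    using that p by (simp add: less_epowr_iff epowr_ennreal)
  show ?thesis
  proof (rule M.nn_integral_rearranged_mult_le)
    fix t \<alpha> :: real assume "0 < t" "0 < \<alpha>" "ennreal \<alpha> < \<rho> t epowr p"
    moreover have "?k \<in> borel_measurable ?M" by measurable
    note k_less = less_rearrangement_iff[OF this, of t "\<alpha> powr (1 / p)"]
    have "t \<ge> 0 \<Longrightarrow> ennreal (\<alpha> powr (1 / p)) < \<rho> t \<longleftrightarrow> ennreal t < emeasure ?M {x\<in>space ?M. ?k x > ennreal (\<alpha> powr (1 / p))}"
      unfolding \<rho>_def by (rule k_less) simp_all
    ultimately show "ennreal t < emeasure ?M {x\<in>space ?M. ?k x epowr p > ennreal \<alpha>}"
      by (simp only: level less_imp_le)
  next
    fix \<alpha> :: real assume "0 < \<alpha>"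
    then show "emeasure ?M {x\<in>space ?M. ?k x epowr p > ennreal \<alpha>} < \<infinity>"
      unfolding level[OF \<open>0 < \<alpha>\<close>] using fin by (intro distribution_finite) simp_all
  qed (use w in simp_all)
qed

text \<open>The inequality for \<open>hardy\<close> is applied to the rearrangement of |f|. Stating
  it with level-set implications for \<open>u\<close> and \<open>w\<close> lets dual weights be
  substituted later.\<close>

lemma fourier_weighted_of_hardy:
  fixes U W :: "real ^ 'n \<Rightarrow> ennreal" and u w :: "real \<Rightarrow> ennreal" and p q :: real
  assumes [measurable]: "U \<in> borel_measurable lebesgue" "W \<in> borel_measurable lebesgue"
      "u \<in> borel_measurable borel" "w \<in> borel_measurable borel"
    and u: "\<And>t \<alpha>. 0 < t \<Longrightarrow> 0 < \<alpha> \<Longrightarrow> ennreal t < emeasure lebesgue {x. U x > ennreal \<alpha>} \<Longrightarrow> ennreal \<alpha> \<le> u t"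
    and w: "\<And>t \<alpha>. 0 < t \<Longrightarrow> 0 < \<alpha> \<Longrightarrow> ennreal t < emeasure lebesgue {x. W x \<le> ennreal \<alpha>} \<Longrightarrow> w t \<le> ennreal \<alpha>"
    and pq: "p > 0" "q > 0" and C: "C < \<infinity>"
    and hardy: "\<And>f. f \<in> borel_measurable borel \<Longrightarrow>
      (half_int q u (hardy f)) epowr (1 / q)
        \<le> C * (half_int p w f) epowr (1 / p)"
    and cond: "q \<ge> 2 \<or> (\<exists>\<beta><\<infinity>. \<forall>y>0. ennreal (y powr (q / 2)) * (tail_int (q / 2) u y)
              \<le> \<beta> * ((head_int u y)
                  + ennreal (y powr q) * (tail_int q u y)))"
  shows "\<exists>C<\<infinity>. \<forall>f :: real ^ 'n \<Rightarrow> complex. integrable lebesgue f \<longrightarrow>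
      (power_int q U (fourier f)) epowr (1 / q)
        \<le> C * (power_int p W f) epowr (1 / p)"
proof -
  define P where "P \<beta> \<longleftrightarrow> (\<forall>y>0. ennreal (y powr (q / 2)) * (tail_int (q / 2) u y)
              \<le> \<beta> * ((head_int u y)
                  + ennreal (y powr q) * (tail_int q u y)))" for \<beta>
  have "\<exists>\<beta><\<infinity>. q \<ge> 2 \<or> P \<beta>"
    using cond unfolding P_def[symmetric] by (auto intro: exI[of _ 0])
  then obtain \<beta> where \<beta>: "\<beta> < \<infinity>" and cond\<beta>: "q \<ge> 2 \<or> P \<beta>"
    by (elim exE conjE)
  define D where "D = (if q = 2 then 6 else if q > 2 then 12 * 4 epowr (q - 2)
        else 7 * (ennreal (32 powr (q / 2) * kink_const q) * (1 + \<beta>)))"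
  have "D < \<infinity>"
    using \<beta> by (simp add: D_def ennreal_mult_less_top epowr_less_top)
  then have "D epowr (1 / q) * C < \<infinity>"
    using C pq by (simp add: ennreal_mult_less_top epowr_less_top)
  moreover have "(power_int q U (fourier f)) epowr (1 / q)
      \<le> (D epowr (1 / q) * C) * (power_int p W f) epowr (1 / p)"
    if f: "integrable lebesgue f" for f :: "real ^ 'n \<Rightarrow> complex"
  proof -
    define \<rho> where "\<rho> = rearrangement lebesgue (\<lambda>x. ennreal (cmod (f x)))"
    have [measurable]: "\<rho> \<in> borel_measurable borel" unfolding \<rho>_def by measurable
    have "(power_int q U (fourier f))
      \<le> D * (half_int q u (hardy \<rho>))"
      unfolding D_def \<rho>_def by (rule fourier_epowr_le[OF _ _ u pq(2) cond\<beta>[unfolded P_def] f]) simp_all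
    then have "(power_int q U (fourier f)) epowr (1 / q)
      \<le> (D * (half_int q u (hardy \<rho>))) epowr (1 / q)"
      using pq by (intro epowr_mono) auto
    also have "\<dots> = D epowr (1 / q) * (half_int q u (hardy \<rho>)) epowr (1 / q)"
      using pq by (intro epowr_mult) auto
    also have "\<dots> \<le> D epowr (1 / q) * (C * (half_int p w \<rho>) epowr (1 / p))"
      by (intro mult_left_mono hardy) auto
    also have "\<dots> \<le> D epowr (1 / q) * (C * (power_int p W f) epowr (1 / p))"
    proof (intro mult_left_mono epowr_mono)
      show "(half_int p w \<rho>) \<le> (power_int p W f)"
        unfolding \<rho>_def by (rule rearrangement_weight_le[OF _ _ w pq(1) f]) simp_all
    qed (use pq in auto)
    finally show ?thesis by (simp add: mult.assoc)
  qed
  ultimately show ?thesis by blast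
qed

section \<open>Duality\<close>

lemma conjugate_exponent:
  fixes p p' :: real
  assumes "1 < p" "1 / p + 1 / p' = 1"
  shows "p' > 1" "p + p' = p * p'" "p' * (1 / p) = p' - 1"
proof -
  have "1 / p < 1" "0 < 1 / p" using assms(1) by simp_all
  then have "0 < 1 / p'" "1 / p' < 1" using assms(2) by linarith+
  then show "p' > 1" by (simp add: divide_less_eq split: if_splits)
  then show "p + p' = p * p'" using assms by (simp add: field_simps)
  then show "p' * (1 / p) = p' - 1" using assms(1) by (simp add: field_simps)
qed

text \<open>For w = 0 or w = \<infinity> and nonzero a, b, one term on the right is infinite.
  Otherwise Young's inequality is applied with the weight divided between the factors, and its
  coefficients 1/p, 1/p' are enlarged to 1.\<close>

lemma epowr_young:
  assumes p: "1 < p" "1 / p + 1 / p' = 1"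
  shows "a * b \<le> a epowr p * w + b epowr p' * w epowr (1 - p')"
proof -
  note p'1 = conjugate_exponent(1)[OF p] and pp = conjugate_exponent(3)[OF p]
  have p'0: "p' > 0" using p'1 by simp
  consider "a = 0 \<or> b = 0" | "a \<noteq> 0" "b \<noteq> 0" "w = 0" | "a \<noteq> 0" "b \<noteq> 0" "w = top"
    | r where "a \<noteq> 0" "b \<noteq> 0" "r > 0" "w = ennreal r"
    by (metis ennreal_cases3)
  then show ?thesis
  proof cases
    case 1
    then show ?thesis by auto
  next
    case 2
    then have "b epowr p' * w epowr (1 - p') = top"
      using p'1 by (simp add: zero_epowr_neg ennreal_mult_top epowr_eq_0_iff)
    then show ?thesis by simp
  next
    case 3
    then have "a epowr p * w = top"
      using p by (simp add: ennreal_mult_top epowr_eq_0_iff)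
    then show ?thesis by simp
  next
    case 4
    have wr: "w epowr (1 - p') = ennreal (r powr (1 - p'))" "r powr (1 - p') > 0"
      using 4 by (simp_all add: epowr_ennreal)
    show ?thesis
    proof (cases "a = top \<or> b = top")
      case True
      then show ?thesis
        using 4 p p'0 wr by (auto simp: top_epowr ennreal_top_mult)
    next
      case False
      then obtain x y where xy: "a = ennreal x" "b = ennreal y" "x > 0" "y > 0"
        using 4 by (metis ennreal_cases3)
      have "x * y = (x * r powr (1 / p)) * (y * r powr (- (1 / p)))"
        using 4 by (simp add: powr_minus)
      also have "\<dots> \<le> (x * r powr (1 / p)) powr p / p + (y * r powr (- (1 / p))) powr p' / p'"
        using p p'1 xy by (intro Youngs_inequality) auto
      also have "\<dots> \<le> (x * r powr (1 / p)) powr p + (y * r powr (- (1 / p))) powr p'"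
      proof (intro add_mono)
        have "z / r \<le> z" if "r > 1" "z \<ge> 0" for z r :: real
          using mult_left_mono[of 1 r z] that by (simp add: divide_le_eq mult.commute)
        then show "(x * r powr (1 / p)) powr p / p \<le> (x * r powr (1 / p)) powr p"
          "(y * r powr (- (1 / p))) powr p' / p' \<le> (y * r powr (- (1 / p))) powr p'"
          using p p'1 by simp_all
      qed
      also have "(x * r powr (1 / p)) powr p = x powr p * r"
        using p 4 xy by (simp add: powr_mult powr_powr)
      also have "(y * r powr (- (1 / p))) powr p' = y powr p' * r powr (1 - p')"
        using pp 4 xy by (simp add: powr_mult powr_powr mult.commute)
      finally have "ennreal (x * y) \<le> ennreal (x powr p * r + y powr p' * r powr (1 - p'))"
        by (rule ennreal_leI)
      also have "\<dots> = a epowr p * w + b epowr p' * w epowr (1 - p')"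
        using xy 4 wr by (simp add: epowr_ennreal ennreal_mult ennreal_plus)
      finally show ?thesis using xy by (simp add: ennreal_mult)
    qed
  qed
qed

text \<open>Young's inequality is integrated after rescaling the pair to (c a, b/c). If one integral
  on the right is 0, finiteness of the other forces a b = 0 almost everywhere, also where the weight
  is 0 or \<infinity>.\<close>

lemma weighted_holder:
  assumes [measurable]: "a \<in> borel_measurable M" "b \<in> borel_measurable M" "w \<in> borel_measurable M"
    and p: "1 < p" "1 / p + 1 / p' = 1"
    and A: "(\<integral>\<^sup>+x. a x epowr p * w x \<partial>M) < \<infinity>"
    and B: "(\<integral>\<^sup>+x. b x epowr p' * w x epowr (1 - p') \<partial>M) < \<infinity>"
  shows "(\<integral>\<^sup>+x. a x * b x \<partial>M)
    \<le> 2 * (\<integral>\<^sup>+x. a x epowr p * w x \<partial>M) epowr (1 / p)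
        * (\<integral>\<^sup>+x. b x epowr p' * w x epowr (1 - p') \<partial>M) epowr (1 / p')"
    (is "?I \<le> 2 * ?A epowr _ * ?B epowr _")
proof -
  note p'1 = conjugate_exponent(1)[OF p]
  have p'0: "p' > 0" using p'1 by simp
  have AEA: "AE x in M. a x epowr p * w x \<noteq> \<infinity>"
    using A by (intro nn_integral_PInf_AE) auto
  have AEB: "AE x in M. b x epowr p' * w x epowr (1 - p') \<noteq> \<infinity>"
    using B by (intro nn_integral_PInf_AE) auto
  consider "?A = 0" | "?B = 0" | "?A \<noteq> 0" "?B \<noteq> 0" by blast
  then show ?thesis
  proof cases
    case 1
    then have "AE x in M. a x epowr p * w x = 0" by (subst (asm) nn_integral_0_iff_AE) auto
    with AEB have "AE x in M. a x * b x = 0"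
    proof eventually_elim
      case (elim x)
      show ?case
      proof (rule ccontr)
        assume "a x * b x \<noteq> 0"
        then have "a x \<noteq> 0" "b x \<noteq> 0" by auto
        with elim p have "w x = 0" by (auto simp: epowr_eq_0_iff)
        with elim p'1 \<open>b x \<noteq> 0\<close> show False
          by (simp add: zero_epowr_neg ennreal_mult_top epowr_eq_0_iff)
      qed
    qed
    then have "?I = 0" by (subst nn_integral_0_iff_AE) auto
    then show ?thesis by simp
  next
    case 2
    then have "AE x in M. b x epowr p' * w x epowr (1 - p') = 0" by (subst (asm) nn_integral_0_iff_AE) auto
    with AEA have "AE x in M. a x * b x = 0"
    proof eventually_elim
      case (elim x)
      show ?case
      proof (rule ccontr)
        assume "a x * b x \<noteq> 0"
        then have ab: "a x \<noteq> 0" "b x \<noteq> 0" by auto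
        with elim p'0 have "w x epowr (1 - p') = 0" by (auto simp: epowr_eq_0_iff)
        then have "w x = top"
          using p'1 by (cases "w x" rule: ennreal_cases3) (auto simp: zero_epowr_neg epowr_ennreal)
        with elim p ab show False
          by (simp add: ennreal_mult_top epowr_eq_0_iff)
      qed
    qed
    then have "?I = 0" by (subst nn_integral_0_iff_AE) auto
    then show ?thesis by simp
  next
    case 3
    obtain \<alpha> where \<alpha>: "?A = ennreal \<alpha>" "\<alpha> > 0"
      using A 3 by (cases "?A" rule: ennreal_cases3) auto
    moreover obtain \<beta> where \<beta>: "?B = ennreal \<beta>" "\<beta> > 0"
      using B 3 by (cases "?B" rule: ennreal_cases3) auto
    ultimately have \<alpha>\<beta>: "?A = ennreal \<alpha>" "?B = ennreal \<beta>" "\<alpha> > 0" "\<beta> > 0" by auto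
    \<comment> \<open>Chosen to balance c^p \<alpha> = c^(-p') \<beta>; both terms then equal the
      desired product, which gives the factor 2.\<close>
    define c where "c = (\<beta> / \<alpha>) powr (1 / (p + p'))"
    have c: "c > 0" using \<alpha>\<beta> by (simp add: c_def)
    note pp = conjugate_exponent(2)[OF p]
    have "?I = (\<integral>\<^sup>+x. (ennreal c * a x) * (ennreal (1 / c) * b x) \<partial>M)"
    proof (intro nn_integral_cong)
      fix x
      have "ennreal c * ennreal (1 / c) = 1" using c by (simp flip: ennreal_mult)
      then show "a x * b x = (ennreal c * a x) * (ennreal (1 / c) * b x)"
        by (metis mult.left_commute mult.assoc mult_1)
    qed
    also have "\<dots> \<le> (\<integral>\<^sup>+x. (ennreal c * a x) epowr p * w x + (ennreal (1 / c) * b x) epowr p' * w x epowr (1 - p') \<partial>M)"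
      by (intro nn_integral_mono epowr_young p)
    also have "\<dots> = (\<integral>\<^sup>+x. ennreal (c powr p) * (a x epowr p * w x) + ennreal ((1 / c) powr p') * (b x epowr p' * w x epowr (1 - p')) \<partial>M)"
      using p p'0 c by (simp add: epowr_mult epowr_ennreal mult.assoc)
    also have "\<dots> = ennreal (c powr p) * ?A + ennreal ((1 / c) powr p') * ?B"
      by (subst nn_integral_add) (simp_all add: nn_integral_cmult)
    also have "\<dots> = ennreal (c powr p * \<alpha> + (1 / c) powr p' * \<beta>)"
      using \<alpha>\<beta> by (simp add: ennreal_mult ennreal_plus)
    also have "c powr p * \<alpha> = \<alpha> powr (1 / p) * \<beta> powr (1 / p')"
    proof -
      have "c powr p = (\<beta> / \<alpha>) powr (1 / p')"
        using p p'0 by (simp add: c_def powr_powr pp)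
      also have "\<dots> * \<alpha> = \<beta> powr (1 / p') * (\<alpha> powr (- (1 / p')) * \<alpha> powr 1)"
        using \<alpha>\<beta> by (simp add: powr_divide powr_minus field_simps)
      also have "\<alpha> powr (- (1 / p')) * \<alpha> powr 1 = \<alpha> powr (- (1 / p') + 1)"
        by (simp only: powr_add)
      also have "- (1 / p') + 1 = 1 / p" using p by linarith
      finally show ?thesis by simp
    qed
    also have "(1 / c) powr p' * \<beta> = \<alpha> powr (1 / p) * \<beta> powr (1 / p')"
    proof -
      have "1 / c = (\<alpha> / \<beta>) powr (1 / (p + p'))"
        using \<alpha>\<beta> by (simp add: c_def powr_divide)
      then have "(1 / c) powr p' = (\<alpha> / \<beta>) powr (1 / p)"
        using p p'0 by (simp add: powr_powr pp)
      then have "(1 / c) powr p' * \<beta> = (\<alpha> / \<beta>) powr (1 / p) * \<beta>" by simp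
      also have "\<dots> = \<alpha> powr (1 / p) * (\<beta> powr (- (1 / p)) * \<beta> powr 1)"
        using \<alpha>\<beta> by (simp add: powr_divide powr_minus field_simps)
      also have "\<beta> powr (- (1 / p)) * \<beta> powr 1 = \<beta> powr (- (1 / p) + 1)"
        by (simp only: powr_add)
      also have "- (1 / p) + 1 = 1 / p'" using p by linarith
      finally show ?thesis .
    qed
    also have "ennreal (\<alpha> powr (1 / p) * \<beta> powr (1 / p') + \<alpha> powr (1 / p) * \<beta> powr (1 / p'))
      = 2 * ?A epowr (1 / p) * ?B epowr (1 / p')"
    proof -
      have "ennreal (d + d) = 2 * ennreal d" if "d \<ge> 0" for d :: real
        by (simp only: that ennreal_plus mult_2)
      moreover have "ennreal (\<alpha> powr (1 / p) * \<beta> powr (1 / p')) = ?A epowr (1 / p) * ?B epowr (1 / p')"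
        unfolding \<alpha>\<beta>(1,2) using \<alpha>\<beta>(3,4) by (simp add: epowr_ennreal ennreal_mult)
      ultimately show ?thesis by (simp add: mult.assoc)
    qed
    finally show ?thesis .
  qed
qed

text \<open>As 1 - r < 0, passing from m to the larger U lowers the second factor of m^r m^(1-r) =
  m. It bounds the norm of a test function built from a truncated weight in the full dual
  weight.\<close>

lemma epowr_trunc_le:
  assumes "m \<le> U" "m < top" "r > 1"
  shows "m epowr r * U epowr (1 - r) \<le> m"
proof (cases m rule: ennreal_cases3)
  case 1
  then have "m epowr r = 0" using assms(3) by (simp add: zero_epowr)
  then show ?thesis by simp
next
  case (2 x)
  have "m epowr r * U epowr (1 - r) \<le> m epowr r * m epowr (1 - r)"
    using assms by (intro mult_left_mono epowr_antimono) auto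
  also have "\<dots> = m" using 2 by (simp add: epowr_ennreal flip: ennreal_mult powr_add)
  finally show ?thesis .
next
  case 3
  then show ?thesis using assms(2) by simp
qed

lemma epowr_bootstrap:
  assumes "S < top" "a > 1" "S \<le> K * S epowr (1 - 1 / a)"
  shows "S epowr (1 / a) \<le> K"
proof (cases "S = 0")
  case True
  have "0 epowr (1 / a) = 0" using assms(2) by (intro zero_epowr) simp
  then show ?thesis using True by simp
next
  case False
  have "S = S epowr (1 - 1 / a) * S epowr (1 / a)"
    using assms by (subst epowr_add[symmetric]) auto
  then have "S epowr (1 - 1 / a) * S epowr (1 / a) \<le> S epowr (1 - 1 / a) * K"
    using assms by (simp add: mult.commute)
  moreover have "S epowr (1 - 1 / a) \<noteq> 0" "S epowr (1 - 1 / a) \<noteq> top"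
    using False assms by (simp_all add: epowr_eq_0_iff epowr_eq_top_iff)
  ultimately show ?thesis by (subst (asm) ennreal_mult_le_mult_iff) auto
qed

section \<open>Removing truncations\<close>

lemma SUP_min_of_nat: "(SUP N. min x (of_nat N)) = (x :: ennreal)"
proof (rule antisym)
  show "(SUP N. min x (of_nat N)) \<le> x" by (intro SUP_least) auto
  show "x \<le> (SUP N. min x (of_nat N))"
  proof (rule ccontr)
    assume "\<not> ?thesis"
    then have less: "(SUP N. min x (of_nat N)) < x" by simp
    then obtain N where N: "(SUP N. min x (of_nat N)) < of_nat N"
      using ennreal_Ex_less_of_nat[of "SUP N. min x (of_nat N)"]
      by (meson order_less_le_trans top_greatest)
    have "min x (of_nat N) \<le> (SUP N. min x (of_nat N))" by (rule SUP_upper) simp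
    then show False using less N by (auto simp: min_def split: if_splits)
  qed
qed

lemma epowr_mult_le_SUP:
  fixes h \<sigma> :: ennreal
  assumes "a > 0"
  shows "h epowr a * \<sigma> \<le> (SUP N. min h (of_nat N) epowr a * min \<sigma> (of_nat N))"
    (is "_ \<le> ?S")
proof -
  have h: "h epowr a \<le> (SUP N. min h (of_nat N) epowr a)" (is "_ \<le> ?T")
  proof -
    have "min h (of_nat N) \<le> ?T epowr (1 / a)" for N
      using assms SUP_upper[of N UNIV "\<lambda>N. min h (of_nat N) epowr a"]
      by (simp add: epowr_le_iff'[symmetric])
    then have "(SUP N. min h (of_nat N)) \<le> ?T epowr (1 / a)" by (intro SUP_least)
    then show ?thesis using assms by (simp add: SUP_min_of_nat epowr_le_iff')
  qed
  have "h epowr a * \<sigma> \<le> (SUP N. min h (of_nat N) epowr a) * (SUP M. min \<sigma> (of_nat M))"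
    using h by (simp add: SUP_min_of_nat mult_right_mono)
  also have "\<dots> = (SUP N. (SUP M. min h (of_nat N) epowr a * min \<sigma> (of_nat M)))"
    by (simp add: SUP_mult_right_ennreal SUP_mult_left_ennreal) (rule SUP_commute)
  \<comment> \<open>The double supremum is attained along the diagonal, by monotonicity in both
    truncation levels.\<close>
  also have "\<dots> \<le> ?S"
  proof (intro SUP_least)
    fix N M :: nat
    have "(of_nat N :: ennreal) \<le> of_nat (max N M)" "(of_nat M :: ennreal) \<le> of_nat (max N M)" by simp_all
    then have "min h (of_nat N) epowr a * min \<sigma> (of_nat M)
      \<le> min h (of_nat (max N M)) epowr a * min \<sigma> (of_nat (max N M))"
      using assms by (intro mult_mono epowr_mono min.mono) auto
    also have "\<dots> \<le> ?S" by (rule SUP_upper) simp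
    finally show "min h (of_nat N) epowr a * min \<sigma> (of_nat M) \<le> ?S" .
  qed
  finally show ?thesis .
qed

text \<open>An a priori finite truncation of \<open>\<integral> h\<^sup>a \<sigma>\<close> that is bounded by \<open>K\<close> times a smaller power
  of itself is bounded in terms of \<open>K\<close> alone, and the truncation can then be removed.\<close>

lemma nn_integral_epowr_bootstrap:
  fixes X :: "nat \<Rightarrow> 'a set"
  assumes [measurable]: "h \<in> borel_measurable M" "\<sigma> \<in> borel_measurable M"
    and X: "\<And>N. X N \<in> sets M" "incseq X" "(\<Union>N. X N) = space M" "\<And>N. emeasure M (X N) < \<infinity>"
    and a: "a > 1"
    and le: "\<And>N. (\<integral>\<^sup>+x. min (h x) (of_nat N) epowr a * (min (\<sigma> x) (of_nat N) * indicator (X N) x) \<partial>M) < top \<Longrightarrow>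
      (\<integral>\<^sup>+x. min (h x) (of_nat N) epowr a * (min (\<sigma> x) (of_nat N) * indicator (X N) x) \<partial>M)
      \<le> K * (\<integral>\<^sup>+x. min (h x) (of_nat N) epowr a * (min (\<sigma> x) (of_nat N) * indicator (X N) x) \<partial>M) epowr (1 - 1 / a)"
  shows "(\<integral>\<^sup>+x. h x epowr a * \<sigma> x \<partial>M) epowr (1 / a) \<le> K"
proof -
  note X(1)[measurable]
  define F where "F N x = min (h x) (of_nat N) epowr a * (min (\<sigma> x) (of_nat N) * indicator (X N) x)" for N x
  have [measurable]: "F N \<in> borel_measurable M" for N unfolding F_def by measurable
  have inc: "F N x \<le> F N' x" if "N \<le> N'" for N N' x
  proof -
    have "(of_nat N :: ennreal) \<le> of_nat N'" using that by simp
    moreover have "X N \<subseteq> X N'" using X(2) that by (rule incseqD)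
    ultimately show ?thesis
      unfolding F_def using a
      by (intro mult_mono epowr_mono min.mono) (auto split: split_indicator)
  qed
  have fin: "(\<integral>\<^sup>+x. F N x \<partial>M) < top" for N
  proof -
    have "(\<integral>\<^sup>+x. F N x \<partial>M) \<le> (\<integral>\<^sup>+x. (of_nat N epowr a * of_nat N) * indicator (X N) x \<partial>M)"
      unfolding F_def mult.assoc using a
      by (intro nn_integral_mono mult_mono epowr_mono) auto
    also have "\<dots> = (of_nat N epowr a * of_nat N) * emeasure M (X N)"
      by (subst nn_integral_cmult) simp_all
    also have "\<dots> < top"
      using X(4)[of N] a by (simp add: ennreal_mult_less_top epowr_less_top of_nat_less_top)
    finally show ?thesis .
  qed
  have "(\<integral>\<^sup>+x. F N x \<partial>M) epowr (1 / a) \<le> K" for N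
    using fin[of N] a le[of N, folded F_def] by (intro epowr_bootstrap)
  then have FK: "(\<integral>\<^sup>+x. F N x \<partial>M) \<le> K epowr a" for N
    using a by (simp add: le_epowr_iff)
  have "(\<integral>\<^sup>+x. h x epowr a * \<sigma> x \<partial>M) \<le> (\<integral>\<^sup>+x. (SUP N. F N x) \<partial>M)"
  proof (rule nn_integral_mono)
    fix x assume "x \<in> space M"
    then obtain M0 where M0: "x \<in> X M0" using X(3) by blast
    have "h x epowr a * \<sigma> x \<le> (SUP N. min (h x) (of_nat N) epowr a * min (\<sigma> x) (of_nat N))"
      using a by (intro epowr_mult_le_SUP) auto
    also have "\<dots> \<le> (SUP N. F N x)"
    proof (rule SUP_least)
      fix N
      have "x \<in> X (max N M0)" using M0 incseqD[OF X(2), of M0 "max N M0"] by auto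
      moreover have "(of_nat N :: ennreal) \<le> of_nat (max N M0)" by simp
      ultimately have "min (h x) (of_nat N) epowr a * min (\<sigma> x) (of_nat N) \<le> F (max N M0) x"
        unfolding F_def using a
        by (simp del: of_nat_max) (intro mult_mono epowr_mono min.mono order_refl, auto)
      also have "\<dots> \<le> (SUP N. F N x)" by (rule SUP_upper) simp
      finally show "min (h x) (of_nat N) epowr a * min (\<sigma> x) (of_nat N) \<le> (SUP N. F N x)" .
    qed
    finally show "h x epowr a * \<sigma> x \<le> (SUP N. F N x)" .
  qed
  also have "\<dots> = (SUP N. \<integral>\<^sup>+x. F N x \<partial>M)"
    by (rule nn_integral_monotone_convergence_SUP) (auto simp: incseq_def le_fun_def inc)
  also have "\<dots> \<le> K epowr a" by (intro SUP_least FK)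
  finally show ?thesis using a by (simp add: le_epowr_iff)
qed

text \<open>Both sides integrate over the region t x < 1, which is symmetric in t and x.\<close>

lemma nn_integral_hardy_adjoint:
  assumes [measurable]: "f \<in> borel_measurable borel" "g \<in> borel_measurable borel"
  shows "(\<integral>\<^sup>+x\<in>{0<..}. hardy g x * f x \<partial>lborel) = (\<integral>\<^sup>+t\<in>{0<..}. g t * hardy f t \<partial>lborel)"
proof -
  have "(\<integral>\<^sup>+x\<in>{0<..}. hardy g x * f x \<partial>lborel)
    = (\<integral>\<^sup>+x. (\<integral>\<^sup>+t. g t * f x * indicator {t. 0 < x \<and> 0 < t \<and> t * x < 1} t \<partial>lborel) \<partial>lborel)"
  proof (rule nn_integral_cong)
    fix x :: real
    have "hardy g x * f x * indicator {0<..} x = (\<integral>\<^sup>+t. g t * indicator {0<..<1 / x} t * (f x * indicator {0<..} x) \<partial>lborel)"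
      by (subst nn_integral_multc) (simp_all add: hardy_def mult.assoc)
    also have "\<dots> = (\<integral>\<^sup>+t. g t * f x * indicator {t. 0 < x \<and> 0 < t \<and> t * x < 1} t \<partial>lborel)"
      by (intro nn_integral_cong) (auto split: split_indicator simp: field_simps)
    finally show "hardy g x * f x * indicator {0<..} x
      = (\<integral>\<^sup>+t. g t * f x * indicator {t. 0 < x \<and> 0 < t \<and> t * x < 1} t \<partial>lborel)" .
  qed
  also have "\<dots> = (\<integral>\<^sup>+t. (\<integral>\<^sup>+x. g t * f x * indicator {t. 0 < x \<and> 0 < t \<and> t * x < 1} t \<partial>lborel) \<partial>lborel)"
    by (rule lborel_pair.Fubini') measurable
  also have "\<dots> = (\<integral>\<^sup>+t\<in>{0<..}. g t * hardy f t \<partial>lborel)"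
  proof (rule nn_integral_cong)
    fix t :: real
    have "g t * hardy f t * indicator {0<..} t = (\<integral>\<^sup>+x. (g t * indicator {0<..} t) * (f x * indicator {0<..<1 / t} x) \<partial>lborel)"
      by (subst nn_integral_cmult) (simp_all add: hardy_def mult_ac)
    also have "\<dots> = (\<integral>\<^sup>+x. g t * f x * indicator {t. 0 < x \<and> 0 < t \<and> t * x < 1} t \<partial>lborel)"
      by (intro nn_integral_cong) (auto split: split_indicator simp: field_simps)
    finally show "(\<integral>\<^sup>+x. g t * f x * indicator {t. 0 < x \<and> 0 < t \<and> t * x < 1} t \<partial>lborel)
      = g t * hardy f t * indicator {0<..} t" ..
  qed
  finally show ?thesis .
qed

lemma balls_exhaust:
  "incseq (\<lambda>N. ball (0 :: 'a::euclidean_space) (real N))" "(\<Union>N. ball (0 :: 'a) (real N)) = UNIV"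
  "emeasure lborel (ball (0 :: 'a) (real N)) < \<infinity>"
proof -
  show "incseq (\<lambda>N. ball (0 :: 'a) (real N))" by (auto simp: incseq_def)
  show "(\<Union>N. ball (0 :: 'a) (real N)) = UNIV" using reals_Archimedean2 by auto
  show "emeasure lborel (ball (0 :: 'a) (real N)) < \<infinity>" by (intro emeasure_bounded_finite) simp
qed

text \<open>The operator \<open>hardy\<close> is formally self-adjoint, so a weighted inequality for it dualizes.\<close>

lemma hardy_dual:
  fixes p p' q q' :: real
  assumes [measurable]: "u \<in> borel_measurable borel" "w \<in> borel_measurable borel" "g \<in> borel_measurable borel"
    and p: "1 < p" "1 / p + 1 / p' = 1" and q: "1 < q" "1 / q + 1 / q' = 1" and C: "C < top"
    and hardy: "\<And>f. f \<in> borel_measurable borel \<Longrightarrow>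
      (half_int q u (hardy f)) epowr (1 / q)
        \<le> C * (half_int p w f) epowr (1 / p)"
    and fin: "(half_int q' (\<lambda>x. u x epowr (1 - q')) g) < top"
  shows "(half_int p' (\<lambda>x. w x epowr (1 - p')) (hardy g)) epowr (1 / p')
    \<le> 2 * C * (half_int q' (\<lambda>x. u x epowr (1 - q')) g) epowr (1 / q')"
proof -
  note p' = conjugate_exponent[OF p] and q' = conjugate_exponent[OF q]
  let ?B = "\<integral>\<^sup>+t\<in>{0<..}. g t epowr q' * u t epowr (1 - q') \<partial>lborel"
  define \<sigma> where "\<sigma> x = w x epowr (1 - p') * indicator {0<..} x" for x
  have [measurable]: "\<sigma> \<in> borel_measurable borel" unfolding \<sigma>_def by measurable
  have "(\<integral>\<^sup>+x. hardy g x epowr p' * \<sigma> x \<partial>lborel) epowr (1 / p') \<le> 2 * C * ?B epowr (1 / q')"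
  proof (rule nn_integral_epowr_bootstrap[where X="\<lambda>N. ball 0 (real N)"])
    fix N :: nat
    define k where "k x = min (hardy g x) (of_nat N)" for x
    define m where "m x = min (\<sigma> x) (of_nat N) * indicator (ball 0 (real N)) x" for x
    have [measurable]: "ball (0 :: real) (real N) \<in> sets borel" by simp
    have [measurable]: "k \<in> borel_measurable borel" "m \<in> borel_measurable borel"
      unfolding k_def m_def by measurable
    let ?S = "\<integral>\<^sup>+x. k x epowr p' * m x \<partial>lborel"
    assume "(\<integral>\<^sup>+x. min (hardy g x) (of_nat N) epowr p' * (min (\<sigma> x) (of_nat N) * indicator (ball 0 (real N)) x) \<partial>lborel) < top"
    then have S: "?S < top" by (simp add: k_def m_def)
    \<comment> \<open>The truncated extremal function for the dual norm. Since (p' - 1) p = p', its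
      norm in the original inequality is again bounded by ?S.\<close>
    define f where "f x = k x epowr (p' - 1) * m x" for x
    have [measurable]: "f \<in> borel_measurable borel" unfolding f_def by measurable
    have m0: "m x = 0" if "x \<le> 0" for x using that by (simp add: m_def \<sigma>_def)
    have m_le: "m x \<le> w x epowr (1 - p')" for x
      unfolding m_def \<sigma>_def by (auto split: split_indicator)
    have m_fin: "m x < top" for x
    proof -
      have "m x \<le> of_nat N" by (auto simp: m_def split: split_indicator)
      then show ?thesis by (simp add: of_nat_less_top order_le_less_trans)
    qed
    have F: "(half_int p w f) \<le> ?S"
    proof (rule nn_integral_mono)
      fix t
      have "(p' - 1) * p = p'" using p'(2) by (simp add: algebra_simps)
      then have fp: "f t epowr p = k t epowr p' * m t epowr p"
        using p by (simp add: f_def epowr_mult epowr_epowr)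
      have "(1 - p') * (1 - p) = 1" using p'(2) by (simp add: algebra_simps)
      then have wt: "w t = (w t epowr (1 - p')) epowr (1 - p)"
        by (simp add: epowr_epowr)
      have "m t epowr p * (w t epowr (1 - p')) epowr (1 - p) \<le> m t"
        by (rule epowr_trunc_le[OF m_le m_fin p(1)])
      then have "f t epowr p * w t \<le> k t epowr p' * m t"
        unfolding fp using wt by (simp add: mult.assoc mult_left_mono)
      then show "f t epowr p * w t * indicator {0<..} t \<le> k t epowr p' * m t"
        by (auto split: split_indicator)
    qed
    let ?H = "\<integral>\<^sup>+t\<in>{0<..}. hardy f t epowr q * u t \<partial>lborel"
    have "?H epowr (1 / q) \<le> C * (half_int p w f) epowr (1 / p)"
      by (rule hardy) measurable
    also have "\<dots> \<le> C * ?S epowr (1 / p)"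
      using F p by (intro mult_left_mono epowr_mono) auto
    finally have H: "?H epowr (1 / q) \<le> C * ?S epowr (1 / p)" .
    also have "\<dots> < top"
      using C S p by (simp add: ennreal_mult_less_top epowr_less_top)
    finally have Hfin: "?H < top"
      using q by (simp add: epowr_less_top_iff)
    \<comment> \<open>Hoelder's inequality is applied on the whole line, so the restriction to t > 0
      is moved inside the powers, where 0 stays 0.\<close>
    have Heq: "(\<integral>\<^sup>+t. (hardy f t * indicator {0<..} t) epowr q * u t \<partial>lborel) = ?H"
      using q by (intro nn_integral_cong) (auto split: split_indicator simp: zero_epowr)
    have Beq: "(\<integral>\<^sup>+t. (g t * indicator {0<..} t) epowr q' * u t epowr (1 - q') \<partial>lborel) = ?B"
      using q' by (intro nn_integral_cong) (auto split: split_indicator simp: zero_epowr)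
    have "?S \<le> (\<integral>\<^sup>+x\<in>{0<..}. hardy g x * f x \<partial>lborel)"
    proof (rule nn_integral_mono)
      fix x :: real
      have "k x epowr p' = k x * k x epowr (p' - 1)"
        using p' epowr_add[of 1 "p' - 1" "k x"] by simp
      also have "\<dots> \<le> hardy g x * k x epowr (p' - 1)"
        by (intro mult_right_mono) (auto simp: k_def)
      finally have "k x epowr p' * m x \<le> hardy g x * k x epowr (p' - 1) * m x"
        by (rule mult_right_mono) simp
      then show "k x epowr p' * m x \<le> hardy g x * f x * indicator {0<..} x"
        using m0[of x] by (auto simp: f_def mult.assoc split: split_indicator)
    qed
    also have "\<dots> = (\<integral>\<^sup>+t\<in>{0<..}. g t * hardy f t \<partial>lborel)"
      by (rule nn_integral_hardy_adjoint) measurable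
    also have "\<dots> = (\<integral>\<^sup>+t. (hardy f t * indicator {0<..} t) * (g t * indicator {0<..} t) \<partial>lborel)"
      by (intro nn_integral_cong) (auto split: split_indicator simp: mult.commute)
    also have "\<dots> \<le> 2 * ?H epowr (1 / q) * ?B epowr (1 / q')"
      using weighted_holder[of "\<lambda>t. hardy f t * indicator {0<..} t" lborel "\<lambda>t. g t * indicator {0<..} t" u q q']
        q Hfin fin unfolding Heq Beq by simp
    also have "\<dots> \<le> 2 * (C * ?S epowr (1 / p)) * ?B epowr (1 / q')"
      using H by (intro mult_right_mono mult_left_mono) auto
    also have "1 / p = 1 - 1 / p'" using p by linarith
    finally show "(\<integral>\<^sup>+x. min (hardy g x) (of_nat N) epowr p' * (min (\<sigma> x) (of_nat N) * indicator (ball 0 (real N)) x) \<partial>lborel)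
      \<le> 2 * C * ?B epowr (1 / q') * (\<integral>\<^sup>+x. min (hardy g x) (of_nat N) epowr p' * (min (\<sigma> x) (of_nat N) * indicator (ball 0 (real N)) x) \<partial>lborel) epowr (1 - 1 / p')"
      by (simp add: k_def m_def mult_ac)
  qed (use p' balls_exhaust in simp_all)
  then show ?thesis by (simp add: \<sigma>_def mult.assoc)
qed

text \<open>The identity \<open>\<integral> f^ g = \<integral> f g^\<close> is tested with a truncation of
  \<open>sgn (cnj f^) |f^|\<^bsup>q-1\<^esup> U\<close>.\<close>

lemma fourier_dual:
  fixes f :: "real ^ 'n \<Rightarrow> complex" and U W :: "real ^ 'n \<Rightarrow> ennreal" and p p' q q' :: real
  assumes [measurable]: "U \<in> borel_measurable lebesgue" "W \<in> borel_measurable lebesgue"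
    and p: "1 < p" "1 / p + 1 / p' = 1" and q: "1 < q" "1 / q + 1 / q' = 1" and C: "C < top"
    and dual: "\<And>g :: real ^ 'n \<Rightarrow> complex. integrable lebesgue g \<Longrightarrow>
      (power_int p' (\<lambda>x. W x epowr (1 - p')) (fourier g)) epowr (1 / p')
        \<le> C * (power_int q' (\<lambda>x. U x epowr (1 - q')) g) epowr (1 / q')"
    and f: "integrable lebesgue f"
    and fin: "(power_int p W f) < top"
  shows "(power_int q U (fourier f)) epowr (1 / q)
    \<le> 2 * C * (power_int p W f) epowr (1 / p)"
proof (rule nn_integral_epowr_bootstrap[where X="\<lambda>N. ball 0 (real N)"])
  note p' = conjugate_exponent[OF p] and q' = conjugate_exponent[OF q]
  have [measurable]: "f \<in> borel_measurable lebesgue" using f by auto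
  let ?A = "\<integral>\<^sup>+x. ennreal (cmod (f x)) epowr p * W x \<partial>lebesgue"
  let ?h = "\<lambda>x. ennreal (cmod (fourier f x))"
  fix N :: nat
  let ?X = "ball (0 :: real ^ 'n) (real N)"
  have X[measurable]: "?X \<in> sets lebesgue" by simp
  have Xfin: "emeasure lebesgue ?X < \<infinity>" using balls_exhaust(3) by simp
  define k where "k x = min (?h x) (of_nat N)" for x
  define m where "m x = min (U x) (of_nat N) * indicator ?X x" for x
  have [measurable]: "k \<in> borel_measurable lebesgue" "m \<in> borel_measurable lebesgue"
    unfolding k_def m_def by measurable
  let ?S = "\<integral>\<^sup>+x. k x epowr q * m x \<partial>lebesgue"
  assume "(\<integral>\<^sup>+x. min (?h x) (of_nat N) epowr q * (min (U x) (of_nat N) * indicator ?X x) \<partial>lebesgue) < top"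
  then have S: "?S < top" by (simp add: k_def m_def)
  have m_le: "m x \<le> U x" for x by (auto simp: m_def split: split_indicator)
  have mN: "m x \<le> of_nat N * indicator ?X x" for x by (auto simp: m_def split: split_indicator)
  have m_fin: "m x < top" for x
    using mN[of x] by (rule order_le_less_trans) (auto simp: of_nat_less_top split: split_indicator)
  define G where "G x = k x epowr (q - 1) * m x" for x
  have [measurable]: "G \<in> borel_measurable lebesgue" unfolding G_def by measurable
  \<comment> \<open>The two height truncations bound \<open>G\<close> by N^(q-1) N on the ball and
    \<open>G\<close> vanishes outside, which makes the test function integrable.\<close>
  obtain b where b: "of_nat N epowr (q - 1) * of_nat N = ennreal b" "b \<ge> 0"
    using q by (cases "of_nat N epowr (q - 1) * of_nat N :: ennreal")
      (auto simp: ennreal_mult_eq_top_iff epowr_eq_top_iff)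
  have G_le: "G x \<le> ennreal (b * indicator ?X x)" for x
  proof -
    have "G x \<le> of_nat N epowr (q - 1) * (of_nat N * indicator ?X x)"
      unfolding G_def using q mN by (intro mult_mono epowr_mono) (auto simp: k_def)
    then show ?thesis using b by (auto split: split_indicator)
  qed
  then have G_real: "G x = ennreal (enn2real (G x))" for x
    using order_le_less_trans[OF G_le[of x] ennreal_less_top] by simp
  \<comment> \<open>Where the transform vanishes the quotient is 0 by the convention for division by
    0, consistent with \<open>fg\<close>.\<close>
  define g where "g x = cnj (fourier f x) / complex_of_real (cmod (fourier f x)) * complex_of_real (enn2real (G x))" for x
  have [measurable]: "g \<in> borel_measurable lebesgue" unfolding g_def by measurable
  have g_norm: "cmod (g x) \<le> enn2real (G x)" for x
    by (cases "fourier f x = 0") (simp_all add: g_def norm_mult norm_divide)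
  have g: "integrable lebesgue g"
  proof (rule Bochner_Integration.integrable_bound)
    show "integrable lebesgue (\<lambda>x. b * indicat_real ?X x)"
      using Xfin by (intro integrable_mult_right integrable_real_indicator) auto
    show "AE x in lebesgue. norm (g x) \<le> norm (b * indicat_real ?X x)"
    proof (rule AE_I2)
      fix x
      have "enn2real (G x) \<le> b * indicat_real ?X x"
        using G_le[of x] b by (subst (asm) G_real) (simp add: ennreal_le_iff)
      then show "norm (g x) \<le> norm (b * indicat_real ?X x)"
        using g_norm[of x] by simp
    qed
  qed simp
  have fg: "fourier f x * g x = complex_of_real (cmod (fourier f x) * enn2real (G x))" for x
  proof -
    have "fourier f x * cnj (fourier f x) = complex_of_real (cmod (fourier f x)) * complex_of_real (cmod (fourier f x))"
      using complex_norm_square[of "fourier f x"] by (simp add: power2_eq_square)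
    then have "fourier f x * (cnj (fourier f x) / complex_of_real (cmod (fourier f x))) = complex_of_real (cmod (fourier f x))"
      by simp
    then show ?thesis unfolding g_def by (simp only: mult.assoc[symmetric] of_real_mult)
  qed
  define B where "B = (LINT y|lebesgue. cmod (f y))"
  have B: "cmod (fourier f x) \<le> B" for x
    unfolding fourier_fkernel B_def
    using integral_norm_bound[of lebesgue "\<lambda>y. fkernel x y * f y"] by (simp add: norm_mult)
  have int: "integrable lebesgue (\<lambda>x. cmod (fourier f x) * enn2real (G x))"
  proof -
    have "integrable lebesgue (\<lambda>x. fourier f x * g x)"
    proof (rule Bochner_Integration.integrable_bound)
      show "integrable lebesgue (\<lambda>x. B * cmod (g x))" using g by simp
      show "AE x in lebesgue. norm (fourier f x * g x) \<le> norm (B * cmod (g x))"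
        using B order_trans[OF norm_ge_zero B] by (auto simp: norm_mult intro!: mult_right_mono)
    qed simp
    then have "integrable lebesgue (\<lambda>x. norm (fourier f x * g x))" by (rule integrable_norm)
    then show ?thesis by (simp add: fg norm_mult)
  qed
  have gS: "(power_int q' (\<lambda>x. U x epowr (1 - q')) g) \<le> ?S"
  proof (rule nn_integral_mono)
    fix x
    have "ennreal (cmod (g x)) \<le> G x"
      using g_norm[of x] by (subst G_real) (rule ennreal_leI)
    then have "ennreal (cmod (g x)) epowr q' * U x epowr (1 - q') \<le> G x epowr q' * U x epowr (1 - q')"
      using q' by (intro mult_right_mono epowr_mono) auto
    also have "G x epowr q' = k x epowr q * m x epowr q'"
    proof -
      have "(q - 1) * q' = q" using q'(2) by (simp add: algebra_simps)
      then show ?thesis using q'(1) by (simp add: G_def epowr_mult epowr_epowr)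
    qed
    also have "\<dots> * U x epowr (1 - q') \<le> k x epowr q * m x"
      unfolding mult.assoc by (intro mult_left_mono epowr_trunc_le m_le m_fin q') simp
    finally show "ennreal (cmod (g x)) epowr q' * U x epowr (1 - q') \<le> k x epowr q * m x" .
  qed
  let ?D = "\<integral>\<^sup>+y. ennreal (cmod (fourier g y)) epowr p' * W y epowr (1 - p') \<partial>lebesgue"
  have "?D epowr (1 / p') \<le> C * (power_int q' (\<lambda>x. U x epowr (1 - q')) g) epowr (1 / q')"
    by (rule dual[OF g])
  also have "\<dots> \<le> C * ?S epowr (1 / q')"
    using gS q' by (intro mult_left_mono epowr_mono) auto
  finally have D: "?D epowr (1 / p') \<le> C * ?S epowr (1 / q')" .
  also have "\<dots> < top"
    using C S q' by (simp add: ennreal_mult_less_top epowr_less_top)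
  finally have Dfin: "?D < top"
    using p'(1) by (simp add: epowr_less_top_iff)
  have "?S \<le> (\<integral>\<^sup>+x. ennreal (cmod (fourier f x) * enn2real (G x)) \<partial>lebesgue)"
  proof (rule nn_integral_mono)
    fix x
    have "k x epowr q = k x * k x epowr (q - 1)"
      using q epowr_add[of 1 "q - 1" "k x"] by simp
    also have "\<dots> \<le> ?h x * k x epowr (q - 1)"
      by (intro mult_right_mono) (auto simp: k_def)
    finally have "k x epowr q * m x \<le> ?h x * k x epowr (q - 1) * m x"
      by (rule mult_right_mono) simp
    also have "\<dots> = ?h x * G x" by (simp add: G_def mult.assoc)
    also have "\<dots> = ennreal (cmod (fourier f x) * enn2real (G x))"
      by (subst G_real) (simp add: ennreal_mult)
    finally show "k x epowr q * m x \<le> ennreal (cmod (fourier f x) * enn2real (G x))" .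
  qed
  also have "\<dots> = ennreal (LINT x|lebesgue. cmod (fourier f x) * enn2real (G x))"
    using int by (intro nn_integral_eq_integral) auto
  also have "(LINT x|lebesgue. cmod (fourier f x) * enn2real (G x))
    = cmod (complex_of_real (LINT x|lebesgue. cmod (fourier f x) * enn2real (G x)))"
    by simp
  also have "complex_of_real (LINT x|lebesgue. cmod (fourier f x) * enn2real (G x)) = (LINT x|lebesgue. fourier f x * g x)"
    unfolding fg by (rule integral_complex_of_real[symmetric])
  also have "\<dots> = (LINT x|lebesgue. f x * fourier g x)"
    by (rule fourier_mult_formula[OF f g])
  also have "ennreal (cmod \<dots>) \<le> (\<integral>\<^sup>+x. ennreal (cmod (f x * fourier g x)) \<partial>lebesgue)"
  proof (cases "integrable lebesgue (\<lambda>x. f x * fourier g x)")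
    case True
    then show ?thesis by (rule integral_norm_bound_ennreal)
  qed (simp add: not_integrable_integral_eq)
  also have "\<dots> = (\<integral>\<^sup>+x. ennreal (cmod (f x)) * ennreal (cmod (fourier g x)) \<partial>lebesgue)"
    by (simp add: norm_mult ennreal_mult)
  also have "\<dots> \<le> 2 * ?A epowr (1 / p) * ?D epowr (1 / p')"
    using fin Dfin by (intro weighted_holder p) auto
  also have "\<dots> \<le> 2 * ?A epowr (1 / p) * (C * ?S epowr (1 / q'))"
    using D by (intro mult_left_mono) auto
  also have "1 / q' = 1 - 1 / q" using q by linarith
  finally show "(\<integral>\<^sup>+x. min (?h x) (of_nat N) epowr q * (min (U x) (of_nat N) * indicator ?X x) \<partial>lebesgue)
    \<le> 2 * C * ?A epowr (1 / p) * (\<integral>\<^sup>+x. min (?h x) (of_nat N) epowr q * (min (U x) (of_nat N) * indicator ?X x) \<partial>lebesgue) epowr (1 - 1 / q)"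
    by (simp add: k_def m_def mult_ac)
next
  have [measurable]: "f \<in> borel_measurable lebesgue" using f by auto
  show "(\<lambda>x. ennreal (cmod (fourier f x))) \<in> borel_measurable lebesgue" by measurable
qed (use assms balls_exhaust in simp_all)

text \<open>A negative power reverses order, so the superlevel set of W^r at \<open>\<alpha>\<close>
  lies in a sublevel set of \<open>W\<close> at \<alpha>^(1/r). Hence w^(1-p') can take the role of
  the left-hand weight.\<close>

lemma epowr_neg_superlevel:
  assumes [measurable]: "W \<in> borel_measurable M" and r: "r < 0"
    and w: "\<And>\<alpha>. 0 < \<alpha> \<Longrightarrow> ennreal t < emeasure M {x\<in>space M. W x \<le> ennreal \<alpha>} \<Longrightarrow> w \<le> ennreal \<alpha>"
    and \<alpha>: "0 < \<alpha>" "ennreal t < emeasure M {x\<in>space M. W x epowr r > ennreal \<alpha>}"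
  shows "ennreal \<alpha> \<le> w epowr r"
proof -
  let ?a = "\<alpha> powr (1 / r)"
  have a: "ennreal ?a epowr r = ennreal \<alpha>"
    using \<alpha> r by (simp add: epowr_ennreal powr_powr)
  have "{x\<in>space M. W x epowr r > ennreal \<alpha>} \<subseteq> {x\<in>space M. W x \<le> ennreal ?a}"
  proof safe
    fix x assume "ennreal \<alpha> < W x epowr r"
    moreover have "W x epowr r \<le> ennreal \<alpha>" if "ennreal ?a \<le> W x"
      using epowr_antimono[of r "ennreal ?a" "W x"] r that by (simp only: a less_imp_le)
    ultimately show "W x \<le> ennreal ?a"
      using linear[of "W x" "ennreal ?a"] by (auto simp: not_le[symmetric])
  qed
  then have "emeasure M {x\<in>space M. W x epowr r > ennreal \<alpha>} \<le> emeasure M {x\<in>space M. W x \<le> ennreal ?a}"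
    by (rule emeasure_mono) measurable
  with \<alpha> have "w \<le> ennreal ?a" by (intro w) auto
  then have "ennreal ?a epowr r \<le> w epowr r" using r by (intro epowr_antimono) auto
  then show ?thesis by (simp only: a)
qed

text \<open>Allows u^(1-q') as right-hand weight. The sublevel set of U^r is a superlevel set of
  \<open>U\<close> with non-strict inequality, while the hypothesis concerns strict ones, so the
  height \<alpha>^(1/r) is approached from below.\<close>

lemma epowr_neg_sublevel:
  assumes [measurable]: "U \<in> borel_measurable M" and r: "r < 0"
    and u: "\<And>\<alpha>. 0 < \<alpha> \<Longrightarrow> ennreal t < emeasure M {x\<in>space M. U x > ennreal \<alpha>} \<Longrightarrow> ennreal \<alpha> \<le> u"
    and \<alpha>: "0 < \<alpha>" "ennreal t < emeasure M {x\<in>space M. U x epowr r \<le> ennreal \<alpha>}"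
  shows "u epowr r \<le> ennreal \<alpha>"
proof -
  let ?a = "\<alpha> powr (1 / r)"
  have a: "ennreal ?a epowr r = ennreal \<alpha>" "?a > 0"
    using \<alpha> r by (simp_all add: epowr_ennreal powr_powr)
  have u_ge: "ennreal b \<le> u" if b: "0 < b" "b < ?a" for b
  proof -
    have "?a powr r < b powr r" using b r by (intro powr_less_mono2_neg) auto
    then have ba: "\<alpha> < b powr r" using \<alpha> r by (simp add: powr_powr)
    have "{x\<in>space M. U x epowr r \<le> ennreal \<alpha>} \<subseteq> {x\<in>space M. U x > ennreal b}"
    proof safe
      fix x assume le: "U x epowr r \<le> ennreal \<alpha>"
      show "ennreal b < U x"
      proof (rule ccontr)
        assume "\<not> ennreal b < U x"
        then have "ennreal b epowr r \<le> U x epowr r"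
          using r by (intro epowr_antimono) auto
        then have "ennreal (b powr r) \<le> ennreal \<alpha>"
          using le b by (simp add: epowr_ennreal)
        then show False using ba \<alpha> by (simp add: ennreal_le_iff)
      qed
    qed
    then have "emeasure M {x\<in>space M. U x epowr r \<le> ennreal \<alpha>} \<le> emeasure M {x\<in>space M. U x > ennreal b}"
      by (rule emeasure_mono) measurable
    with \<alpha> b show ?thesis by (intro u) auto
  qed
  have "ennreal ?a \<le> u"
  proof (rule ccontr)
    assume "\<not> ?thesis"
    then obtain c where c: "u = ennreal c" "c \<ge> 0" "c < ?a"
      by (cases u) (auto simp: not_le ennreal_less_iff)
    then have "ennreal ((c + ?a) / 2) \<le> ennreal c"
      using u_ge[of "(c + ?a) / 2"] a by simp
    then show False using c by (simp add: ennreal_le_iff)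
  qed
  then have "u epowr r \<le> ennreal ?a epowr r" using r by (intro epowr_antimono) auto
  then show ?thesis by (simp only: a)
qed

text \<open>The inequality for \<open>hardy\<close> is dualized, the direct result is applied to the
  dual weights with exponents q' on the right and p' on the left, and the resulting Fourier
  inequality is dualized back.\<close>

lemma fourier_weighted_of_dual_hardy:
  fixes U W :: "real ^ 'n \<Rightarrow> ennreal" and u w :: "real \<Rightarrow> ennreal" and p p' q :: real
  assumes [measurable]: "U \<in> borel_measurable lebesgue" "W \<in> borel_measurable lebesgue"
      "u \<in> borel_measurable borel" "w \<in> borel_measurable borel"
    and u: "\<And>t \<alpha>. 0 < t \<Longrightarrow> 0 < \<alpha> \<Longrightarrow> ennreal t < emeasure lebesgue {x. U x > ennreal \<alpha>} \<Longrightarrow> ennreal \<alpha> \<le> u t"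
    and w: "\<And>t \<alpha>. 0 < t \<Longrightarrow> 0 < \<alpha> \<Longrightarrow> ennreal t < emeasure lebesgue {x. W x \<le> ennreal \<alpha>} \<Longrightarrow> w t \<le> ennreal \<alpha>"
    and p: "1 < p" "1 / p + 1 / p' = 1" and q: "1 < q" and C: "C < \<infinity>"
    and hardy: "\<And>f. f \<in> borel_measurable borel \<Longrightarrow>
      (half_int q u (hardy f)) epowr (1 / q)
        \<le> C * (half_int p w f) epowr (1 / p)"
    and cond: "p' \<ge> 2 \<or> (\<exists>\<beta><\<infinity>. \<forall>y>0.
      ennreal (y powr (p' / 2)) * (\<integral>\<^sup>+x\<in>{y<..}. w x epowr (1 - p') / ennreal (x powr (p' / 2)) \<partial>lborel)
        \<le> \<beta> * ((\<integral>\<^sup>+x\<in>{0<..<y}. w x epowr (1 - p') \<partial>lborel)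
            + ennreal (y powr p') * (\<integral>\<^sup>+x\<in>{y<..}. w x epowr (1 - p') / ennreal (x powr p') \<partial>lborel)))"
  shows "\<exists>C<\<infinity>. \<forall>f :: real ^ 'n \<Rightarrow> complex. integrable lebesgue f \<longrightarrow>
      (power_int q U (fourier f)) epowr (1 / q)
        \<le> C * (power_int p W f) epowr (1 / p)"
proof -
  define q' where "q' = q / (q - 1)"
  have q1: "1 < q" "1 / q + 1 / q' = 1" using q by (simp_all add: q'_def field_simps)
  note p' = conjugate_exponent[OF p] and q' = conjugate_exponent[OF q1]
  \<comment> \<open>The summand 1 keeps the constant positive: when the right-hand integral is
    infinite, the bound is then \<infinity> and not 0 * \<infinity> = 0.\<close>
  have C2: "2 * C + 1 < top" using C by (simp add: ennreal_mult_less_top)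
  have "\<exists>C<\<infinity>. \<forall>g :: real ^ 'n \<Rightarrow> complex. integrable lebesgue g \<longrightarrow>
      (power_int p' (\<lambda>x. W x epowr (1 - p')) (fourier g)) epowr (1 / p')
        \<le> C * (power_int q' (\<lambda>x. U x epowr (1 - q')) g) epowr (1 / q')"
  proof (rule fourier_weighted_of_hardy[where u="\<lambda>t. w t epowr (1 - p')" and w="\<lambda>t. u t epowr (1 - q')" and C="2 * C + 1"])
    fix t \<alpha> :: real assume t: "0 < t" "0 < \<alpha>"
    show "ennreal \<alpha> \<le> w t epowr (1 - p')" if "ennreal t < emeasure lebesgue {x. W x epowr (1 - p') > ennreal \<alpha>}"
      using that t p' w by (intro epowr_neg_superlevel[of W lebesgue "1 - p'" t "w t" \<alpha>]) simp_all
    show "u t epowr (1 - q') \<le> ennreal \<alpha>" if "ennreal t < emeasure lebesgue {x. U x epowr (1 - q') \<le> ennreal \<alpha>}"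
      using that t q' u by (intro epowr_neg_sublevel[of U lebesgue "1 - q'" t "u t" \<alpha>]) simp_all
  next
    fix f :: "real \<Rightarrow> ennreal" assume [measurable]: "f \<in> borel_measurable borel"
    let ?B = "\<integral>\<^sup>+t\<in>{0<..}. f t epowr q' * u t epowr (1 - q') \<partial>lborel"
    show "(half_int p' (\<lambda>x. w x epowr (1 - p')) (hardy f)) epowr (1 / p') \<le> (2 * C + 1) * ?B epowr (1 / q')"
    proof (cases "?B = top")
      case True
      then have "(2 * C + 1) * ?B epowr (1 / q') = top"
        using q' by (simp add: top_epowr ennreal_mult_top)
      then show ?thesis by simp
    next
      case False
      have "(half_int p' (\<lambda>x. w x epowr (1 - p')) (hardy f)) epowr (1 / p') \<le> 2 * C * ?B epowr (1 / q')"
        using C False by (intro hardy_dual[OF _ _ _ p q1 _ hardy]) (auto simp: less_top)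
      also have "\<dots> \<le> (2 * C + 1) * ?B epowr (1 / q')"
        by (intro mult_right_mono) simp_all
      finally show ?thesis .
    qed
  qed (use p' q' C2 cond in simp_all)
  then obtain D where D: "D < top"
    and dual: "\<And>g :: real ^ 'n \<Rightarrow> complex. integrable lebesgue g \<Longrightarrow>
      (power_int p' (\<lambda>x. W x epowr (1 - p')) (fourier g)) epowr (1 / p')
        \<le> D * (power_int q' (\<lambda>x. U x epowr (1 - q')) g) epowr (1 / q')"
    by auto
  have "(power_int q U (fourier f)) epowr (1 / q)
        \<le> (2 * D + 1) * (power_int p W f) epowr (1 / p)"
    if f: "integrable lebesgue f" for f :: "real ^ 'n \<Rightarrow> complex"
  proof (cases "(power_int p W f) = top")
    case True
    then have "(2 * D + 1) * (power_int p W f) epowr (1 / p) = top"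
      using p by (simp add: top_epowr ennreal_mult_top)
    then show ?thesis by simp
  next
    case False
    have "(power_int q U (fourier f)) epowr (1 / q)
        \<le> 2 * D * (power_int p W f) epowr (1 / p)"
      by (rule fourier_dual[OF _ _ p q1 D dual f]) (use False in \<open>simp_all add: less_top\<close>)
    also have "\<dots> \<le> (2 * D + 1) * (power_int p W f) epowr (1 / p)"
      by (intro mult_right_mono) simp_all
    finally show ?thesis .
  qed
  moreover have "2 * D + 1 < \<infinity>" using D by (simp add: ennreal_mult_less_top)
  ultimately show ?thesis by blast
qed

text \<open>Write v(t) = t^(r-2) G(t) with G decreasing. Beyond y, G is at most G(y) and x^(r/2-2)
  is integrable because r < 2, which gives the constant 1 / (1 - r/2); below y, v is at least
  y^(r-2) G(y).\<close>

lemma B_class_of_antimono: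
  assumes [measurable]: "v \<in> borel_measurable borel" and r: "1 < r" "r < 2"
    and anti: "antimono_on {0<..} (\<lambda>t. ennreal (t powr (2 - r)) * v t)"
  shows "v \<in> B_class (r / 2)"
  unfolding B_class_def
proof (intro CollectI exI[of _ "ennreal (1 / (1 - r / 2))"] conjI allI impI)
  fix y :: real assume y: "y > 0"
  define G where "G t = ennreal (t powr (2 - r)) * v t" for t
  have v: "v t = ennreal (t powr (r - 2)) * G t" if "t > 0" for t
  proof -
    have "ennreal (t powr (r - 2)) * ennreal (t powr (2 - r)) = 1"
      using that by (simp flip: ennreal_mult powr_add)
    then show ?thesis by (simp add: G_def flip: mult.assoc)
  qed
  have G: "G t \<le> G s" if "0 < s" "s \<le> t" for s t
    using monotone_onD[OF anti, of s t] that by (simp add: G_def)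
  have "(\<integral>\<^sup>+x. ennreal (x powr (r / 2 - 2)) * indicator {y..} x \<partial>lborel) = ennreal (0 - y powr (r / 2 - 1) / (r / 2 - 1))"
  proof (rule nn_integral_FTC_atLeast[where F="\<lambda>x. x powr (r / 2 - 1) / (r / 2 - 1)" and T=0])
    show "DERIV (\<lambda>x. x powr (r / 2 - 1) / (r / 2 - 1)) x :> x powr (r / 2 - 2)" if "y \<le> x" for x
      using that y r by (auto intro!: derivative_eq_intros)
    have "((\<lambda>x. x powr (r / 2 - 1) / (r / 2 - 1)) \<longlongrightarrow> 0 / (r / 2 - 1)) at_top"
      using r by (intro tendsto_divide tendsto_neg_powr filterlim_ident tendsto_const) auto
    then show "((\<lambda>x. x powr (r / 2 - 1) / (r / 2 - 1)) \<longlongrightarrow> 0) at_top" by simp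
  qed auto
  also have "0 - y powr (r / 2 - 1) / (r / 2 - 1) = 1 / (1 - r / 2) * y powr (r / 2 - 1)"
    using r by (simp add: field_simps)
  finally have tail: "(\<integral>\<^sup>+x. ennreal (x powr (r / 2 - 2)) * indicator {y..} x \<partial>lborel)
    = ennreal (1 / (1 - r / 2) * y powr (r / 2 - 1))" .
  have "(tail_int (r / 2) v y)
    \<le> (\<integral>\<^sup>+x. G y * (ennreal (x powr (r / 2 - 2)) * indicator {y..} x) \<partial>lborel)"
  proof (rule nn_integral_mono)
    fix x
    have "v x / ennreal (x powr (r / 2)) \<le> G y * ennreal (x powr (r / 2 - 2))" if "y < x"
    proof -
      have x: "x > 0" using that y by simp
      have "inverse (ennreal (x powr (r / 2))) = ennreal (x powr (- (r / 2)))"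
        using x by (simp add: inverse_ennreal powr_minus)
      then have "v x / ennreal (x powr (r / 2)) = G x * (ennreal (x powr (r - 2)) * ennreal (x powr (- (r / 2))))"
        using v[OF x] by (simp add: divide_ennreal_def mult_ac)
      also have "ennreal (x powr (r - 2)) * ennreal (x powr (- (r / 2))) = ennreal (x powr (r / 2 - 2))"
        by (simp flip: ennreal_mult powr_add)
      also have "G x * ennreal (x powr (r / 2 - 2)) \<le> G y * ennreal (x powr (r / 2 - 2))"
        using that y by (intro mult_right_mono G) auto
      finally show ?thesis .
    qed
    then show "v x / ennreal (x powr (r / 2)) * indicator {y<..} x
      \<le> G y * (ennreal (x powr (r / 2 - 2)) * indicator {y..} x)"
      by (auto split: split_indicator)
  qed
  also have "\<dots> = G y * ennreal (1 / (1 - r / 2) * y powr (r / 2 - 1))"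
    by (subst nn_integral_cmult) (simp_all add: tail)
  finally have "ennreal (y powr (r / 2)) * (tail_int (r / 2) v y)
    \<le> ennreal (y powr (r / 2)) * (G y * ennreal (1 / (1 - r / 2) * y powr (r / 2 - 1)))"
    by (rule mult_left_mono) simp
  also have "\<dots> = ennreal (1 / (1 - r / 2)) * (G y * ennreal (y powr (r - 1)))"
  proof -
    have "y powr (r - 1) = y powr (r / 2) * y powr (r / 2 - 1)"
      by (simp flip: powr_add)
    then have "ennreal (y powr (r - 1)) = ennreal (y powr (r / 2)) * ennreal (y powr (r / 2 - 1))"
      by (simp add: ennreal_mult)
    moreover have "ennreal (1 / (1 - r / 2) * y powr (r / 2 - 1)) = ennreal (1 / (1 - r / 2)) * ennreal (y powr (r / 2 - 1))"
      using r by (intro ennreal_mult) auto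
    ultimately show ?thesis by (simp only: mult_ac)
  qed
  also have "\<dots> \<le> ennreal (1 / (1 - r / 2)) * (head_int v y)"
  proof (rule mult_left_mono)
    have "G y * ennreal (y powr (r - 1)) = (\<integral>\<^sup>+x. (G y * ennreal (y powr (r - 2))) * indicator {0<..<y} x \<partial>lborel)"
    proof -
      have "y powr (r - 1) = y powr (r - 2) * y"
        using y powr_add[of y "r - 2" 1] by simp
      then show ?thesis using y by (subst nn_integral_cmult) (simp_all add: ennreal_mult mult.assoc)
    qed
    also have "\<dots> \<le> (head_int v y)"
    proof (rule nn_integral_mono)
      fix x
      have "G y * ennreal (y powr (r - 2)) \<le> v x" if "0 < x" "x < y"
        unfolding v[OF that(1)] mult.commute[of "ennreal (x powr (r - 2))"] using that r
        by (intro mult_mono G ennreal_leI powr_mono2') auto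
      then show "G y * ennreal (y powr (r - 2)) * indicator {0<..<y} x \<le> v x * indicator {0<..<y} x"
        by (auto split: split_indicator)
    qed
    finally show "G y * ennreal (y powr (r - 1)) \<le> (head_int v y)" .
  qed simp
  finally show "ennreal (y powr (r / 2)) * (\<integral>\<^sup>+x\<in>{y<..}. v x / ennreal (x powr (r / 2)) \<partial>lebesgue)
    \<le> ennreal (1 / (1 - r / 2)) * (\<integral>\<^sup>+x\<in>{0<..<y}. v x \<partial>lebesgue)"
    by (simp only: nn_integral_completion)
qed simp

section \<open>Comparison of the weight conditions\<close>

lemma set_nn_integral_pos_cong:
  fixes a b :: "real \<Rightarrow> ennreal"
  assumes "\<And>x. 0 < x \<Longrightarrow> a x = b x" "S \<subseteq> {0<..}"
  shows "(\<integral>\<^sup>+x\<in>S. a x \<partial>M) = (\<integral>\<^sup>+x\<in>S. b x \<partial>M)"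
  using assms by (intro nn_integral_cong) (auto split: split_indicator)

lemma B_class_cong:
  assumes "\<And>x. 0 < x \<Longrightarrow> a x = b x"
  shows "a \<in> B_class s \<longleftrightarrow> b \<in> B_class s"
proof -
  have "(\<integral>\<^sup>+x\<in>{y<..}. a x / ennreal (x powr s) \<partial>lebesgue) = (\<integral>\<^sup>+x\<in>{y<..}. b x / ennreal (x powr s) \<partial>lebesgue)"
    "(\<integral>\<^sup>+x\<in>{0<..<y}. a x \<partial>lebesgue) = (\<integral>\<^sup>+x\<in>{0<..<y}. b x \<partial>lebesgue)" if "y > 0" for y
    using assms that by (auto intro!: set_nn_integral_pos_cong)
  then show ?thesis by (simp add: B_class_def)
qed

text \<open>Enlarging the right side by any \<open>R\<close> turns membership in the class into a
  condition of the form (c) or (f).\<close>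

lemma B_classD:
  assumes "v \<in> B_class s"
  shows "\<exists>\<beta><\<infinity>. \<forall>y>0. ennreal (y powr s) * (tail_int s v y)
        \<le> \<beta> * ((head_int v y) + R y)"
proof -
  obtain \<beta> where \<beta>: "\<beta> < \<infinity>" "\<And>y. y > 0 \<Longrightarrow>
     ennreal (y powr s) * (tail_int s v y) \<le> \<beta> * (head_int v y)"
    using assms by (auto simp: B_class_def nn_integral_completion)
  have "ennreal (y powr s) * (tail_int s v y)
        \<le> \<beta> * ((head_int v y) + R y)" if "y > 0" for y
    using \<beta>(2)[OF that] by (rule order_trans) (intro mult_left_mono, auto)
  with \<beta>(1) show ?thesis by blast
qed

text \<open>Both sides are integrals of powers of min(1, y/z) <= 1, which decrease in the exponent.
  It replaces max(1, q) in (c) by q.\<close>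

lemma weight_cond_le_exponent:
  assumes [measurable]: "v \<in> borel_measurable borel" and y: "y > 0" and r: "0 < r" "r \<le> s"
  shows "(head_int v y) + ennreal (y powr s) * (tail_int s v y)
    \<le> (head_int v y) + ennreal (y powr r) * (tail_int r v y)"
proof -
  have "(\<integral>\<^sup>+z\<in>{0<..}. ennreal (min 1 (y / z) powr s) * v z \<partial>lborel)
    \<le> (\<integral>\<^sup>+z\<in>{0<..}. ennreal (min 1 (y / z) powr r) * v z \<partial>lborel)"
  proof (rule nn_integral_mono)
    fix z
    have "min 1 (y / z) powr s \<le> min 1 (y / z) powr r" if "z > 0"
      using that y r by (intro powr_mono') auto
    then show "ennreal (min 1 (y / z) powr s) * v z * indicator {0<..} z
      \<le> ennreal (min 1 (y / z) powr r) * v z * indicator {0<..} z"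
      by (auto split: split_indicator intro!: mult_right_mono ennreal_leI)
  qed
  then show ?thesis
    using y r by (simp add: nn_integral_min_powr)
qed

theorem theorem2p1:
  fixes U W :: "real ^ 'n \<Rightarrow> ennreal"
    and u w :: "real \<Rightarrow> ennreal"
    and p p' q :: real
    and C\<^sub>1 :: ennreal
  assumes U_meas: "U \<in> borel_measurable lebesgue"
    and W_meas: "W \<in> borel_measurable lebesgue"
    and u: "\<And>t. t > 0 \<Longrightarrow> u t = rearrangement lebesgue U t"
    and w: "\<And>t. t > 0 \<Longrightarrow> 1 / w t = rearrangement lebesgue (\<lambda>x. 1 / W x) t"
    and p: "1 < p"
    and q: "0 < q" "q < p"
    and p': "1 / p + 1 / p' = 1"
    and C\<^sub>1: "C\<^sub>1 < \<infinity>"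
    and weight_ineq: "\<And>f :: real \<Rightarrow> ennreal. f \<in> borel_measurable (lebesgue_on {0<..}) \<Longrightarrow>
      (\<integral>\<^sup>+t\<in>{0<..}. (\<integral>\<^sup>+x\<in>{0<..<1 / t}. f x \<partial>lebesgue) epowr q * u t \<partial>lebesgue) epowr (1 / q)
        \<le> C\<^sub>1 * (\<integral>\<^sup>+t\<in>{0<..}. f t epowr p * w t \<partial>lebesgue) epowr (1 / p)"
    and conds:
      "q \<ge> 2
       \<or> (q > 1 \<and> p \<le> 2)
       \<or> (\<exists>\<beta><\<infinity>. \<forall>y>0.
            ennreal (y powr (q / 2)) * (\<integral>\<^sup>+x\<in>{y<..}. u x / ennreal (x powr (q / 2)) \<partial>lebesgue)
              \<le> \<beta> * ((\<integral>\<^sup>+x\<in>{0<..<y}. u x \<partial>lebesgue)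
                  + ennreal (y powr max 1 q)
                    * (\<integral>\<^sup>+x\<in>{y<..}. u x / ennreal (x powr max 1 q) \<partial>lebesgue)))
       \<or> u \<in> B_class (q / 2)
       \<or> (q > 1 \<and> antimono_on {0<..} (\<lambda>t. ennreal (t powr (2 - q)) * u t))
       \<or> (q > 1 \<and> (\<exists>\<beta><\<infinity>. \<forall>y>0.
            ennreal (y powr (p' / 2))
              * (\<integral>\<^sup>+x\<in>{y<..}. w x epowr (1 - p') / ennreal (x powr (p' / 2)) \<partial>lebesgue)
              \<le> \<beta> * ((\<integral>\<^sup>+x\<in>{0<..<y}. w x epowr (1 - p') \<partial>lebesgue)
                  + ennreal (y powr p')
                    * (\<integral>\<^sup>+x\<in>{y<..}. w x epowr (1 - p') / ennreal (x powr p') \<partial>lebesgue))))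
       \<or> (q > 1 \<and> (\<lambda>x. w x epowr (1 - p')) \<in> B_class (p' / 2))
       \<or> (q > 1 \<and> antimono_on {0<..} (\<lambda>t. ennreal (t powr (2 - p')) * w t epowr (1 - p')))"
  shows "\<exists>C<\<infinity>. \<forall>f :: real ^ 'n \<Rightarrow> complex. integrable lebesgue f \<longrightarrow>
      (\<integral>\<^sup>+y. ennreal (cmod (fourier f y)) epowr q * U y \<partial>lebesgue) epowr (1 / q)
        \<le> C * (\<integral>\<^sup>+x. ennreal (cmod (f x)) epowr p * W x \<partial>lebesgue) epowr (1 / p)"
proof -
  \<comment> \<open>\<open>u\<close> and \<open>w\<close> are unspecified outside (0, \<infinity>);
    \<open>u\<^sub>1\<close> and \<open>w\<^sub>1\<close> agree with them there and are Borel on the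
    whole line.\<close>
  define u\<^sub>1 where "u\<^sub>1 = rearrangement lebesgue U"
  define w\<^sub>1 where "w\<^sub>1 t = 1 / rearrangement lebesgue (\<lambda>x. 1 / W x) t" for t
  note [measurable] = U_meas W_meas
  have W_inv[measurable]: "(\<lambda>x. 1 / W x) \<in> borel_measurable lebesgue"
    unfolding one_divide_ennreal by measurable
  have [measurable]: "u\<^sub>1 \<in> borel_measurable borel"
    unfolding u\<^sub>1_def by measurable
  have [measurable]: "w\<^sub>1 \<in> borel_measurable borel"
    unfolding w\<^sub>1_def one_divide_ennreal by measurable
  have u_eq: "u t = u\<^sub>1 t" if "t > 0" for t
    using u[OF that] by (simp add: u\<^sub>1_def)
  have w_eq: "w t = w\<^sub>1 t" if "t > 0" for t
    unfolding w\<^sub>1_def w[OF that, symmetric] by (simp add: one_divide_ennreal epowr_epowr)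
  have u_level: "ennreal \<alpha> \<le> u\<^sub>1 t"
    if "0 < t" "0 < \<alpha>" "ennreal t < emeasure lebesgue {x. U x > ennreal \<alpha>}" for t \<alpha>
    using less_rearrangement_iff[OF U_meas, of t \<alpha>] that by (simp add: u\<^sub>1_def)
  have w_level: "w\<^sub>1 t \<le> ennreal \<alpha>"
    if t: "0 < t" "0 < \<alpha>" "ennreal t < emeasure lebesgue {x. W x \<le> ennreal \<alpha>}" for t \<alpha>
  proof -
    \<comment> \<open>The set {W <= \<alpha>} is {1/W >= 1/\<alpha>}, which is not a strict
      superlevel set, so heights c < 1/\<alpha> are used.\<close>
    have "ennreal (1 / \<alpha>) \<le> rearrangement lebesgue (\<lambda>x. 1 / W x) t"
    proof (rule ccontr)
      assume "\<not> ?thesis"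
      then obtain c where c: "rearrangement lebesgue (\<lambda>x. 1 / W x) t = ennreal c" "c \<ge> 0" "c < 1 / \<alpha>"
        by (cases "rearrangement lebesgue (\<lambda>x. 1 / W x) t") (auto simp: not_le ennreal_less_iff)
      then have "\<not> ennreal t < emeasure lebesgue {x\<in>space lebesgue. 1 / W x > ennreal c}"
        using less_rearrangement_iff[OF W_inv, of t c] t by simp
      moreover have "emeasure lebesgue {x. W x \<le> ennreal \<alpha>} \<le> emeasure lebesgue {x\<in>space lebesgue. 1 / W x > ennreal c}"
      proof (rule emeasure_mono)
        show "{x. W x \<le> ennreal \<alpha>} \<subseteq> {x\<in>space lebesgue. 1 / W x > ennreal c}"
        proof safe
          fix x assume "W x \<le> ennreal \<alpha>"
          then have "ennreal \<alpha> epowr (- 1) \<le> W x epowr (- 1)" by (intro epowr_antimono) auto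
          moreover have "ennreal \<alpha> epowr (- 1) = ennreal (1 / \<alpha>)"
            using t by (simp add: epowr_ennreal powr_minus divide_inverse)
          moreover have "ennreal c < ennreal (1 / \<alpha>)" using c by (simp add: ennreal_less_iff)
          ultimately show "ennreal c < 1 / W x" by (simp add: one_divide_ennreal)
        qed simp
      qed measurable
      ultimately show False using t by (auto simp: not_less)
    qed
    then have "(rearrangement lebesgue (\<lambda>x. 1 / W x) t) epowr (- 1) \<le> ennreal (1 / \<alpha>) epowr (- 1)"
      by (intro epowr_antimono) auto
    also have "\<dots> = ennreal \<alpha>" using t by (simp add: epowr_ennreal powr_minus)
    finally show ?thesis by (simp add: w\<^sub>1_def one_divide_ennreal)
  qed
  have hardy: "(half_int q u\<^sub>1 (hardy f)) epowr (1 / q)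
      \<le> C\<^sub>1 * (half_int p w\<^sub>1 f) epowr (1 / p)"
    if f: "f \<in> borel_measurable borel" for f
  proof -
    have "f \<in> borel_measurable (lebesgue_on {0<..})"
      using f by (intro measurable_restrict_space1 measurable_completion) simp
    from weight_ineq[OF this] show ?thesis
      unfolding nn_integral_completion hardy_def[symmetric]
      by (simp add: set_nn_integral_pos_cong[of "\<lambda>t. hardy f t epowr q * u t" "\<lambda>t. hardy f t epowr q * u\<^sub>1 t"]
          set_nn_integral_pos_cong[of "\<lambda>t. f t epowr p * w t" "\<lambda>t. f t epowr p * w\<^sub>1 t"] u_eq w_eq)
  qed
  note p'_facts = conjugate_exponent[OF p p']
  have p0: "p > 0" using p by simp
  let ?P = "\<lambda>r v. \<exists>\<beta><\<infinity>. \<forall>y>0. ennreal (y powr (r / 2)) * (tail_int (r / 2) v y)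
      \<le> \<beta> * ((head_int v y) + ennreal (y powr r) * (tail_int r v y))"
  let ?\<sigma> = "\<lambda>t. w t epowr (1 - p')" and ?\<sigma>\<^sub>1 = "\<lambda>t. w\<^sub>1 t epowr (1 - p')"
  have \<sigma>_eq: "?\<sigma> t = ?\<sigma>\<^sub>1 t" if "t > 0" for t
    using w_eq[OF that] by simp
  have \<sigma>_meas: "?\<sigma>\<^sub>1 \<in> borel_measurable borel" by measurable
  note direct = fourier_weighted_of_hardy[OF U_meas W_meas _ _ u_level w_level p0 q(1) C\<^sub>1 hardy]
  note dual = fourier_weighted_of_dual_hardy[OF U_meas W_meas _ _ u_level w_level p p' _ C\<^sub>1 hardy]
  have antimono_cong: "antimono_on {0<..} (\<lambda>t. ennreal (t powr r) * b t)"
    if "antimono_on {0<..} (\<lambda>t. ennreal (t powr r) * a t)" "\<And>t. t > 0 \<Longrightarrow> a t = b t" for r a b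
    using that by (simp add: monotone_on_def)
  \<comment> \<open>The first alternative collects (a), (c), (d), (e) and is handled directly; the
    second collects (b), (f), (g), (h) and is handled by duality.\<close>
  have "(q \<ge> 2 \<or> ?P q u\<^sub>1) \<or> (q > 1 \<and> (p' \<ge> 2 \<or> ?P p' ?\<sigma>\<^sub>1))"
    using conds
  proof (elim disjE)
    assume "2 \<le> q"
    then show ?thesis by simp
  next
    assume *: "1 < q \<and> p \<le> 2"
    have "p' \<ge> 2"
    proof -
      have "1 / p \<ge> 1 / 2" using * p by (intro divide_left_mono) auto
      then have "1 / p' \<le> 1 / 2" using p' by linarith
      then show ?thesis using p'_facts(1) by (simp add: divide_le_eq)
    qed
    with * show ?thesis by simp
  next
    assume "\<exists>\<beta><\<infinity>. \<forall>y>0.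
            ennreal (y powr (q / 2)) * (\<integral>\<^sup>+x\<in>{y<..}. u x / ennreal (x powr (q / 2)) \<partial>lebesgue)
              \<le> \<beta> * ((\<integral>\<^sup>+x\<in>{0<..<y}. u x \<partial>lebesgue)
                  + ennreal (y powr max 1 q)
                    * (\<integral>\<^sup>+x\<in>{y<..}. u x / ennreal (x powr max 1 q) \<partial>lebesgue))"
    then obtain \<beta> where \<beta>: "\<beta> < \<infinity>" and le: "\<And>y. y > 0 \<Longrightarrow>
            ennreal (y powr (q / 2)) * (tail_int (q / 2) u y)
              \<le> \<beta> * ((head_int u y)
                  + ennreal (y powr max 1 q)
                    * (\<integral>\<^sup>+x\<in>{y<..}. u x / ennreal (x powr max 1 q) \<partial>lborel))"
      unfolding nn_integral_completion by auto
    have "ennreal (y powr (q / 2)) * (tail_int (q / 2) u\<^sub>1 y)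
      \<le> \<beta> * ((head_int u\<^sub>1 y) + ennreal (y powr q) * (tail_int q u\<^sub>1 y))"
      if y: "y > 0" for y
    proof -
      have cong: "(tail_int s u y) = (tail_int s u\<^sub>1 y)"
        "(head_int u y) = (head_int u\<^sub>1 y)" for s
        using y by (auto intro!: set_nn_integral_pos_cong simp: u_eq)
      show ?thesis
        using le[OF y] unfolding cong
        by (rule order_trans) (use y q in \<open>intro mult_left_mono weight_cond_le_exponent, auto\<close>)
    qed
    with \<beta> show ?thesis by blast
  next
    assume "u \<in> B_class (q / 2)"
    then have "u\<^sub>1 \<in> B_class (q / 2)" using B_class_cong[of u u\<^sub>1] u_eq by blast
    then show ?thesis by (intro disjI1 disjI2 B_classD)
  next
    assume *: "1 < q \<and> antimono_on {0<..} (\<lambda>t. ennreal (t powr (2 - q)) * u t)"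
    show ?thesis
    \<comment> \<open>The passage to the class is made for 1 < q < 2; for larger q the first
      alternative holds outright. The same division is made for p' in (h).\<close>
    proof (cases "q \<ge> 2")
      case False
      have "u\<^sub>1 \<in> B_class (q / 2)"
        using * False antimono_cong[of "2 - q" u u\<^sub>1] u_eq by (intro B_class_of_antimono) auto
      then show ?thesis by (intro disjI1 disjI2 B_classD)
    qed simp
  next
    assume *: "q > 1 \<and> (\<exists>\<beta><\<infinity>. \<forall>y>0.
            ennreal (y powr (p' / 2))
              * (\<integral>\<^sup>+x\<in>{y<..}. w x epowr (1 - p') / ennreal (x powr (p' / 2)) \<partial>lebesgue)
              \<le> \<beta> * ((\<integral>\<^sup>+x\<in>{0<..<y}. w x epowr (1 - p') \<partial>lebesgue)
                  + ennreal (y powr p')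
                    * (\<integral>\<^sup>+x\<in>{y<..}. w x epowr (1 - p') / ennreal (x powr p') \<partial>lebesgue)))"
    have cong: "(tail_int s ?\<sigma> y) = (tail_int s ?\<sigma>\<^sub>1 y)"
      "(head_int ?\<sigma> y) = (head_int ?\<sigma>\<^sub>1 y)" if "y > 0" for y s
      using that by (auto intro!: set_nn_integral_pos_cong simp: w_eq)
    have "?P p' ?\<sigma>\<^sub>1"
      using * unfolding nn_integral_completion by (simp add: cong)
    with * show ?thesis by blast
  next
    assume *: "q > 1 \<and> ?\<sigma> \<in> B_class (p' / 2)"
    then have "?\<sigma>\<^sub>1 \<in> B_class (p' / 2)" using B_class_cong[of ?\<sigma> ?\<sigma>\<^sub>1] \<sigma>_eq by blast
    with * show ?thesis by (intro disjI2 conjI B_classD) auto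
  next
    assume *: "q > 1 \<and> antimono_on {0<..} (\<lambda>t. ennreal (t powr (2 - p')) * w t epowr (1 - p'))"
    show ?thesis
    proof (cases "p' \<ge> 2")
      case False
      have "?\<sigma>\<^sub>1 \<in> B_class (p' / 2)"
        using * False p'_facts antimono_cong[of "2 - p'" ?\<sigma> ?\<sigma>\<^sub>1] \<sigma>_eq \<sigma>_meas
        by (intro B_class_of_antimono) auto
      with * show ?thesis by (intro disjI2 conjI B_classD) auto
    qed (use * in simp)
  qed
  then show ?thesis
  proof
    assume "q \<ge> 2 \<or> ?P q u\<^sub>1"
    then show ?thesis by (intro direct) simp_all
  next
    assume "q > 1 \<and> (p' \<ge> 2 \<or> ?P p' ?\<sigma>\<^sub>1)"
    then show ?thesis by (intro dual) simp_all
  qed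
qed

end
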